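(* Let $(R,\mathfrak m)$ be a complete Noetherian local ring, $\mathfrak a$ a proper ideal of $R$, and $M$ a relative Cohen-Macaulay $R$-module with respect to $\mathfrak a$ with $\operatorname{cd}(\mathfrak a,M)=c>0$ and $\operatorname{Supp}_R(M/\mathfrak aM)\subseteq V(\mathfrak m)$. Then $\mathfrak a$ contains a regular element on $D_R(H^c_{\mathfrak a}(M))$.
   Context: $H^i_{\mathfrak a}(M)$ is the $i$-th local cohomology module of $M$ with respect to $\mathfrak a$, and $\operatorname{cd}(\mathfrak a,M)=\sup\{i\in\mathbb Z\mid H^i_{\mathfrak a}(M)\neq0\}$. A finitely generated $R$-module $M$ is relative Cohen-Macaulay with respect to $\mathfrak a$ if there is precisely one $i$ with $H^i_{\mathfrak a}(M)\ne0$; equivalently, $\operatorname{grade}(\mathfrak a,M)=\operatorname{cd}(\mathfrak a,M)$ (relative Cohen-Macaulay modules are thus finitely generated by definition). $D_R(-)=\operatorname{Hom}_R(-,E_R(R/\mathfrak m))$ is the Matlis duality functor, and $V(I)$ is the set of prime ideals of $R$ containing $I$. *)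

theory Defs
  imports "HOL-Algebra.Ring_Divisibility" "HOL-Algebra.Ideal_Product" "HOL-Algebra.Module"
    "HOL-Library.Extended_Real"
begin

section \<open>Rings\<close>

definition noetherian_local_ring :: "('r, 'k) ring_scheme \<Rightarrow> 'r set \<Rightarrow> bool" where
  "noetherian_local_ring R \<mm> \<longleftrightarrow>
     cring R \<and> noetherian_ring R \<and> {J. maximalideal J R} = {\<mm>}"

text \<open>The power \<open>I\<^sup>n\<close> of an ideal, with \<open>I\<^sup>0 = R\<close>.\<close>

abbreviation ideal_power :: "('r, 'k) ring_scheme \<Rightarrow> 'r set \<Rightarrow> nat \<Rightarrow> 'r set" where
  "ideal_power R I n \<equiv> I [^]\<^bsub>ideals_set R\<^esub> n"

text \<open>Complete includes separated: every Cauchy sequence of the \<open>I\<close>-adic topology has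
  exactly one limit.\<close>

definition adically_complete :: "('r, 'k) ring_scheme \<Rightarrow> 'r set \<Rightarrow> bool" where
  "adically_complete R I \<longleftrightarrow>
     (\<Inter>n. ideal_power R I n) = {\<zero>\<^bsub>R\<^esub>} \<and>
     (\<forall>x :: nat \<Rightarrow> 'r. (\<forall>n. x n \<in> carrier R) \<and>
          (\<forall>k. \<exists>N. \<forall>i\<ge>N. \<forall>j\<ge>N. x i \<ominus>\<^bsub>R\<^esub> x j \<in> ideal_power R I k) \<longrightarrow>
          (\<exists>y\<in>carrier R. \<forall>k. \<exists>N. \<forall>i\<ge>N. x i \<ominus>\<^bsub>R\<^esub> y \<in> ideal_power R I k))"

definition prime_zero_locus :: "('r, 'k) ring_scheme \<Rightarrow> 'r set \<Rightarrow> 'r set set" where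
  "prime_zero_locus R I = {p. primeideal p R \<and> I \<subseteq> p}"

section \<open>Modules\<close>

text \<open>A module record inherits the fields \<^term>\<open>monoid.mult\<close> and \<^term>\<open>monoid.one\<close> from
  rings; they play no role in a module and are left \<^term>\<open>undefined\<close> in the constructions below.\<close>

definition self_module :: "('r, 'k) ring_scheme \<Rightarrow> ('r, 'r) module" where
  "self_module R =
     \<lparr>carrier = carrier R, monoid.mult = undefined, monoid.one = undefined,
      ring.zero = \<zero>\<^bsub>R\<^esub>, ring.add = (\<oplus>\<^bsub>R\<^esub>), module.smult = (\<otimes>\<^bsub>R\<^esub>)\<rparr>"

definition quotient_module :: "('r, 'a) module \<Rightarrow> 'a set \<Rightarrow> ('r, 'a set) module" where
  "quotient_module M N =
     \<lparr>carrier = a_rcosets\<^bsub>M\<^esub> N, monoid.mult = undefined, monoid.one = undefined,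
      ring.zero = N, ring.add = (<+>\<^bsub>M\<^esub>), module.smult = (\<lambda>r C. \<Union>x\<in>C. N +>\<^bsub>M\<^esub> (r \<odot>\<^bsub>M\<^esub> x))\<rparr>"

definition module_span :: "('r, 'k) ring_scheme \<Rightarrow> ('r, 'a) module \<Rightarrow> 'a set \<Rightarrow> 'a set" where
  "module_span R M S = \<Inter>{N. submodule N R M \<and> S \<subseteq> N}"

definition finitely_generated_module :: "('r, 'k) ring_scheme \<Rightarrow> ('r, 'a) module \<Rightarrow> bool" where
  "finitely_generated_module R M \<longleftrightarrow>
     module R M \<and> (\<exists>S. finite S \<and> S \<subseteq> carrier M \<and> module_span R M S = carrier M)"

definition ideal_smult ::
  "('r, 'k) ring_scheme \<Rightarrow> 'r set \<Rightarrow> ('r, 'a) module \<Rightarrow> 'a set" where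
  "ideal_smult R I M = module_span R M {r \<odot>\<^bsub>M\<^esub> x |r x. r \<in> I \<and> x \<in> carrier M}"

definition linear_map ::
  "('r, 'k) ring_scheme \<Rightarrow> ('r, 'a) module \<Rightarrow> ('r, 'b) module \<Rightarrow> ('a \<Rightarrow> 'b) \<Rightarrow> bool" where
  "linear_map R M N f \<longleftrightarrow>
     f \<in> carrier M \<rightarrow> carrier N \<and>
     (\<forall>x\<in>carrier M. \<forall>y\<in>carrier M. f (x \<oplus>\<^bsub>M\<^esub> y) = f x \<oplus>\<^bsub>N\<^esub> f y) \<and>
     (\<forall>r\<in>carrier R. \<forall>x\<in>carrier M. f (r \<odot>\<^bsub>M\<^esub> x) = r \<odot>\<^bsub>N\<^esub> f x)"

definition Hom_module ::
  "('r, 'k) ring_scheme \<Rightarrow> ('r, 'a) module \<Rightarrow> ('r, 'b) module \<Rightarrow> ('r, 'a \<Rightarrow> 'b) module" where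
  "Hom_module R M N =
     \<lparr>carrier = {f \<in> extensional (carrier M). linear_map R M N f},
      monoid.mult = undefined, monoid.one = undefined,
      ring.zero = (\<lambda>x\<in>carrier M. \<zero>\<^bsub>N\<^esub>),
      ring.add = (\<lambda>f g. \<lambda>x\<in>carrier M. f x \<oplus>\<^bsub>N\<^esub> g x),
      module.smult = (\<lambda>r f. \<lambda>x\<in>carrier M. r \<odot>\<^bsub>N\<^esub> f x)\<rparr>"

definition regular_element ::
  "('r, 'k) ring_scheme \<Rightarrow> ('r, 'a) module \<Rightarrow> 'r \<Rightarrow> bool" where
  "regular_element R M r \<longleftrightarrow>
     r \<in> carrier R \<and> (\<forall>x\<in>carrier M. r \<odot>\<^bsub>M\<^esub> x = \<zero>\<^bsub>M\<^esub> \<longrightarrow> x = \<zero>\<^bsub>M\<^esub>)"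

text \<open>Fractions \<open>x/s\<close> with \<open>s \<notin> p\<close>; the classes of the relation form the localization \<open>M\<^sub>p\<close>,
  whose zero is the class of \<open>0/1\<close>.\<close>

definition fraction_rel ::
  "('r, 'k) ring_scheme \<Rightarrow> 'r set \<Rightarrow> ('r, 'a) module \<Rightarrow> (('a \<times> 'r) \<times> ('a \<times> 'r)) set" where
  "fraction_rel R p M =
     {((x, s), (y, t)) |x s y t.
        x \<in> carrier M \<and> y \<in> carrier M \<and> s \<in> carrier R - p \<and> t \<in> carrier R - p \<and>
        (\<exists>u\<in>carrier R - p. u \<odot>\<^bsub>M\<^esub> (t \<odot>\<^bsub>M\<^esub> x \<ominus>\<^bsub>M\<^esub> s \<odot>\<^bsub>M\<^esub> y) = \<zero>\<^bsub>M\<^esub>)}"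

definition localization_carrier ::
  "('r, 'k) ring_scheme \<Rightarrow> 'r set \<Rightarrow> ('r, 'a) module \<Rightarrow> ('a \<times> 'r) set set" where
  "localization_carrier R p M = (carrier M \<times> (carrier R - p)) // fraction_rel R p M"

definition Supp :: "('r, 'k) ring_scheme \<Rightarrow> ('r, 'a) module \<Rightarrow> 'r set set" where
  "Supp R M =
     {p. primeideal p R \<and>
         localization_carrier R p M \<noteq> {fraction_rel R p M `` {(\<zero>\<^bsub>M\<^esub>, \<one>\<^bsub>R\<^esub>)}}}"

section \<open>Injective modules, injective hulls, Matlis duality\<close>

text \<open>HOL cannot quantify over the carrier types of the test modules \<open>A\<close>, \<open>B\<close> inside a formula,
  so these range over all modules whose carrier is a set of elements of the type \<open>'r\<close> of \<open>R\<close>.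
  As this includes the inclusions of ideals into \<open>R\<close>, Baer's criterion shows that the
  extension property then holds for test modules over arbitrary types.\<close>

definition injective_module :: "('r, 'k) ring_scheme \<Rightarrow> ('r, 'b) module \<Rightarrow> bool" where
  "injective_module R E \<longleftrightarrow>
     module R E \<and>
     (\<forall>(A :: ('r, 'r) module) (B :: ('r, 'r) module) f g.
        module R A \<and> module R B \<and>
        linear_map R A B f \<and> inj_on f (carrier A) \<and> linear_map R A E g \<longrightarrow>
        (\<exists>h. linear_map R B E h \<and> (\<forall>x\<in>carrier A. h (f x) = g x)))"

definition injective_hull ::
  "('r, 'k) ring_scheme \<Rightarrow> ('r, 'a) module \<Rightarrow> ('a \<Rightarrow> 'e) \<Rightarrow> ('r, 'e) module \<Rightarrow> bool" where
  "injective_hull R M \<iota> E \<longleftrightarrow>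
     injective_module R E \<and> linear_map R M E \<iota> \<and> inj_on \<iota> (carrier M) \<and>
     (\<forall>N. submodule N R E \<and> N \<inter> \<iota> ` carrier M = {\<zero>\<^bsub>E\<^esub>} \<longrightarrow> N = {\<zero>\<^bsub>E\<^esub>})"

abbreviation residue_field_module ::
  "('r, 'k) ring_scheme \<Rightarrow> 'r set \<Rightarrow> ('r, 'r set) module" where
  "residue_field_module R \<mm> \<equiv> quotient_module (self_module R) \<mm>"

text \<open>\<open>E\<close> is meant to be an injective hull of the residue field.\<close>

definition Matlis_dual ::
  "('r, 'k) ring_scheme \<Rightarrow> ('r, 'e) module \<Rightarrow> ('r, 'a) module \<Rightarrow> ('r, 'a \<Rightarrow> 'e) module" where
  "Matlis_dual R E N = Hom_module R N E"

section \<open>Local cohomology\<close>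

definition injective_resolution ::
  "('r, 'k) ring_scheme \<Rightarrow> ('r, 'a) module \<Rightarrow> ('a \<Rightarrow> 'b) \<Rightarrow>
   (nat \<Rightarrow> ('r, 'b) module) \<Rightarrow> (nat \<Rightarrow> 'b \<Rightarrow> 'b) \<Rightarrow> bool" where
  "injective_resolution R M \<epsilon> I d \<longleftrightarrow>
     (\<forall>i. injective_module R (I i)) \<and>
     linear_map R M (I 0) \<epsilon> \<and> inj_on \<epsilon> (carrier M) \<and>
     (\<forall>i. linear_map R (I i) (I (Suc i)) (d i)) \<and>
     \<epsilon> ` carrier M = {x \<in> carrier (I 0). d 0 x = \<zero>\<^bsub>I 1\<^esub>} \<and>
     (\<forall>i. d i ` carrier (I i) =
          {x \<in> carrier (I (Suc i)). d (Suc i) x = \<zero>\<^bsub>I (Suc (Suc i))\<^esub>})"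

text \<open>The functor \<open>\<Gamma>\<^sub>\<aa>\<close> on objects; on maps it is restriction.\<close>

definition torsion_part ::
  "('r, 'k) ring_scheme \<Rightarrow> 'r set \<Rightarrow> ('r, 'a) module \<Rightarrow> 'a set" where
  "torsion_part R \<aa> M =
     {x \<in> carrier M. \<exists>n. \<forall>r\<in>ideal_power R \<aa> n. r \<odot>\<^bsub>M\<^esub> x = \<zero>\<^bsub>M\<^esub>}"

definition torsion_cocycles ::
  "('r, 'k) ring_scheme \<Rightarrow> 'r set \<Rightarrow> (nat \<Rightarrow> ('r, 'b) module) \<Rightarrow> (nat \<Rightarrow> 'b \<Rightarrow> 'b) \<Rightarrow>
   nat \<Rightarrow> 'b set" where
  "torsion_cocycles R \<aa> I d i = {x \<in> torsion_part R \<aa> (I i). d i x = \<zero>\<^bsub>I (Suc i)\<^esub>}"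

fun torsion_coboundaries ::
  "('r, 'k) ring_scheme \<Rightarrow> 'r set \<Rightarrow> (nat \<Rightarrow> ('r, 'b) module) \<Rightarrow> (nat \<Rightarrow> 'b \<Rightarrow> 'b) \<Rightarrow>
   nat \<Rightarrow> 'b set" where
  "torsion_coboundaries R \<aa> I d 0 = {\<zero>\<^bsub>I 0\<^esub>}"
| "torsion_coboundaries R \<aa> I d (Suc i) = d i ` torsion_part R \<aa> (I i)"

text \<open>The right derived functors of \<open>\<Gamma>\<^sub>\<aa>\<close>: if \<open>(I, d)\<close> is an injective resolution of \<open>M\<close>, this
  is \<open>H\<^sup>i(\<Gamma>\<^sub>\<aa>(I)) = H\<^sup>i\<^sub>\<aa>(M)\<close>. The module is determined by \<open>M\<close> up to isomorphism only, so the
  resolution it is computed from is a parameter, here and in the notions derived from it.\<close>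

definition local_cohomology ::
  "('r, 'k) ring_scheme \<Rightarrow> 'r set \<Rightarrow> (nat \<Rightarrow> ('r, 'b) module) \<Rightarrow> (nat \<Rightarrow> 'b \<Rightarrow> 'b) \<Rightarrow>
   nat \<Rightarrow> ('r, 'b set) module" where
  "local_cohomology R \<aa> I d i =
     quotient_module ((I i)\<lparr>carrier := torsion_cocycles R \<aa> I d i\<rparr>)
       (torsion_coboundaries R \<aa> I d i)"

definition nonzero_module :: "('r, 'a) module \<Rightarrow> bool" where
  "nonzero_module M \<longleftrightarrow> carrier M \<noteq> {\<zero>\<^bsub>M\<^esub>}"

text \<open>Local cohomology vanishes in negative degrees; the supremum of the empty set is \<open>-\<infinity>\<close>.\<close>

definition cohomological_dimension ::
  "('r, 'k) ring_scheme \<Rightarrow> 'r set \<Rightarrow> (nat \<Rightarrow> ('r, 'b) module) \<Rightarrow> (nat \<Rightarrow> 'b \<Rightarrow> 'b) \<Rightarrow> ereal"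
  where
  "cohomological_dimension R \<aa> I d =
     Sup {ereal (real i) |i. nonzero_module (local_cohomology R \<aa> I d i)}"

definition relative_Cohen_Macaulay ::
  "('r, 'k) ring_scheme \<Rightarrow> 'r set \<Rightarrow> ('r, 'a) module \<Rightarrow>
   (nat \<Rightarrow> ('r, 'b) module) \<Rightarrow> (nat \<Rightarrow> 'b \<Rightarrow> 'b) \<Rightarrow> bool" where
  "relative_Cohen_Macaulay R \<aa> M I d \<longleftrightarrow>
     finitely_generated_module R M \<and>
     (\<exists>!i. nonzero_module (local_cohomology R \<aa> I d i))"

end

theory Submission
  imports Defs
begin

text \<open>
  If \<open>x\<close> acts surjectively on \<open>H = H\<^sup>c\<^sub>\<aa>(M)\<close>, then it is regular on \<open>Hom(H, E)\<close>, so we need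
  \<open>x \<in> \<aa>\<close> with \<open>xH = H\<close>. For Artinian \<open>H\<close> with \<open>\<aa>H = H\<close> such an \<open>x\<close> is supplied by prime avoidance
  for the primes of a secondary decomposition.

  Both properties of \<open>H\<close> come from the Koszul complex on generators \<open>x\<^sub>1, \<dots>, x\<^sub>n\<close> of \<open>\<aa>\<close>. Its
  cohomologies with coefficients in \<open>\<Gamma>\<^sub>\<aa>(I)\<close> and in \<open>I\<close> agree, because \<open>x\<^sub>j\<close> acts bijectively on
  \<open>\<Gamma>/\<Gamma>\<^sub>x\<^sub>j(\<Gamma>)\<close> for \<open>\<Gamma> = \<Gamma>\<^sub>x\<^sub>1\<dots>\<Gamma>\<^sub>x\<^sub>j\<^sub>-\<^sub>1(I)\<close>. As \<open>H\<close> is the only cohomology of \<open>\<Gamma>\<^sub>\<aa>(I)\<close>, its \<open>i\<close>-th Koszul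
  cohomology is the \<open>(i + c)\<close>-th one of \<open>M\<close>. In degree \<open>i = n\<close> this gives \<open>H/\<aa>H = 0\<close>, since
  \<open>c > 0\<close>. In degree \<open>i = 0\<close> it shows that \<open>0 :\<^sub>H \<aa>\<close> is finitely generated and supported in
  \<open>Supp(M/\<aa>M) \<subseteq> {\<mm>}\<close>, hence Artinian; as \<open>H\<close> is \<open>\<aa>\<close>-torsion, it is Artinian by
  Melkersson's criterion.
\<close>

text \<open>Cohomology is never formed as a quotient: a pair \<open>Z\<close>, \<open>B\<close> of
  submodules of one ambient module stands for Z/B, and chain conditions or local vanishing travel
  along sequences of such pairs that are exact in the middle. The Koszul complex is an iterated
  mapping cone, so each fact about it is an induction with one cone per generator. As the cones are
  not shifted, the complex on n generators reaches n degrees downwards: H/aH sits in degree c and 0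
  :_H a in degree c - n, while the Koszul cohomology of M lives in degrees -n to 0, whence its
  vanishing in degree c > 0. Of the comparison between the torsion subcomplex and the resolution,
  the injective direction is the one that carries vanishing and finiteness over to H. Melkersson's
  criterion serves twice: for generators of m it reduces 0 :_H a to its part killed by m, a
  finite-dimensional vector space, and for generators of a it then reaches H. Prime avoidance
  applies because Nakayama's lemma with aH = H leaves only secondary summands whose primes do not
  contain a.\<close>

section \<open>Submodules and linear maps\<close>

lemma submodule_carrier: "submodule N R X \<Longrightarrow> x \<in> N \<Longrightarrow> x \<in> carrier X"
  using subgroup.mem_carrier[OF submodule.axioms(1)] by fastforce

lemma submodule_zero: "submodule N R X \<Longrightarrow> \<zero>\<^bsub>X\<^esub> \<in> N"
  using subgroup.one_closed[OF submodule.axioms(1)] by fastforce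

lemma submodule_add: "submodule N R X \<Longrightarrow> x \<in> N \<Longrightarrow> y \<in> N \<Longrightarrow> x \<oplus>\<^bsub>X\<^esub> y \<in> N"
  using subgroup.m_closed[OF submodule.axioms(1)] by fastforce

lemma submodule_neg: "submodule N R X \<Longrightarrow> x \<in> N \<Longrightarrow> \<ominus>\<^bsub>X\<^esub> x \<in> N"
  using subgroup.m_inv_closed[OF submodule.axioms(1)] by (fastforce simp: a_inv_def)

lemma submodule_diff: "submodule N R X \<Longrightarrow> x \<in> N \<Longrightarrow> y \<in> N \<Longrightarrow> x \<ominus>\<^bsub>X\<^esub> y \<in> N"
  unfolding a_minus_def by (intro submodule_add submodule_neg)

lemma submodule_smult: "submodule N R X \<Longrightarrow> r \<in> carrier R \<Longrightarrow> x \<in> N \<Longrightarrow> r \<odot>\<^bsub>X\<^esub> x \<in> N"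
  by (rule submodule.smult_closed)

lemmas submoduleD = submodule_carrier submodule_zero submodule_add submodule_neg submodule_diff
  submodule_smult

text \<open>Negation is the action of the scalar -1, so closure under addition and scalars is all
  that has to be checked.\<close>

lemma submodule_of_closed:
  fixes X (structure)
  assumes "module R X" "N \<subseteq> carrier X" "\<zero> \<in> N"
    and "\<And>x y. x \<in> N \<Longrightarrow> y \<in> N \<Longrightarrow> x \<oplus> y \<in> N"
    and "\<And>r x. r \<in> carrier R \<Longrightarrow> x \<in> N \<Longrightarrow> r \<odot> x \<in> N"
  shows "submodule N R X"
proof -
  interpret module R X by fact
  have "\<ominus> x \<in> N" if "x \<in> N" for x
    using assms(5)[of "\<ominus>\<^bsub>R\<^esub> \<one>\<^bsub>R\<^esub>" x] that assms(2) smult_l_minus[of "\<one>\<^bsub>R\<^esub>" x] by auto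
  then show ?thesis by (intro submoduleI) (use assms in auto)
qed

lemma submodule_zero_singleton: "module R X \<Longrightarrow> submodule {\<zero>\<^bsub>X\<^esub>} R X"
proof -
  assume "module R X"
  then interpret module R X .
  show ?thesis by (rule submodule_of_closed) (auto simp: module_axioms)
qed

lemma submodule_sum:
  fixes X (structure)
  assumes "module R X" "submodule A R X" "submodule B R X"
  shows "submodule {a \<oplus> b |a b. a \<in> A \<and> b \<in> B} R X" (is "submodule ?S R X")
proof -
  interpret module R X by fact
  note A = submoduleD[OF assms(2)] and B = submoduleD[OF assms(3)]
  show ?thesis
  proof (rule submodule_of_closed)
    show "\<zero> \<in> ?S" using A(2) B(2) by force
  next
    fix x y assume "x \<in> ?S" "y \<in> ?S"
    then obtain a b a' b' where *: "a \<in> A" "b \<in> B" "a' \<in> A" "b' \<in> B"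
      and xy: "x = a \<oplus> b" "y = a' \<oplus> b'" by blast
    have "x \<oplus> y = (a \<oplus> a') \<oplus> (b \<oplus> b')"
      using * A(1) B(1) unfolding xy by (simp add: M.a_ac)
    then show "x \<oplus> y \<in> ?S" using * A(3) B(3) by blast
  next
    fix r x assume r: "r \<in> carrier R" and "x \<in> ?S"
    then obtain a b where *: "a \<in> A" "b \<in> B" and x: "x = a \<oplus> b" by blast
    have "r \<odot> x = r \<odot> a \<oplus> r \<odot> b"
      using * A(1) B(1) r unfolding x by (simp add: smult_r_distr)
    then show "r \<odot> x \<in> ?S" using * r A(6) B(6) by blast
  qed (use assms(1) A(1) B(1) in auto)
qed

lemma linear_mapD:
  assumes "linear_map R X Y f"
  shows "x \<in> carrier X \<Longrightarrow> f x \<in> carrier Y"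
    and "x \<in> carrier X \<Longrightarrow> y \<in> carrier X \<Longrightarrow> f (x \<oplus>\<^bsub>X\<^esub> y) = f x \<oplus>\<^bsub>Y\<^esub> f y"
    and "r \<in> carrier R \<Longrightarrow> x \<in> carrier X \<Longrightarrow> f (r \<odot>\<^bsub>X\<^esub> x) = r \<odot>\<^bsub>Y\<^esub> f x"
  using assms unfolding linear_map_def by auto

lemma linear_map_zero_neg_diff:
  fixes X (structure)
  assumes "module R X" "module R Y" "linear_map R X Y f"
  shows "f \<zero> = \<zero>\<^bsub>Y\<^esub>"
    and "x \<in> carrier X \<Longrightarrow> f (\<ominus> x) = \<ominus>\<^bsub>Y\<^esub> f x"
    and "x \<in> carrier X \<Longrightarrow> y \<in> carrier X \<Longrightarrow> f (x \<ominus> y) = f x \<ominus>\<^bsub>Y\<^esub> f y"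
proof -
  interpret X: module R X by fact
  interpret Y: module R Y by fact
  note f = linear_mapD[OF assms(3)]
  show 0: "f \<zero> = \<zero>\<^bsub>Y\<^esub>"
    using f(3)[of "\<zero>\<^bsub>R\<^esub>" "\<zero>"] f(1)[of "\<zero>"] by simp
  show n: "f (\<ominus> x) = \<ominus>\<^bsub>Y\<^esub> f x" if "x \<in> carrier X" for x
    using f(3)[of "\<ominus>\<^bsub>R\<^esub> \<one>\<^bsub>R\<^esub>" x] f(1)[of x] that
      X.smult_l_minus[of "\<one>\<^bsub>R\<^esub>" x] Y.smult_l_minus[of "\<one>\<^bsub>R\<^esub>" "f x"] by simp
  show "f (x \<ominus> y) = f x \<ominus>\<^bsub>Y\<^esub> f y" if "x \<in> carrier X" "y \<in> carrier X"
    using that n[of y] by (simp add: a_minus_def f(2))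
qed

lemma linear_map_smult:
  assumes "module R X" "r \<in> carrier R"
  shows "linear_map R X X (\<lambda>x. r \<odot>\<^bsub>X\<^esub> x)"
proof -
  interpret module R X by fact
  show ?thesis unfolding linear_map_def
    using assms(2) by (auto simp: smult_r_distr smult_assoc1[symmetric] R.m_comm)
qed

lemma linear_map_id: "linear_map R X X (\<lambda>x. x)"
  unfolding linear_map_def by auto

lemma submodule_image:
  assumes "module R X" "module R Y" "linear_map R X Y f" "submodule N R X"
  shows "submodule (f ` N) R Y"
proof -
  interpret X: module R X by fact
  interpret Y: module R Y by fact
  note f = linear_mapD[OF assms(3)] and N = submoduleD[OF assms(4)]
  show ?thesis
  proof (rule submodule_of_closed)
    show "\<zero>\<^bsub>Y\<^esub> \<in> f ` N" using linear_map_zero_neg_diff(1)[OF assms(1-3)] N(2) by (metis image_eqI)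
    show "x \<oplus>\<^bsub>Y\<^esub> y \<in> f ` N" if "x \<in> f ` N" "y \<in> f ` N" for x y
      using that N(1,3) f(2) by (smt (verit) image_iff)
    show "r \<odot>\<^bsub>Y\<^esub> x \<in> f ` N" if "r \<in> carrier R" "x \<in> f ` N" for r x
      using that N(1,6) f(3) by (smt (verit) image_iff)
  qed (use assms f N in auto)
qed

lemma submodule_preimage:
  assumes "module R X" "module R Y" "linear_map R X Y f" "submodule Z R X" "submodule N R Y"
  shows "submodule {x \<in> Z. f x \<in> N} R X"
proof -
  note f = linear_mapD[OF assms(3)] and N = submoduleD[OF assms(5)] and Z = submoduleD[OF assms(4)]
  show ?thesis
    by (rule submodule_of_closed)
      (use assms(1) f N Z linear_map_zero_neg_diff(1)[OF assms(1-3)] in auto)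
qed

lemma submodule_kernel:
  assumes "module R X" "module R Y" "linear_map R X Y f" "submodule Z R X"
  shows "submodule {x \<in> Z. f x = \<zero>\<^bsub>Y\<^esub>} R X"
  using submodule_preimage[OF assms submodule_zero_singleton[OF assms(2)]] by simp


section \<open>Subquotients\<close>

text \<open>The ascending chain condition for Z/B, stated through the correspondence between
  submodules of Z/B and submodules lying between \<open>B\<close> and \<open>Z\<close>. All
  subquotients of one module thereby share its type.\<close>

definition noetherian_subquotient ::
  "('r, 'k) ring_scheme \<Rightarrow> ('r, 'x) module \<Rightarrow> 'x set \<Rightarrow> 'x set \<Rightarrow> bool" where
  "noetherian_subquotient R X Z B \<longleftrightarrow>
     (\<forall>N. (\<forall>i. submodule (N i) R X \<and> B \<subseteq> N i \<and> N i \<subseteq> Z \<and> N i \<subseteq> N (Suc i)) \<longrightarrow>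
          (\<exists>i. \<forall>j\<ge>i. N j = N i))"

definition artinian_subquotient ::
  "('r, 'k) ring_scheme \<Rightarrow> ('r, 'x) module \<Rightarrow> 'x set \<Rightarrow> 'x set \<Rightarrow> bool" where
  "artinian_subquotient R X Z B \<longleftrightarrow>
     (\<forall>N. (\<forall>i. submodule (N i) R X \<and> B \<subseteq> N i \<and> N i \<subseteq> Z \<and> N (Suc i) \<subseteq> N i) \<longrightarrow>
          (\<exists>i. \<forall>j\<ge>i. N j = N i))"

text \<open>The localization of \<open>Z/B\<close> at the prime \<open>p\<close> vanishes.\<close>

definition locally_zero_subquotient ::
  "('r, 'k) ring_scheme \<Rightarrow> 'r set \<Rightarrow> ('r, 'x) module \<Rightarrow> 'x set \<Rightarrow> 'x set \<Rightarrow> bool" where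
  "locally_zero_subquotient R p X Z B \<longleftrightarrow> (\<forall>z\<in>Z. \<exists>u\<in>carrier R - p. u \<odot>\<^bsub>X\<^esub> z \<in> B)"

lemma noetherian_subquotientD:
  assumes "noetherian_subquotient R X Z B"
    and "\<And>i. submodule (N i) R X" "\<And>i. B \<subseteq> N i" "\<And>i. N i \<subseteq> Z" "\<And>i. N i \<subseteq> N (Suc i)"
  obtains i where "\<And>j. j \<ge> i \<Longrightarrow> N j = N i"
  using assms unfolding noetherian_subquotient_def by meson

lemma artinian_subquotientD:
  assumes "artinian_subquotient R X Z B"
    and "\<And>i. submodule (N i) R X" "\<And>i. B \<subseteq> N i" "\<And>i. N i \<subseteq> Z" "\<And>i. N (Suc i) \<subseteq> N i"
  obtains i where "\<And>j. j \<ge> i \<Longrightarrow> N j = N i"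
  using assms unfolding artinian_subquotient_def by meson

text \<open>Exactness in the middle of Z1/B1 -> Z/B -> Z2/B2, in the form "kernel inside image" that
  lets a property of both outer terms pass to the middle one. For \<open>B2 = Z2\<close> it says
  that \<alpha> is onto modulo \<open>B\<close>; for zero \<open>Z1\<close> and \<open>B1\<close> it
  says that \<beta> is injective on Z/B.\<close>

locale exact_subquotients =
  X1: module R X1 + X: module R X + X2: module R X2
  for R :: "('r, 'k) ring_scheme" (structure)
    and X1 :: "('r, 'x) module" and X :: "('r, 'y) module" and X2 :: "('r, 'z) module" +
  fixes Z1 B1 \<alpha> Z B \<beta> Z2 B2
  assumes Z1: "submodule Z1 R X1" and Z: "submodule Z R X"
    and B: "submodule B R X"
    and B2: "submodule B2 R X2" "B2 \<subseteq> Z2" and Z2: "submodule Z2 R X2"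
    and \<alpha>: "linear_map R X1 X \<alpha>" "\<alpha> ` B1 \<subseteq> B" "B1 \<subseteq> Z1"
    and \<beta>: "linear_map R X X2 \<beta>" "\<beta> ` Z \<subseteq> Z2" "\<beta> ` B \<subseteq> B2"
    and ex: "\<And>z. z \<in> Z \<Longrightarrow> \<beta> z \<in> B2 \<Longrightarrow> \<exists>z1\<in>Z1. \<exists>b\<in>B. z = \<alpha> z1 \<oplus>\<^bsub>X\<^esub> b"
begin

text \<open>Within a chain, a submodule is determined by its preimage under \<alpha> and its image
  under \<beta>. Once both are stationary, an element n of a later member has the same image modulo
  \<open>B2\<close> as some n' of the earlier one, and the difference lifts to \<open>Z1\<close>,
  where nothing grows any more.\<close>

lemma noetherian_middle:
  assumes "noetherian_subquotient R X1 Z1 B1" "noetherian_subquotient R X2 Z2 B2"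
  shows "noetherian_subquotient R X Z B"
  unfolding noetherian_subquotient_def
proof (intro allI impI)
  fix N assume N: "\<forall>i. submodule (N i) R X \<and> B \<subseteq> N i \<and> N i \<subseteq> Z \<and> N i \<subseteq> N (Suc i)"
  have mono: "N i \<subseteq> N j" if "i \<le> j" for i j
    using lift_Suc_mono_le[of N] N that by blast
  define N1 where "N1 i = {z \<in> Z1. \<alpha> z \<in> N i}" for i
  \<comment> \<open>The summand \<open>B2\<close> brings the images into the interval between
    \<open>B2\<close> and \<open>Z2\<close>.\<close>
  define N2 where "N2 i = {a \<oplus>\<^bsub>X2\<^esub> b |a b. a \<in> \<beta> ` N i \<and> b \<in> B2}" for i
  have N1: "submodule (N1 i) R X1" for i
    unfolding N1_def by (rule submodule_preimage) (use \<alpha> Z1 N X1.module_axioms X.module_axioms in auto)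
  have N2: "submodule (N2 i) R X2" for i
    unfolding N2_def
    by (rule submodule_sum)
      (use \<beta> B2 N X2.module_axioms X.module_axioms in \<open>auto intro!: submodule_image\<close>)
  obtain i1 where i1: "\<And>j. j \<ge> i1 \<Longrightarrow> N1 j = N1 i1"
    using noetherian_subquotientD[OF assms(1), of N1] N1 N \<alpha> unfolding N1_def by blast
  have "B2 \<subseteq> N2 i" for i
  proof
    fix b assume b: "b \<in> B2"
    have "\<zero>\<^bsub>X2\<^esub> \<in> \<beta> ` N i"
      by (rule submodule_zero[OF submodule_image]) (use N \<beta> X2.module_axioms X.module_axioms in auto)
    moreover have "b = \<zero>\<^bsub>X2\<^esub> \<oplus>\<^bsub>X2\<^esub> b" using b submodule_carrier[OF B2(1)] by simp
    ultimately show "b \<in> N2 i" unfolding N2_def using b by blast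
  qed
  moreover have "N2 i \<subseteq> Z2" for i
    unfolding N2_def using N \<beta>(2) B2(2) by (blast intro: submodule_add[OF Z2])
  moreover have "N2 i \<subseteq> N2 (Suc i)" for i
    unfolding N2_def using N by blast
  ultimately obtain i2 where i2: "\<And>j. j \<ge> i2 \<Longrightarrow> N2 j = N2 i2"
    using noetherian_subquotientD[OF assms(2), of N2] N2 by blast
  define k where "k = max i1 i2"
  have "N j \<subseteq> N k" if j: "j \<ge> k" for j
  proof
    fix n assume n: "n \<in> N j"
    have Nj: "submodule (N j) R X" and Nk: "submodule (N k) R X" using N by auto
    have [simp]: "x \<in> carrier X" if "x \<in> N j" for x using that submodule_carrier[OF Nj] by auto
    have b0: "\<zero>\<^bsub>X2\<^esub> \<in> B2" using submodule_zero[OF B2(1)] .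
    have bn: "\<beta> n \<in> carrier X2" using n linear_mapD(1)[OF \<beta>(1)] by auto
    have "\<beta> n \<in> N2 j" unfolding N2_def using n b0 bn by force
    then have "\<beta> n \<in> N2 k" using i2[of j] i2[of k] j by (auto simp: k_def)
    then obtain n' b where n': "n' \<in> N k" and b: "b \<in> B2" and eq: "\<beta> n = \<beta> n' \<oplus>\<^bsub>X2\<^esub> b"
      unfolding N2_def by blast
    have n'j: "n' \<in> N j" using n' mono[OF j] by auto
    have "\<beta> (n \<ominus>\<^bsub>X\<^esub> n') = \<beta> n \<ominus>\<^bsub>X2\<^esub> \<beta> n'"
      using linear_map_zero_neg_diff(3)[OF X.module_axioms X2.module_axioms \<beta>(1)] n n'j by simp
    also have "\<dots> = b"
    proof -
      have "\<beta> n' \<in> carrier X2" "b \<in> carrier X2"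
        using n'j linear_mapD(1)[OF \<beta>(1)] b submodule_carrier[OF B2(1)] by auto
      then show ?thesis unfolding eq
        by (simp add: a_minus_def X2.M.a_ac X2.M.r_neg X2.M.r_neg1 X2.M.r_neg2)
    qed
    finally have "\<beta> (n \<ominus>\<^bsub>X\<^esub> n') \<in> B2" using b by simp
    moreover have d: "n \<ominus>\<^bsub>X\<^esub> n' \<in> N j" using submodule_diff[OF Nj n n'j] .
    ultimately obtain z1 b' where z1: "z1 \<in> Z1" and b': "b' \<in> B"
      and e: "n \<ominus>\<^bsub>X\<^esub> n' = \<alpha> z1 \<oplus>\<^bsub>X\<^esub> b'" using ex N by blast
    have c: "\<alpha> z1 \<in> carrier X" using z1 linear_mapD(1)[OF \<alpha>(1)] submodule_carrier[OF Z1] by auto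
    have b'j: "b' \<in> N j" using b' N by auto
    have "\<alpha> z1 = (n \<ominus>\<^bsub>X\<^esub> n') \<ominus>\<^bsub>X\<^esub> b'"
      unfolding e using c b'j by (simp add: a_minus_def X.M.a_assoc X.M.r_neg)
    also have "\<dots> \<in> N j" using submodule_diff[OF Nj d b'j] .
    finally have "z1 \<in> N1 j" using z1 by (simp add: N1_def)
    then have "z1 \<in> N1 k" using i1[of j] i1[of k] j by (auto simp: k_def)
    then have "n \<ominus>\<^bsub>X\<^esub> n' \<in> N k" unfolding e N1_def using submodule_add[OF Nk] N b' by blast
    then have "(n \<ominus>\<^bsub>X\<^esub> n') \<oplus>\<^bsub>X\<^esub> n' \<in> N k" using submodule_add[OF Nk] n' by blast
    moreover have "(n \<ominus>\<^bsub>X\<^esub> n') \<oplus>\<^bsub>X\<^esub> n' = n"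
      using n n'j by (simp add: a_minus_def X.M.a_assoc X.M.l_neg)
    ultimately show "n \<in> N k" by simp
  qed
  then show "\<exists>i. \<forall>j\<ge>i. N j = N i" using mono by blast
qed

text \<open>One multiplier pushes z into the kernel of \<beta>, a second kills its lift to
  \<open>Z1\<close>, and their product stays outside the prime.\<close>

lemma locally_zero_middle:
  assumes p: "primeideal p R"
    and "locally_zero_subquotient R p X1 Z1 B1" "locally_zero_subquotient R p X2 Z2 B2"
  shows "locally_zero_subquotient R p X Z B"
  unfolding locally_zero_subquotient_def
proof
  fix z assume z: "z \<in> Z"
  then obtain u where u: "u \<in> carrier R - p" "u \<odot>\<^bsub>X2\<^esub> \<beta> z \<in> B2"
    using assms(3) \<beta>(2) unfolding locally_zero_subquotient_def by blast
  have zc: "z \<in> carrier X" using z submodule_carrier[OF Z] by auto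
  have "\<beta> (u \<odot>\<^bsub>X\<^esub> z) \<in> B2" using linear_mapD(3)[OF \<beta>(1)] u zc by auto
  then obtain z1 b where z1: "z1 \<in> Z1" and b: "b \<in> B" and e: "u \<odot>\<^bsub>X\<^esub> z = \<alpha> z1 \<oplus>\<^bsub>X\<^esub> b"
    using ex submodule_smult[OF Z _ z] u by blast
  obtain v where v: "v \<in> carrier R - p" "v \<odot>\<^bsub>X1\<^esub> z1 \<in> B1"
    using assms(2) z1 unfolding locally_zero_subquotient_def by blast
  have c: "z1 \<in> carrier X1" "\<alpha> z1 \<in> carrier X" "b \<in> carrier X"
    using z1 b linear_mapD(1)[OF \<alpha>(1)] submodule_carrier[OF Z1] submodule_carrier[OF B] by auto
  have "(v \<otimes> u) \<odot>\<^bsub>X\<^esub> z = v \<odot>\<^bsub>X\<^esub> (u \<odot>\<^bsub>X\<^esub> z)" using u v zc by (simp add: X.smult_assoc1)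
  also have "\<dots> = \<alpha> (v \<odot>\<^bsub>X1\<^esub> z1) \<oplus>\<^bsub>X\<^esub> v \<odot>\<^bsub>X\<^esub> b"
    unfolding e using c v by (simp add: X.smult_r_distr linear_mapD(3)[OF \<alpha>(1)])
  also have "\<dots> \<in> B" using submodule_add[OF B] submodule_smult[OF B] v b \<alpha>(2) by blast
  finally have "(v \<otimes> u) \<odot>\<^bsub>X\<^esub> z \<in> B" .
  moreover have "v \<otimes> u \<in> carrier R - p" using u v primeideal.I_prime[OF p] by auto
  ultimately show "\<exists>u\<in>carrier R - p. u \<odot>\<^bsub>X\<^esub> z \<in> B" by blast
qed

lemma zero_middle:
  assumes "Z1 \<subseteq> B1" "Z2 \<subseteq> B2"
  shows "Z \<subseteq> B"
proof
  fix z assume z: "z \<in> Z"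
  then have "\<beta> z \<in> B2" using \<beta>(2) assms(2) by auto
  then obtain z1 b where "z1 \<in> Z1" "b \<in> B" "z = \<alpha> z1 \<oplus>\<^bsub>X\<^esub> b" using ex[OF z] by auto
  then show "z \<in> B" using submodule_add[OF B, of "\<alpha> z1" b] \<alpha>(2) assms(1) by auto
qed

end

section \<open>Prime ideals\<close>

lemma ideal_of_closed:
  fixes R (structure)
  assumes "cring R" "J \<subseteq> carrier R" "\<zero> \<in> J"
    and add: "\<And>x y. x \<in> J \<Longrightarrow> y \<in> J \<Longrightarrow> x \<oplus> y \<in> J"
    and mult: "\<And>r x. r \<in> carrier R \<Longrightarrow> x \<in> J \<Longrightarrow> r \<otimes> x \<in> J"
  shows "ideal J R"
proof -
  interpret cring R by fact
  have neg: "\<ominus> x \<in> J" if "x \<in> J" for x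
    using mult[of "\<ominus> \<one>" x] that assms(2) by (auto simp: l_minus)
  show ?thesis
  proof (rule idealI)
    show "subgroup J (add_monoid R)"
      using assms neg by (intro subgroup.intro) (auto simp flip: a_inv_def)
  next
    fix a x assume "a \<in> J" "x \<in> carrier R"
    then show "a \<otimes> x \<in> J" using mult[of x a] assms(2) m_comm[of a x] by auto
  qed (use ring_axioms mult in auto)
qed

lemma ideal_add: "ideal J R \<Longrightarrow> x \<in> J \<Longrightarrow> y \<in> J \<Longrightarrow> x \<oplus>\<^bsub>R\<^esub> y \<in> J"
  by (simp add: additive_subgroup.a_closed ideal.axioms(1))

lemma ideal_neg: "ideal J R \<Longrightarrow> x \<in> J \<Longrightarrow> \<ominus>\<^bsub>R\<^esub> x \<in> J"
  by (simp add: additive_subgroup.a_inv_closed ideal.axioms(1))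

lemma ideal_add_notin:
  fixes R (structure)
  assumes "ideal q R" "x \<in> carrier R" "y \<in> q" "x \<notin> q"
  shows "x \<oplus> y \<notin> q"
proof
  interpret ideal q R by fact
  assume "x \<oplus> y \<in> q"
  then have "x \<oplus> y \<oplus> (\<ominus> y) \<in> q" using assms by (auto intro: ideal_add ideal_neg)
  moreover have "x \<oplus> y \<oplus> (\<ominus> y) = x" using assms Icarr by (simp add: a_assoc r_neg)
  ultimately show False using assms by simp
qed

text \<open>Elements of the given ideals outside p are multiplied together; primality keeps the
  product outside p.\<close>

lemma prime_avoids_finite_intersection:
  fixes R (structure)
  assumes p: "primeideal p R" and a: "ideal \<aa> R" "\<not> \<aa> \<subseteq> p"
    and "finite Q" "\<And>q. q \<in> Q \<Longrightarrow> ideal q R \<and> \<not> q \<subseteq> p"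
  shows "\<exists>y\<in>\<aa>. y \<notin> p \<and> (\<forall>q\<in>Q. y \<in> q)"
  using assms(4,5)
proof (induction Q rule: finite_induct)
  case empty
  then show ?case using a by auto
next
  case (insert q Q)
  obtain y where y: "y \<in> \<aa>" "y \<notin> p" "\<forall>q\<in>Q. y \<in> q" using insert.IH insert.prems by auto
  obtain z where z: "z \<in> q" "z \<notin> p" using insert.prems[of q] by auto
  note yz = y z
  interpret primeideal p R by fact
  have c: "y \<in> carrier R" "z \<in> carrier R"
    using ideal.Icarr[OF a(1) y(1)] ideal.Icarr[of q R z] z insert.prems[of q] by auto
  have "y \<otimes> z \<in> \<aa>" "y \<otimes> z \<notin> p" "y \<otimes> z \<in> q"
    using ideal.I_r_closed[OF a(1) yz(1) c(2)] yz(2,5) I_prime[OF c]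
      ideal.I_l_closed[of q R z y] yz(4) c(1) insert.prems[of q] by auto
  moreover have "y \<otimes> z \<in> q'" if "q' \<in> Q" for q'
    using ideal.I_r_closed[of q' R y z] that yz(3) c(2) insert.prems[of q'] by auto
  ultimately show ?case by blast
qed

text \<open>A minimal member p of \<open>P\<close> contains none of the other primes, so some y of
  the ideal lies in all the others but not in p. If an x that avoids the others fails at p, then x +
  y avoids every member.\<close>

lemma prime_avoidance:
  fixes R (structure)
  assumes R: "cring R" and a: "ideal \<aa> R" and "finite P"
    and "\<And>p. p \<in> P \<Longrightarrow> primeideal p R \<and> \<not> \<aa> \<subseteq> p"
  shows "\<exists>x\<in>\<aa>. \<forall>p\<in>P. x \<notin> p"
  using assms(3,4)
proof (induction P rule: finite_psubset_induct)
  case (psubset P)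
  show ?case
  proof (cases "P = {}")
    case True
    then show ?thesis using additive_subgroup.zero_closed[OF ideal.axioms(1)[OF a]] by auto
  next
    case False
    then obtain p where p: "p \<in> P" and min: "\<And>q. q \<in> P \<Longrightarrow> q \<subseteq> p \<Longrightarrow> p = q"
      using finite_has_minimal[OF psubset.hyps(1)] by metis
    obtain x where x: "x \<in> \<aa>" "\<forall>q\<in>P - {p}. x \<notin> q"
      using psubset.IH[of "P - {p}"] psubset.prems p by auto
    show ?thesis
    proof (cases "x \<in> p")
      case False
      then show ?thesis using x by blast
    next
      case True
      have "\<exists>y\<in>\<aa>. y \<notin> p \<and> (\<forall>q\<in>P - {p}. y \<in> q)"
        by (rule prime_avoids_finite_intersection)
          (use p psubset.prems psubset.hyps a min in \<open>auto simp: primeideal_def\<close>)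
      then obtain y where y: "y \<in> \<aa>" "y \<notin> p" "\<forall>q\<in>P - {p}. y \<in> q" by blast
      interpret cring R by fact
      have c: "x \<in> carrier R" "y \<in> carrier R" using x y ideal.Icarr[OF a] by auto
      have id: "ideal q R" if "q \<in> P" for q using psubset.prems[OF that] by (simp add: primeideal_def)
      have "x \<oplus> y \<notin> q" if q: "q \<in> P" for q
      proof (cases "q = p")
        case True
        have "y \<oplus> x \<notin> p" by (rule ideal_add_notin[OF id[OF p]]) (use c y \<open>x \<in> p\<close> in auto)
        then show ?thesis using c True by (simp add: a_comm)
      next
        case False
        then show ?thesis using ideal_add_notin[OF id[OF q]] x y q c by auto
      qed
      moreover have "x \<oplus> y \<in> \<aa>" using x y ideal_add[OF a] by auto
      ultimately show ?thesis by blast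
    qed
  qed
qed

text \<open>The ideal Rr + m is larger than m, hence the whole ring. Thus r acts invertibly on
  anything killed by m.\<close>

lemma maximal_ideal_inverse:
  fixes R (structure)
  assumes R: "cring R" and m: "maximalideal \<mm> R" and r: "r \<in> carrier R" "r \<notin> \<mm>"
  shows "\<exists>s\<in>carrier R. \<exists>u\<in>\<mm>. \<one> = s \<otimes> r \<oplus> u"
proof -
  interpret cring R by fact
  interpret m: maximalideal \<mm> R by fact
  let ?J = "{s \<otimes> r \<oplus> u |s u. s \<in> carrier R \<and> u \<in> \<mm>}"
  have J: "ideal ?J R"
  proof (rule ideal_of_closed)
    show "?J \<subseteq> carrier R" using r m.Icarr by auto
    have "\<zero> = \<zero> \<otimes> r \<oplus> \<zero>" using r by simp
    then show "\<zero> \<in> ?J" using m.zero_closed by blast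
  next
    fix x y assume "x \<in> ?J" "y \<in> ?J"
    then obtain s u s' u' where *: "s \<in> carrier R" "u \<in> \<mm>" "s' \<in> carrier R" "u' \<in> \<mm>"
      "x = s \<otimes> r \<oplus> u" "y = s' \<otimes> r \<oplus> u'" by blast
    then have "x \<oplus> y = (s \<oplus> s') \<otimes> r \<oplus> (u \<oplus> u')"
      using r m.Icarr by (simp add: l_distr a_ac)
    then show "x \<oplus> y \<in> ?J" using * by blast
  next
    fix t x assume t: "t \<in> carrier R" and "x \<in> ?J"
    then obtain s u where *: "s \<in> carrier R" "u \<in> \<mm>" "x = s \<otimes> r \<oplus> u" by blast
    then have "t \<otimes> x = (t \<otimes> s) \<otimes> r \<oplus> t \<otimes> u"
      using r t m.Icarr by (simp add: r_distr m_assoc)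
    then show "t \<otimes> x \<in> ?J" using * t m.I_l_closed by blast
  qed (rule R)
  have "\<mm> \<subseteq> ?J"
  proof
    fix u assume u: "u \<in> \<mm>"
    then have "u = \<zero> \<otimes> r \<oplus> u" using r m.Icarr by simp
    then show "u \<in> ?J" using u by blast
  qed
  moreover have "r \<in> ?J"
  proof -
    have "r = \<one> \<otimes> r \<oplus> \<zero>" using r by simp
    then show ?thesis using m.zero_closed by blast
  qed
  ultimately have "?J = carrier R"
    using m.I_maximal[OF J] ideal.Icarr[OF J] r by blast
  then have "\<one> \<in> ?J" by simp
  then show ?thesis by blast
qed


section \<open>Artinian subquotients\<close>

lemma submodule_smult_preimage:
  fixes X :: "('r, 'x) module"
  assumes "module R X" "submodule Z R X" "submodule B R X" "r \<in> carrier R"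
  shows "submodule {z \<in> Z. r \<odot>\<^bsub>X\<^esub> z \<in> B} R X"
  using submodule_preimage[OF assms(1,1) linear_map_smult[OF assms(1,4)] assms(2,3)] .

lemma submodule_colon:
  fixes X (structure)
  assumes X: "module R X" and Z: "submodule Z R X" and B: "submodule B R X" and T: "T \<subseteq> carrier R"
  shows "submodule {z \<in> Z. \<forall>t\<in>T. t \<odot> z \<in> B} R X"
proof -
  interpret module R X by fact
  note z = submoduleD[OF Z] and b = submoduleD[OF B]
  show ?thesis
  proof (rule submodule_of_closed[OF X])
    fix r v assume r: "r \<in> carrier R" and v: "v \<in> {z \<in> Z. \<forall>t\<in>T. t \<odot> z \<in> B}"
    have "t \<odot> (r \<odot> v) = r \<odot> (t \<odot> v)" if "t \<in> T" for t
      using that T r v z(1) by (auto simp: R.m_comm simp flip: smult_assoc1)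
    then show "r \<odot> v \<in> {z \<in> Z. \<forall>t\<in>T. t \<odot> z \<in> B}" using r v z(6) b(6) by simp
  qed (use z b T in \<open>auto simp: smult_r_distr subset_iff\<close>)
qed

lemma submodule_smult_image_sum:
  fixes X :: "('r, 'x) module" (structure)
  assumes "module R X" "submodule Z R X" "submodule B R X" "r \<in> carrier R"
  shows "submodule {r \<odot> z \<oplus> b |z b. z \<in> Z \<and> b \<in> B} R X"
proof -
  have "{r \<odot> z \<oplus> b |z b. z \<in> Z \<and> b \<in> B} =
      {a \<oplus> b |a b. a \<in> (\<lambda>z. r \<odot> z) ` Z \<and> b \<in> B}" by blast
  then show ?thesis
    using submodule_sum[OF assms(1) submodule_image[OF assms(1,1) linear_map_smult[OF assms(1,4)] assms(2)]
      assms(3)] by simp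
qed

lemma (in module) diff_solve:
  "a \<in> carrier M \<Longrightarrow> b \<in> carrier M \<Longrightarrow> c \<in> carrier M \<Longrightarrow> a = b \<oplus>\<^bsub>M\<^esub> c \<Longrightarrow> a \<ominus>\<^bsub>M\<^esub> b = c"
  by (simp add: a_minus_def M.a_comm[of b c] M.a_assoc M.r_neg)

lemma (in module) diff_add_cancel:
  "a \<in> carrier M \<Longrightarrow> b \<in> carrier M \<Longrightarrow> (a \<ominus>\<^bsub>M\<^esub> b) \<oplus>\<^bsub>M\<^esub> b = a"
  by (simp add: a_minus_def M.a_assoc M.l_neg)

lemma (in module) smult_diff:
  "r \<in> carrier R \<Longrightarrow> a \<in> carrier M \<Longrightarrow> b \<in> carrier M \<Longrightarrow>
    r \<odot>\<^bsub>M\<^esub> (a \<ominus>\<^bsub>M\<^esub> b) = r \<odot>\<^bsub>M\<^esub> a \<ominus>\<^bsub>M\<^esub> r \<odot>\<^bsub>M\<^esub> b"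
  by (simp add: a_minus_def smult_r_distr smult_r_minus)

lemma (in module) smult_pow_Suc:
  assumes "r \<in> carrier R" "x \<in> carrier M"
  shows "r [^] Suc n \<odot>\<^bsub>M\<^esub> x = r [^] n \<odot>\<^bsub>M\<^esub> (r \<odot>\<^bsub>M\<^esub> x)"
    and "r [^] Suc n \<odot>\<^bsub>M\<^esub> x = r \<odot>\<^bsub>M\<^esub> (r [^] n \<odot>\<^bsub>M\<^esub> x)"
  using assms smult_assoc1[of "r [^] n" r x] smult_assoc1[of r "r [^] n" x] R.m_comm[of r "r [^] n"]
  by auto

text \<open>Melkersson's criterion, for a single element: the submodules \<open>x\<^sup>n N \<inter> (0 : x)\<close> of the
  Artinian module \<open>0 : x\<close> determine a submodule \<open>N\<close> of an \<open>x\<close>-torsion module within a chain.\<close>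

lemma artinian_if_torsion_one:
  fixes X (structure)
  assumes X: "module R X" and Z: "submodule Z R X" and B: "submodule B R X" "B \<subseteq> Z"
    and x: "x \<in> carrier R" and tors: "\<And>z. z \<in> Z \<Longrightarrow> \<exists>k::nat. x [^]\<^bsub>R\<^esub> k \<odot> z \<in> B"
    and art: "artinian_subquotient R X {z \<in> Z. x \<odot> z \<in> B} B"
  shows "artinian_subquotient R X Z B"
  unfolding artinian_subquotient_def
proof (intro allI impI)
  interpret module R X by fact
  fix N assume N: "\<forall>i. submodule (N i) R X \<and> B \<subseteq> N i \<and> N i \<subseteq> Z \<and> N (Suc i) \<subseteq> N i"
  have subN: "submodule (N i) R X" and BN: "B \<subseteq> N i" and NZ: "N i \<subseteq> Z" for i using N by auto
  have anti: "N j \<subseteq> N i" if "i \<le> j" for i j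
    using lift_Suc_antimono_le[of N] N that by blast
  have Nc: "y \<in> carrier X" if "y \<in> N i" for y i using submodule_carrier[OF subN that] .
  have Bc: "y \<in> carrier X" if "y \<in> B" for y using submodule_carrier[OF B(1) that] .
  \<comment> \<open>Modulo \<open>B\<close> this is x^n N_i \<inter> (0 : x), written as the image
    under x^n of what x^(n+1) kills. It decreases in both indices.\<close>
  define V where "V i n = {x [^]\<^bsub>R\<^esub> n \<odot> y \<oplus> b |y b.
      y \<in> {y \<in> N i. x [^]\<^bsub>R\<^esub> Suc n \<odot> y \<in> B} \<and> b \<in> B}" for i and n :: nat
  have V1: "submodule (V i n) R X" for i n
    unfolding V_def
    by (intro submodule_smult_image_sum submodule_smult_preimage) (use X subN B x in auto)
  have V2: "B \<subseteq> V i n" for i n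
  proof
    fix b assume b: "b \<in> B"
    have "b = x [^]\<^bsub>R\<^esub> n \<odot> \<zero> \<oplus> b" using Bc[OF b] x by simp
    moreover have "\<zero> \<in> {y \<in> N i. x [^]\<^bsub>R\<^esub> Suc n \<odot> y \<in> B}"
      using submodule_zero[OF subN] submodule_zero[OF B(1)] x by simp
    ultimately show "b \<in> V i n" unfolding V_def using b by blast
  qed
  have V3: "V i n \<subseteq> {z \<in> Z. x \<odot> z \<in> B}" for i n
  proof
    fix v assume "v \<in> V i n"
    then obtain y b where y: "y \<in> N i" "x [^]\<^bsub>R\<^esub> Suc n \<odot> y \<in> B" "b \<in> B"
      and v: "v = x [^]\<^bsub>R\<^esub> n \<odot> y \<oplus> b" unfolding V_def by blast
    have "v \<in> Z" unfolding v using y NZ B x by (auto intro!: submodule_add[OF Z] submodule_smult[OF Z])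
    moreover have "x \<odot> v = x [^]\<^bsub>R\<^esub> Suc n \<odot> y \<oplus> x \<odot> b"
      unfolding v using y x Nc Bc smult_pow_Suc(2)[of x y n] by (simp add: smult_r_distr)
    moreover have "\<dots> \<in> B" using y x by (auto intro!: submodule_add[OF B(1)] submodule_smult[OF B(1)])
    ultimately show "v \<in> {z \<in> Z. x \<odot> z \<in> B}" by simp
  qed
  have Vi: "V j n \<subseteq> V i n" if "i \<le> j" for i j n
    unfolding V_def using anti[OF that] by blast
  have Vn1: "V i (Suc n) \<subseteq> V i n" for i n
  proof
    fix v assume "v \<in> V i (Suc n)"
    then obtain y b where y: "y \<in> N i" "x [^]\<^bsub>R\<^esub> Suc (Suc n) \<odot> y \<in> B" "b \<in> B"
      and v: "v = x [^]\<^bsub>R\<^esub> Suc n \<odot> y \<oplus> b" unfolding V_def by blast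
    have "x \<odot> y \<in> {y \<in> N i. x [^]\<^bsub>R\<^esub> Suc n \<odot> y \<in> B}"
      using y submodule_smult[OF subN x] smult_pow_Suc(1)[OF x Nc[OF y(1)], of "Suc n"]
      by (simp del: nat_pow_Suc)
    moreover have "v = x [^]\<^bsub>R\<^esub> n \<odot> (x \<odot> y) \<oplus> b"
      unfolding v using smult_pow_Suc(1)[OF x Nc[OF y(1)], of n] by simp
    ultimately show "v \<in> V i n" unfolding V_def using y(3) by blast
  qed
  have Vn: "V i m \<subseteq> V i n" if "n \<le> m" for i n m
    using lift_Suc_antimono_le[of "V i"] Vn1 that by blast
  \<comment> \<open>Stationarity of the diagonal controls all n \<ge> m at once; the finitely many n
    below m are treated one by one.\<close>
  obtain m where m: "\<And>j. j \<ge> m \<Longrightarrow> V j j = V m m"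
    using artinian_subquotientD[OF art, of "\<lambda>n. V n n"] V1 V2 V3 Vi[OF le_SucI[OF le_refl]] Vn1
    by (metis subset_trans)
  have "\<exists>s. \<forall>j\<ge>s. V j n = V s n" for n
    using artinian_subquotientD[OF art, of "\<lambda>i. V i n"] V1 V2 V3 Vi[OF le_SucI[OF le_refl]] by metis
  then obtain s where s: "\<And>n j. j \<ge> s n \<Longrightarrow> V j n = V (s n) n" by metis
  \<comment> \<open>The inserted 0 keeps \<open>Max\<close> meaningful when m = 0.\<close>
  define i0 where "i0 = max m (Max (insert 0 (s ` {..<m})))"
  have i0: "m \<le> i0" "\<And>n. n < m \<Longrightarrow> s n \<le> i0" unfolding i0_def by (auto simp: le_max_iff_disj)
  have stable: "V i n = V i0 n" if "i \<ge> i0" for i n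
  proof (cases "n < m")
    case True
    then show ?thesis using s[of n i] s[of n i0] i0(2)[of n] that by simp
  next
    case False
    \<comment> \<open>By monotonicity in both indices, \<open>V i n\<close> and
      \<open>V i0 n\<close> are squeezed between \<open>V k k\<close> and \<open>V m m\<close>,
      which agree.\<close>
    define k where "k = max i n"
    have "V m m = V k k" using m[of k] False by (auto simp: k_def)
    also have "\<dots> \<subseteq> V i k" by (rule Vi) (simp add: k_def)
    also have "\<dots> \<subseteq> V i n" by (rule Vn) (simp add: k_def)
    finally have "V m m \<subseteq> V i n" .
    moreover have "V i n \<subseteq> V i0 n" by (rule Vi[OF that])
    moreover have "V i0 n \<subseteq> V m n" by (rule Vi[OF i0(1)])
    moreover have "V m n \<subseteq> V m m" by (rule Vn) (use False in simp)
    ultimately show ?thesis by blast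
  qed
  \<comment> \<open>Induction on the exponent that sends y into \<open>B\<close>: stationarity of
    \<open>V\<close> yields y' in \<open>N i\<close> with the same x^n-multiple modulo
    \<open>B\<close>, so a smaller power already sends y - y' into \<open>B\<close>.\<close>
  have "y \<in> N i" if "i \<ge> i0" "y \<in> N i0" "x [^]\<^bsub>R\<^esub> n \<odot> y \<in> B" for i y and n :: nat
    using that(2,3)
  proof (induction n arbitrary: y)
    case 0
    then show ?case using BN[of i] Nc by auto
  next
    case (Suc n)
    have yc: "y \<in> carrier X" using Suc.prems Nc by auto
    have "x [^]\<^bsub>R\<^esub> n \<odot> y = x [^]\<^bsub>R\<^esub> n \<odot> y \<oplus> \<zero>" using yc x by simp
    then have "x [^]\<^bsub>R\<^esub> n \<odot> y \<in> V i0 n"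
      unfolding V_def using Suc.prems submodule_zero[OF B(1)] by blast
    then have "x [^]\<^bsub>R\<^esub> n \<odot> y \<in> V i n" using stable[OF that(1)] by simp
    then obtain y' b where y': "y' \<in> N i" "b \<in> B" and e: "x [^]\<^bsub>R\<^esub> n \<odot> y = x [^]\<^bsub>R\<^esub> n \<odot> y' \<oplus> b"
      unfolding V_def by blast
    have y'c: "y' \<in> carrier X" "y' \<in> N i0" using y' Nc anti[OF that(1)] by auto
    have "x [^]\<^bsub>R\<^esub> n \<odot> (y \<ominus> y') = b"
      using diff_solve[OF _ _ _ e] yc y'c x Bc[OF y'(2)] by (simp add: smult_diff)
    then have "y \<ominus> y' \<in> N i"
      using Suc.IH[of "y \<ominus> y'"] submodule_diff[OF subN Suc.prems(1) y'c(2)] y'(2) by simp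
    then have "(y \<ominus> y') \<oplus> y' \<in> N i" using submodule_add[OF subN] y' by blast
    then show ?case using diff_add_cancel[OF yc y'c(1)] by simp
  qed
  then have "N i0 \<subseteq> N i" if "i \<ge> i0" for i using that tors NZ by blast
  then show "\<exists>i. \<forall>j\<ge>i. N j = N i" using anti by blast
qed

text \<open>The elements are used one at a time: the part of Z/B killed by t is Artinian by
  induction over the remaining elements, and the criterion for t alone then covers Z/B.\<close>

lemma artinian_if_torsion:
  fixes X (structure)
  assumes X: "module R X" and "submodule Z R X" and B: "submodule B R X" "B \<subseteq> Z"
    and "set ts \<subseteq> carrier R"
    and "\<And>t z. t \<in> set ts \<Longrightarrow> z \<in> Z \<Longrightarrow> \<exists>k::nat. t [^]\<^bsub>R\<^esub> k \<odot> z \<in> B"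
    and "artinian_subquotient R X {z \<in> Z. \<forall>t\<in>set ts. t \<odot> z \<in> B} B"
  shows "artinian_subquotient R X Z B"
  using assms(2,4-)
proof (induction ts arbitrary: Z)
  case Nil
  then show ?case by simp
next
  case (Cons t ts)
  let ?Z = "{z \<in> Z. t \<odot> z \<in> B}"
  have "artinian_subquotient R X ?Z B"
  proof (rule Cons.IH)
    show "submodule ?Z R X" using submodule_smult_preimage[OF X Cons.prems(1) B(1)] Cons.prems by simp
    have "{z \<in> ?Z. \<forall>t\<in>set ts. t \<odot> z \<in> B} = {z \<in> Z. \<forall>t\<in>set (t # ts). t \<odot> z \<in> B}" by auto
    then show "artinian_subquotient R X {z \<in> ?Z. \<forall>t\<in>set ts. t \<odot> z \<in> B} B"
      using Cons.prems(5) by simp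
    show "B \<subseteq> ?Z" using Cons.prems(2,3) submodule_smult[OF B(1)] by auto
  qed (use Cons.prems in auto)
  then show ?case by (intro artinian_if_torsion_one[OF X Cons.prems(1) B(1)]) (use Cons.prems in auto)
qed

text \<open>Z/B is a vector space over R/m. A descending chain that never stabilises would yield
  infinitely many independent vectors, and their spans would form a strictly ascending
  chain.\<close>

lemma artinian_if_noetherian_over_field:
  fixes X (structure)
  assumes X: "module R X" and Z: "submodule Z R X" and B: "submodule B R X" "B \<subseteq> Z"
    and m: "maximalideal \<mm> R" and kill: "\<And>r z. r \<in> \<mm> \<Longrightarrow> z \<in> Z \<Longrightarrow> r \<odot> z \<in> B"
    and noeth: "noetherian_subquotient R X Z B"
  shows "artinian_subquotient R X Z B"
  unfolding artinian_subquotient_def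
proof (intro allI impI, rule ccontr)
  interpret module R X by fact
  fix N assume N: "\<forall>i. submodule (N i) R X \<and> B \<subseteq> N i \<and> N i \<subseteq> Z \<and> N (Suc i) \<subseteq> N i"
    and unstable: "\<not> (\<exists>i. \<forall>j\<ge>i. N j = N i)"
  have anti: "N j \<subseteq> N i" if "i \<le> j" for i j
    using lift_Suc_antimono_le[of N] N that by blast
  have "\<exists>j\<ge>i. \<exists>v. v \<in> N i \<and> v \<notin> N j" for i using unstable anti by blast
  then obtain g v where gv: "\<And>i. g i \<ge> i" "\<And>i. v i \<in> N i" "\<And>i. v i \<notin> N (g i)" by metis
  \<comment> \<open>Iterating \<open>g\<close> selects stages along which the chain drops strictly;
    \<open>w n\<close> is a vector lost at the n-th drop.\<close>
  define f where "f n = (g ^^ n) 0" for n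
  define w where "w n = v (f n)" for n
  have w: "w n \<in> N (f n)" "w n \<notin> N (f (Suc n))" for n unfolding w_def f_def using gv by auto
  have fmono: "N (f (Suc n)) \<subseteq> N (f n)" for n unfolding f_def using gv(1) anti by simp
  have subN: "submodule (N i) R X" and BN: "B \<subseteq> N i" and NZ: "N i \<subseteq> Z" for i using N by auto
  \<comment> \<open>\<open>S n\<close> is the span of the first n of these vectors, taken over
    \<open>B\<close>.\<close>
  define S where "S = rec_nat B (\<lambda>n T. {s \<oplus> u |s u. s \<in> T \<and> u \<in> (\<lambda>r. r \<odot> w n) ` carrier R})"
  have S0: "S 0 = B" and SS: "S (Suc n) = {s \<oplus> u |s u. s \<in> S n \<and> u \<in> (\<lambda>r. r \<odot> w n) ` carrier R}"
    for n unfolding S_def by auto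
  have wc: "w n \<in> carrier X" "w n \<in> Z" for n
    using submodule_carrier[OF subN w(1)] subsetD[OF NZ w(1)] by auto
  have line: "submodule ((\<lambda>r. r \<odot> w n) ` carrier R) R X" for n
    by (rule submodule_of_closed)
      (use X wc in \<open>auto simp: image_iff simp flip: smult_l_distr smult_assoc1 intro: bexI[of _ "\<zero>\<^bsub>R\<^esub>"]\<close>)
  have S1: "submodule (S n) R X" for n
    by (induction n) (auto simp only: S0 SS intro!: B submodule_sum[OF X] line)
  have S2: "S n \<subseteq> Z" for n
  proof (induction n)
    case (Suc n)
    then show ?case unfolding SS using wc submodule_smult[OF Z] submodule_add[OF Z] by blast
  qed (use S0 B in simp)
  have S3: "S n \<subseteq> S (Suc n)" for n
  proof
    fix s assume s: "s \<in> S n"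
    then have "s = s \<oplus> \<zero>\<^bsub>R\<^esub> \<odot> w n" using wc submodule_carrier[OF S1] by simp
    then show "s \<in> S (Suc n)" unfolding SS using s by blast
  qed
  have "B \<subseteq> S n" for n using lift_Suc_mono_le[of S 0 n] S3 S0 by auto
  then obtain k where k: "\<And>j. j \<ge> k \<Longrightarrow> S j = S k"
    using noetherian_subquotientD[OF noeth, of S] S1 S2 S3 by blast
  have unit: "w n \<in> N (f (Suc n))" if r: "r \<in> carrier R" "r \<notin> \<mm>" and rw: "r \<odot> w n \<in> N (f (Suc n))"
    for r n
  proof -
    obtain s u where su: "s \<in> carrier R" "u \<in> \<mm>" "\<one>\<^bsub>R\<^esub> = s \<otimes>\<^bsub>R\<^esub> r \<oplus>\<^bsub>R\<^esub> u"
      using maximal_ideal_inverse[OF is_cring m r] by blast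
    have uc: "u \<in> carrier R" using ideal.Icarr[OF maximalideal.axioms(1)[OF m] su(2)] .
    have "w n = (s \<otimes>\<^bsub>R\<^esub> r \<oplus>\<^bsub>R\<^esub> u) \<odot> w n" using wc by (simp flip: su(3))
    also have "\<dots> = s \<odot> (r \<odot> w n) \<oplus> u \<odot> w n"
      using su r wc uc by (simp add: smult_l_distr smult_assoc1)
    also have "\<dots> \<in> N (f (Suc n))"
      using su rw kill[OF su(2) wc(2)] BN
      by (blast intro: submodule_add[OF subN] submodule_smult[OF subN])
    finally show ?thesis .
  qed
  \<comment> \<open>Independence: in a combination lying in \<open>N (f (Suc n))\<close>, the
    coefficient of \<open>w n\<close> belongs to m, since otherwise inverting it would put
    \<open>w n\<close> itself into that submodule.\<close>
  have SN: "S n \<inter> N (f n) \<subseteq> B" for n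
  proof (induction n)
    case (Suc n)
    show ?case
    proof
      fix y assume y: "y \<in> S (Suc n) \<inter> N (f (Suc n))"
      then obtain s r where sr: "s \<in> S n" "r \<in> carrier R" and e: "y = s \<oplus> r \<odot> w n"
        unfolding SS by blast
      have c: "s \<in> carrier X" "r \<odot> w n \<in> carrier X" "y \<in> carrier X"
        using sr wc submodule_carrier[OF S1] y submodule_carrier[OF subN] by auto
      have rw: "r \<odot> w n \<in> N (f n)" using submodule_smult[OF subN] w sr by blast
      have "y \<ominus> r \<odot> w n = s" by (rule diff_solve) (use c e in \<open>auto simp: M.a_comm\<close>)
      then have "s \<in> N (f n)" using submodule_diff[OF subN _ rw, of y] y fmono by auto
      then have sB: "s \<in> B" using sr Suc.IH by auto
      have "y \<ominus> s = r \<odot> w n" by (rule diff_solve) (use c e in auto)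
      then have "r \<odot> w n \<in> N (f (Suc n))" using submodule_diff[OF subN, of y "f (Suc n)" s] y sB BN by auto
      then have "r \<in> \<mm>" using unit[OF sr(2)] w by blast
      then have "r \<odot> w n \<in> B" using kill wc by blast
      then show "y \<in> B" unfolding e using sB submodule_add[OF B(1)] by blast
    qed
  qed (use S0 in auto)
  \<comment> \<open>The spans no longer grow at k, so \<open>w k\<close> lies in \<open>S k\<close>
    and independence forces it into \<open>B\<close>.\<close>
  have "w k = \<zero> \<oplus> \<one>\<^bsub>R\<^esub> \<odot> w k" using wc by simp
  then have "w k \<in> S (Suc k)" unfolding SS using submodule_zero[OF S1] by blast
  then have "w k \<in> B" using k[of "Suc k"] SN[of k] w(1) by auto
  then show False using w(2) BN by blast
qed

section \<open>Secondary representations of Artinian subquotients\<close>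

lemma artinian_minimal:
  assumes art: "artinian_subquotient R X Z B" and ne: "\<A> \<noteq> {}"
    and A: "\<And>N. N \<in> \<A> \<Longrightarrow> submodule N R X \<and> B \<subseteq> N \<and> N \<subseteq> Z"
  obtains N where "N \<in> \<A>" "\<And>N'. N' \<in> \<A> \<Longrightarrow> \<not> N' \<subset> N"
proof -
  have "\<exists>N\<in>\<A>. \<forall>N'\<in>\<A>. \<not> N' \<subset> N"
  proof (rule ccontr)
    assume "\<not> ?thesis"
    then have ex: "\<exists>N'. N' \<in> \<A> \<and> N' \<subset> N" if "N \<in> \<A>" for N
      using that by blast
    obtain f where f: "\<And>n::nat. f n \<in> \<A>" "\<And>n. f (Suc n) \<subset> f n"
    proof -
      have "\<exists>f. \<forall>n::nat. f n \<in> \<A> \<and> f (Suc n) \<subset> f n"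
        by (rule dependent_nat_choice) (use ne ex in auto)
      then show ?thesis using that by blast
    qed
    have d: "f (Suc i) \<subseteq> f i" and fA: "submodule (f i) R X" "B \<subseteq> f i" "f i \<subseteq> Z" for i
      using psubset_imp_subset[OF f(2)] A[OF f(1)] by auto
    have "\<exists>i. \<forall>j\<ge>i. f j = f i"
      by (rule art[unfolded artinian_subquotient_def, rule_format]) (simp add: d fA)
    then show False using f(2) by (metis le_SucI le_refl psubset_eq)
  qed
  then show thesis using that by blast
qed

text \<open>In place of the binomial theorem: splitting one factor r + s off the power replaces y by
  ry and by sy, and each of these lowers one of the two exponents.\<close>

lemma power_sum_mem_submodule:
  fixes X (structure)
  assumes X: "module R X" and B: "submodule B R X" and "r \<in> carrier R" "s \<in> carrier R"
    and "y \<in> carrier X" "r [^]\<^bsub>R\<^esub> (k::nat) \<odot> y \<in> B" "s [^]\<^bsub>R\<^esub> (l::nat) \<odot> y \<in> B"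
  shows "(r \<oplus>\<^bsub>R\<^esub> s) [^]\<^bsub>R\<^esub> (k + l) \<odot> y \<in> B"
  using assms(5-)
proof (induction "k + l" arbitrary: k l y)
  case 0
  then show ?case by simp
next
  case (Suc n)
  interpret module R X by fact
  have rs: "r \<in> carrier R" "s \<in> carrier R" by fact+
  have c: "r [^]\<^bsub>R\<^esub> m \<odot> (s \<odot> y) = s \<odot> (r [^]\<^bsub>R\<^esub> m \<odot> y)"
    "s [^]\<^bsub>R\<^esub> m \<odot> (r \<odot> y) = r \<odot> (s [^]\<^bsub>R\<^esub> m \<odot> y)" for m :: nat
    using rs Suc.prems(1) by (simp_all add: R.m_comm flip: smult_assoc1)
  show ?case
  proof (cases "k = 0 \<or> l = 0")
    case True
    then have "y \<in> B" using Suc.prems by auto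
    then show ?thesis using submodule_smult[OF B] rs by simp
  next
    case False
    then obtain k' l' where kl: "k = Suc k'" "l = Suc l'" by (metis not0_implies_Suc)
    have n: "k + l = Suc n" "k' + l = n" "k + l' = n" using Suc.hyps(2) kl by auto
    have 1: "(r \<oplus>\<^bsub>R\<^esub> s) [^]\<^bsub>R\<^esub> (k' + l) \<odot> (r \<odot> y) \<in> B"
    proof (rule Suc.hyps(1))
      show "r [^]\<^bsub>R\<^esub> k' \<odot> (r \<odot> y) \<in> B"
        using Suc.prems(1,2) rs unfolding kl smult_pow_Suc(1)[OF rs(1) Suc.prems(1)] by simp
      show "s [^]\<^bsub>R\<^esub> l \<odot> (r \<odot> y) \<in> B"
        unfolding c using submodule_smult[OF B] rs Suc.prems(3) by simp
    qed (use n rs Suc.prems in auto)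
    have 2: "(r \<oplus>\<^bsub>R\<^esub> s) [^]\<^bsub>R\<^esub> (k + l') \<odot> (s \<odot> y) \<in> B"
    proof (rule Suc.hyps(1))
      show "s [^]\<^bsub>R\<^esub> l' \<odot> (s \<odot> y) \<in> B"
        using Suc.prems(1,3) rs unfolding kl smult_pow_Suc(1)[OF rs(2) Suc.prems(1)] by simp
      show "r [^]\<^bsub>R\<^esub> k \<odot> (s \<odot> y) \<in> B"
        unfolding c using submodule_smult[OF B] rs Suc.prems(2) by simp
    qed (use n rs Suc.prems in auto)
    have "(r \<oplus>\<^bsub>R\<^esub> s) [^]\<^bsub>R\<^esub> (k + l) \<odot> y = (r \<oplus>\<^bsub>R\<^esub> s) [^]\<^bsub>R\<^esub> n \<odot> (r \<odot> y)
        \<oplus> (r \<oplus>\<^bsub>R\<^esub> s) [^]\<^bsub>R\<^esub> n \<odot> (s \<odot> y)"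
      unfolding n(1) using rs Suc.prems(1) smult_pow_Suc(1)[of "r \<oplus>\<^bsub>R\<^esub> s" y n]
      by (simp add: smult_l_distr smult_r_distr del: nat_pow_Suc)
    then show ?thesis using 1 2 n submodule_add[OF B] by simp
  qed
qed

lemma iterate_surjective:
  fixes X (structure)
  assumes X: "module R X" and N: "submodule N R X" and W: "submodule W R X" and r: "r \<in> carrier R"
    and surj: "N \<subseteq> {r \<odot> y \<oplus> w |y w. y \<in> N \<and> w \<in> W}" and y: "y \<in> N"
  shows "\<exists>v\<in>N. \<exists>w\<in>W. y = r [^]\<^bsub>R\<^esub> (n::nat) \<odot> v \<oplus> w"
proof (induction n)
  interpret module R X by fact
  case 0
  have "y = r [^]\<^bsub>R\<^esub> (0::nat) \<odot> y \<oplus> \<zero>" using submodule_carrier[OF N y] by simp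
  then show ?case using y submodule_zero[OF W] by blast
next
  interpret module R X by fact
  case (Suc n)
  then obtain v w where v: "v \<in> N" "w \<in> W" "y = r [^]\<^bsub>R\<^esub> n \<odot> v \<oplus> w" by blast
  obtain v' w' where v': "v' \<in> N" "w' \<in> W" "v = r \<odot> v' \<oplus> w'" using surj v(1) by blast
  have "y = r [^]\<^bsub>R\<^esub> Suc n \<odot> v' \<oplus> (r [^]\<^bsub>R\<^esub> n \<odot> w' \<oplus> w)"
    unfolding v(3) unfolding v'(3)
    using r v v' submodule_carrier[OF N] submodule_carrier[OF W] smult_pow_Suc(1)[of r v' n]
    by (simp add: smult_r_distr M.a_assoc del: nat_pow_Suc)
  moreover have "r [^]\<^bsub>R\<^esub> n \<odot> w' \<oplus> w \<in> W"
    using submodule_add[OF W] submodule_smult[OF W] v v' r by simp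
  ultimately show ?case using v'(1) by blast
qed

text \<open>The last premise says that \<open>N/B\<close> is secondary.\<close>

lemma secondary_primeideal:
  fixes X (structure)
  assumes X: "module R X" and N: "submodule N R X" and B: "submodule B R X" and NB: "\<not> N \<subseteq> B"
    and sec: "\<And>r. r \<in> carrier R \<Longrightarrow> (\<exists>k::nat. \<forall>y\<in>N. r [^]\<^bsub>R\<^esub> k \<odot> y \<in> B) \<or>
      N \<subseteq> {r \<odot> y \<oplus> b |y b. y \<in> N \<and> b \<in> B}"
  shows "primeideal {r \<in> carrier R. \<exists>k::nat. \<forall>y\<in>N. r [^]\<^bsub>R\<^esub> k \<odot> y \<in> B} R" (is "primeideal ?p R")
proof (rule primeidealI)
  interpret module R X by fact
  have Nc: "y \<in> carrier X" if "y \<in> N" for y using submodule_carrier[OF N that] .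
  have Bc: "y \<in> carrier X" if "y \<in> B" for y using submodule_carrier[OF B that] .
  show "ideal ?p R"
  proof (rule ideal_of_closed)
    have "\<forall>y\<in>N. \<zero>\<^bsub>R\<^esub> [^]\<^bsub>R\<^esub> (1::nat) \<odot> y \<in> B" using submodule_zero[OF B] Nc by simp
    then show "\<zero>\<^bsub>R\<^esub> \<in> ?p" by blast
  next
    fix r s assume r: "r \<in> ?p" and s: "s \<in> ?p"
    then obtain k l :: nat where "\<forall>y\<in>N. r [^]\<^bsub>R\<^esub> k \<odot> y \<in> B" "\<forall>y\<in>N. s [^]\<^bsub>R\<^esub> l \<odot> y \<in> B" by blast
    then have "\<forall>y\<in>N. (r \<oplus>\<^bsub>R\<^esub> s) [^]\<^bsub>R\<^esub> (k + l) \<odot> y \<in> B"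
      using r s Nc by (auto intro!: power_sum_mem_submodule[OF X B])
    then show "r \<oplus>\<^bsub>R\<^esub> s \<in> ?p" using r s by blast
  next
    fix t r assume t: "t \<in> carrier R" and r: "r \<in> ?p"
    then obtain k :: nat where k: "\<forall>y\<in>N. r [^]\<^bsub>R\<^esub> k \<odot> y \<in> B" by blast
    have "(t \<otimes>\<^bsub>R\<^esub> r) [^]\<^bsub>R\<^esub> k \<odot> y \<in> B" if "y \<in> N" for y
    proof -
      have "(t \<otimes>\<^bsub>R\<^esub> r) [^]\<^bsub>R\<^esub> k \<odot> y = t [^]\<^bsub>R\<^esub> k \<odot> (r [^]\<^bsub>R\<^esub> k \<odot> y)"
        using t r Nc[OF that] by (simp add: R.nat_pow_distrib smult_assoc1)
      then show ?thesis using k that submodule_smult[OF B] t by simp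
    qed
    then show "t \<otimes>\<^bsub>R\<^esub> r \<in> ?p" using t r by auto
  qed (auto simp: is_cring)
  show "carrier R \<noteq> ?p"
  proof
    assume "carrier R = ?p"
    then obtain k :: nat where "\<forall>y\<in>N. \<one>\<^bsub>R\<^esub> [^]\<^bsub>R\<^esub> k \<odot> y \<in> B" using R.one_closed by blast
    then show False using NB Nc by auto
  qed
  fix a b assume ab: "a \<in> carrier R" "b \<in> carrier R" "a \<otimes>\<^bsub>R\<^esub> b \<in> ?p"
  show "a \<in> ?p \<or> b \<in> ?p"
  proof (cases "a \<in> ?p")
    case False
    then have surj: "N \<subseteq> {a \<odot> y \<oplus> b |y b. y \<in> N \<and> b \<in> B}" using sec[OF ab(1)] ab(1) by blast
    obtain k :: nat where k: "\<forall>y\<in>N. (a \<otimes>\<^bsub>R\<^esub> b) [^]\<^bsub>R\<^esub> k \<odot> y \<in> B" using ab(3) by blast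
    have "b [^]\<^bsub>R\<^esub> k \<odot> y \<in> B" if y: "y \<in> N" for y
    proof -
      \<comment> \<open>As a is surjective on N/B, y can be divided by a^k modulo \<open>B\<close>;
        then b^k y becomes (ab)^k w modulo \<open>B\<close>, which vanishes.\<close>
      obtain w c where w: "w \<in> N" "c \<in> B" "y = a [^]\<^bsub>R\<^esub> k \<odot> w \<oplus> c" 
        using iterate_surjective[OF X N B ab(1) surj y, of k] by blast
      have "b [^]\<^bsub>R\<^esub> k \<odot> y = (a \<otimes>\<^bsub>R\<^esub> b) [^]\<^bsub>R\<^esub> k \<odot> w \<oplus> b [^]\<^bsub>R\<^esub> k \<odot> c"
        unfolding w(3) using ab w Nc Bc
        by (simp add: smult_r_distr R.nat_pow_distrib R.m_comm flip: smult_assoc1)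
      then show ?thesis using k w submodule_add[OF B] submodule_smult[OF B] ab by simp
    qed
    then show ?thesis using ab(2) by blast
  qed simp
qed (use X in \<open>auto simp: module_def\<close>)

text \<open>The submodule (xs)Z + B, unfolded generator by generator to fit inductions over the
  list.\<close>

fun linear_combinations ::
  "('r, 'x) module \<Rightarrow> 'r list \<Rightarrow> 'x set \<Rightarrow> 'x set \<Rightarrow> 'x set" where
  "linear_combinations X [] Z B = B"
| "linear_combinations X (x # xs) Z B =
     {x \<odot>\<^bsub>X\<^esub> z \<oplus>\<^bsub>X\<^esub> y |z y. z \<in> Z \<and> y \<in> linear_combinations X xs Z B}"

lemma linear_combinations_submodule:
  fixes X (structure)
  assumes "module R X" "submodule Z R X" "submodule B R X" "set xs \<subseteq> carrier R"
  shows "submodule (linear_combinations X xs Z B) R X \<and> B \<subseteq> linear_combinations X xs Z B"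
  using assms(4)
proof (induction xs)
  case Nil
  then show ?case using assms by simp
next
  case (Cons x xs)
  interpret module R X by fact
  let ?L = "linear_combinations X xs Z B"
  have L: "submodule ?L R X" "B \<subseteq> ?L" using Cons by auto
  have "B \<subseteq> linear_combinations X (x # xs) Z B"
  proof
    fix b assume b: "b \<in> B"
    then have "b = x \<odot> \<zero> \<oplus> b" using submodule_carrier[OF assms(3)] Cons.prems by simp
    then show "b \<in> linear_combinations X (x # xs) Z B" using b L(2) submodule_zero[OF assms(2)] by auto
  qed
  then show ?case using submodule_smult_image_sum[OF assms(1,2) L(1), of x] Cons.prems by simp
qed

lemma linear_combinations_mono: "B \<subseteq> B' \<Longrightarrow> linear_combinations X xs Z B \<subseteq> linear_combinations X xs Z B'"
  by (induction xs) (simp_all, blast)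

text \<open>Iterating Z = xZ + W until x^k maps \<open>Z\<close> into \<open>Y\<close>, and so into
  W, absorbs the term x^k Z. This eliminates one generator.\<close>

lemma nakayama_nilpotent:
  fixes X (structure)
  assumes X: "module R X" and Z: "submodule Z R X" and Y: "submodule Y R X"
    and "set xs \<subseteq> carrier R"
    and "\<And>x. x \<in> set xs \<Longrightarrow> \<exists>k::nat. \<forall>z\<in>Z. x [^]\<^bsub>R\<^esub> k \<odot> z \<in> Y"
    and "Z \<subseteq> linear_combinations X xs Z Y"
  shows "Z \<subseteq> Y"
  using assms(4-)
proof (induction xs)
  case Nil
  then show ?case by simp
next
  case (Cons x xs)
  interpret module R X by fact
  let ?W = "linear_combinations X xs Z Y"
  have W: "submodule ?W R X" "Y \<subseteq> ?W"
    using linear_combinations_submodule[OF X Z Y, of xs] Cons.prems by auto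
  have x: "x \<in> carrier R" using Cons.prems by simp
  obtain k :: nat where k: "\<forall>z\<in>Z. x [^]\<^bsub>R\<^esub> k \<odot> z \<in> Y" using Cons.prems(2)[of x] by auto
  have "Z \<subseteq> ?W"
  proof
    fix z assume "z \<in> Z"
    then obtain v w where v: "v \<in> Z" "w \<in> ?W" "z = x [^]\<^bsub>R\<^esub> k \<odot> v \<oplus> w" 
      using iterate_surjective[OF X Z W(1) x, of z k] Cons.prems(3) by auto
    have "x [^]\<^bsub>R\<^esub> k \<odot> v \<in> ?W" using k v(1) W(2) by blast
    then show "z \<in> ?W" unfolding v(3) using v(2) submodule_add[OF W(1)] by blast
  qed
  then show ?case using Cons.IH Cons.prems by auto
qed

text \<open>\<open>Y\<close> collects the secondary summands of \<open>N/B\<close> whose primes, listed in \<open>P\<close>, do not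
  contain \<open>\<aa>\<close>.\<close>

definition surjective_core ::
  "('r, 'k) ring_scheme \<Rightarrow> ('r, 'x) module \<Rightarrow> 'x set \<Rightarrow> 'r set \<Rightarrow> 'x set \<Rightarrow> 'x set \<Rightarrow> 'r set set \<Rightarrow> bool" where
  "surjective_core R X B \<aa> N Y P \<longleftrightarrow>
     submodule Y R X \<and> B \<subseteq> Y \<and> Y \<subseteq> N \<and> finite P \<and> (\<forall>p\<in>P. primeideal p R \<and> \<not> \<aa> \<subseteq> p) \<and>
     (\<forall>x\<in>carrier R. (\<forall>p\<in>P. x \<notin> p) \<longrightarrow> Y \<subseteq> {x \<odot>\<^bsub>X\<^esub> y \<oplus>\<^bsub>X\<^esub> b |y b. y \<in> Y \<and> b \<in> B}) \<and>
     (\<forall>t\<in>\<aa>. \<exists>k::nat. \<forall>z\<in>N. t [^]\<^bsub>R\<^esub> k \<odot>\<^bsub>X\<^esub> z \<in> Y)"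

lemma surjective_coreD:
  fixes X (structure)
  assumes "surjective_core R X B \<aa> N Y P"
  shows "submodule Y R X" "B \<subseteq> Y" "Y \<subseteq> N" "finite P"
    and "p \<in> P \<Longrightarrow> primeideal p R \<and> \<not> \<aa> \<subseteq> p"
    and "x \<in> carrier R \<Longrightarrow> (\<And>p. p \<in> P \<Longrightarrow> x \<notin> p) \<Longrightarrow> Y \<subseteq> {x \<odot> y \<oplus> b |y b. y \<in> Y \<and> b \<in> B}"
    and "t \<in> \<aa> \<Longrightarrow> \<exists>k::nat. \<forall>z\<in>N. t [^]\<^bsub>R\<^esub> k \<odot> z \<in> Y"
  using assms unfolding surjective_core_def by simp_all

text \<open>An element avoiding both sets of primes divides each summand separately, and the sum of
  the two exponents of nilpotency serves for \<open>N\<close>.\<close>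

lemma surjective_core_sum:
  fixes X (structure)
  assumes X: "module R X" and B: "submodule B R X" and a: "\<aa> \<subseteq> carrier R"
    and N1: "submodule N1 R X" and N2: "submodule N2 R X" and N: "submodule N R X" "N1 \<subseteq> N" "N2 \<subseteq> N"
      "N \<subseteq> {a \<oplus> b |a b. a \<in> N1 \<and> b \<in> N2}"
    and core: "surjective_core R X B \<aa> N1 Y1 P1" "surjective_core R X B \<aa> N2 Y2 P2"
  shows "surjective_core R X B \<aa> N {a \<oplus> b |a b. a \<in> Y1 \<and> b \<in> Y2} (P1 \<union> P2)"
    (is "surjective_core R X B \<aa> N ?Y _")
proof -
  interpret module R X by fact
  have Y1: "submodule Y1 R X" "B \<subseteq> Y1" "Y1 \<subseteq> N1" and Y2: "submodule Y2 R X" "B \<subseteq> Y2" "Y2 \<subseteq> N2"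
    using core unfolding surjective_core_def by auto
  have Y: "submodule ?Y R X" by (rule submodule_sum[OF X Y1(1) Y2(1)])
  have c1: "y \<in> carrier X" if "y \<in> Y1" for y using submodule_carrier[OF Y1(1) that] .
  have c2: "y \<in> carrier X" if "y \<in> Y2" for y using submodule_carrier[OF Y2(1) that] .
  have cB: "y \<in> carrier X" if "y \<in> B" for y using submodule_carrier[OF B(1) that] .
  have d1: "y \<in> carrier X" if "y \<in> N1" for y using submodule_carrier[OF N1 that] .
  have d2: "y \<in> carrier X" if "y \<in> N2" for y using submodule_carrier[OF N2 that] .
  have "B \<subseteq> ?Y"
  proof
    fix b assume b: "b \<in> B"
    then have "b = b \<oplus> \<zero>" using cB by simp
    then show "b \<in> ?Y" using b Y1(2) submodule_zero[OF Y2(1)] by blast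
  qed
  moreover have "?Y \<subseteq> N" using Y1(3) Y2(3) N(2,3) submodule_add[OF N(1)] by blast
  moreover have "?Y \<subseteq> {x \<odot> y \<oplus> b |y b. y \<in> ?Y \<and> b \<in> B}"
    if x: "x \<in> carrier R" "\<forall>p\<in>P1 \<union> P2. x \<notin> p" for x
  proof
    fix y assume "y \<in> ?Y"
    then obtain y1 y2 where y: "y1 \<in> Y1" "y2 \<in> Y2" "y = y1 \<oplus> y2" by blast
    have "Y1 \<subseteq> {x \<odot> y \<oplus> b |y b. y \<in> Y1 \<and> b \<in> B}" "Y2 \<subseteq> {x \<odot> y \<oplus> b |y b. y \<in> Y2 \<and> b \<in> B}"
      using core x unfolding surjective_core_def by auto
    then obtain w1 b1 w2 b2 where w: "w1 \<in> Y1" "b1 \<in> B" "w2 \<in> Y2" "b2 \<in> B"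
      "y1 = x \<odot> w1 \<oplus> b1" "y2 = x \<odot> w2 \<oplus> b2" using y(1,2) by blast
    have "y = x \<odot> (w1 \<oplus> w2) \<oplus> (b1 \<oplus> b2)"
      unfolding y w(5,6) using w(1-4) c1 c2 cB x by (simp add: smult_r_distr M.a_ac)
    then show "y \<in> {x \<odot> y \<oplus> b |y b. y \<in> ?Y \<and> b \<in> B}"
      using w submodule_add[OF B] by blast
  qed
  moreover have "\<exists>k::nat. \<forall>z\<in>N. t [^]\<^bsub>R\<^esub> k \<odot> z \<in> ?Y" if t: "t \<in> \<aa>" for t
  proof -
    obtain k1 k2 :: nat where k: "\<forall>z\<in>N1. t [^]\<^bsub>R\<^esub> k1 \<odot> z \<in> Y1" "\<forall>z\<in>N2. t [^]\<^bsub>R\<^esub> k2 \<odot> z \<in> Y2"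
      using surjective_coreD(7)[OF core(1) t] surjective_coreD(7)[OF core(2) t] by auto
    have tc: "t \<in> carrier R" using t a by auto
    have "t [^]\<^bsub>R\<^esub> (k1 + k2) \<odot> z \<in> ?Y" if z: "z \<in> N" for z
    proof -
      obtain a b where ab: "a \<in> N1" "b \<in> N2" "z = a \<oplus> b" using z N(4) by blast
      have "t [^]\<^bsub>R\<^esub> (k1 + k2) \<odot> z =
          t [^]\<^bsub>R\<^esub> k2 \<odot> (t [^]\<^bsub>R\<^esub> k1 \<odot> a) \<oplus> t [^]\<^bsub>R\<^esub> k1 \<odot> (t [^]\<^bsub>R\<^esub> k2 \<odot> b)"
        unfolding ab(3) using ab(1,2) d1 d2 tc
        by (simp add: smult_r_distr R.nat_pow_mult add.commute flip: smult_assoc1)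
      moreover have "t [^]\<^bsub>R\<^esub> k2 \<odot> (t [^]\<^bsub>R\<^esub> k1 \<odot> a) \<in> Y1" "t [^]\<^bsub>R\<^esub> k1 \<odot> (t [^]\<^bsub>R\<^esub> k2 \<odot> b) \<in> Y2"
        using k ab(1,2) tc submodule_smult[OF Y1(1)] submodule_smult[OF Y2(1)] by auto
      ultimately show ?thesis by blast
    qed
    then show ?thesis by blast
  qed
  ultimately show ?thesis using Y core unfolding surjective_core_def by auto
qed

text \<open>A minimal counterexample N is excluded. If every r is nilpotent or surjective on N/B,
  the core is \<open>B\<close> when all of \<aa> acts nilpotently, and N otherwise. If some r is
  neither, Fitting's argument writes N as the sum of two smaller submodules, whose cores add
  up.\<close>

lemma artinian_surjective_core:
  fixes X (structure)
  assumes X: "module R X" and Z: "submodule Z R X" and B: "submodule B R X" "B \<subseteq> Z"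
    and art: "artinian_subquotient R X Z B" and a: "\<aa> \<subseteq> carrier R"
  shows "\<exists>Y P. surjective_core R X B \<aa> Z Y P" (is "?E Z")
proof (rule ccontr)
  interpret module R X by fact
  assume "\<not> ?E Z"
  then have "Z \<in> {N. submodule N R X \<and> B \<subseteq> N \<and> N \<subseteq> Z \<and> \<not> ?E N}" using Z B by blast
  then obtain N where "N \<in> {N. submodule N R X \<and> B \<subseteq> N \<and> N \<subseteq> Z \<and> \<not> ?E N}"
    and min: "\<And>N'. N' \<in> {N. submodule N R X \<and> B \<subseteq> N \<and> N \<subseteq> Z \<and> \<not> ?E N} \<Longrightarrow> \<not> N' \<subset> N"
    using artinian_minimal[OF art, of "{N. submodule N R X \<and> B \<subseteq> N \<and> N \<subseteq> Z \<and> \<not> ?E N}"] by blast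
  then have N: "submodule N R X" "B \<subseteq> N" "N \<subseteq> Z" and notE: "\<not> ?E N" by auto
  have smaller: "?E N'" if "submodule N' R X" "B \<subseteq> N'" "N' \<subset> N" for N'
    using min[of N'] that N(3) by blast
  have Nc: "y \<in> carrier X" if "y \<in> N" for y using submodule_carrier[OF N(1) that] .
  have Bc: "y \<in> carrier X" if "y \<in> B" for y using submodule_carrier[OF B(1) that] .
  have "\<exists>r\<in>carrier R. (\<forall>k::nat. \<not> (\<forall>y\<in>N. r [^]\<^bsub>R\<^esub> k \<odot> y \<in> B)) \<and>
      \<not> N \<subseteq> {r \<odot> y \<oplus> b |y b. y \<in> N \<and> b \<in> B}"
  proof (rule ccontr)
    assume "\<not> ?thesis"
    then have sec: "(\<exists>k::nat. \<forall>y\<in>N. r [^]\<^bsub>R\<^esub> k \<odot> y \<in> B) \<or>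
      N \<subseteq> {r \<odot> y \<oplus> b |y b. y \<in> N \<and> b \<in> B}" if "r \<in> carrier R" for r using that by blast
    have BB: "B \<subseteq> {x \<odot> y \<oplus> b |y b. y \<in> B \<and> b \<in> B}" if "x \<in> carrier R" for x
    proof
      fix b assume b: "b \<in> B"
      then have "b = x \<odot> \<zero> \<oplus> b" using Bc that by simp
      then show "b \<in> {x \<odot> y \<oplus> b |y b. y \<in> B \<and> b \<in> B}"
        using b submodule_zero[OF B(1)] by blast
    qed
    let ?p = "{r \<in> carrier R. \<exists>k::nat. \<forall>y\<in>N. r [^]\<^bsub>R\<^esub> k \<odot> y \<in> B}"
    show False
    proof (cases "\<aa> \<subseteq> ?p")
      case True
      then have "?E N" unfolding surjective_core_def
        using BB N B by (intro exI[of _ B] exI[of _ "{}"]) auto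
      then show ?thesis using notE by contradiction
    next
      case False
      have "primeideal ?p R"
      proof (rule secondary_primeideal[OF X N(1) B(1)])
        show "\<not> N \<subseteq> B"
        proof
          assume "N \<subseteq> B"
          then have "\<forall>y\<in>N. r [^]\<^bsub>R\<^esub> (0::nat) \<odot> y \<in> B" for r using Nc by auto
          then show False using False a by blast
        qed
      qed (use sec in blast)
      moreover have "\<exists>k::nat. \<forall>z\<in>N. t [^]\<^bsub>R\<^esub> k \<odot> z \<in> N" if "t \<in> \<aa>" for t
        using submodule_smult[OF N(1)] that a by blast
      moreover have "N \<subseteq> {x \<odot> y \<oplus> b |y b. y \<in> N \<and> b \<in> B}" if "x \<in> carrier R" "x \<notin> ?p" for x
        using sec that by blast
      ultimately have "surjective_core R X B \<aa> N N {?p}"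
        unfolding surjective_core_def using N False by simp
      then have "?E N" by blast
      then show ?thesis using notE by contradiction
    qed
  qed
  then obtain r where r: "r \<in> carrier R" and notnil: "\<And>k::nat. \<not> (\<forall>y\<in>N. r [^]\<^bsub>R\<^esub> k \<odot> y \<in> B)"
    and notsurj: "\<not> N \<subseteq> {r \<odot> y \<oplus> b |y b. y \<in> N \<and> b \<in> B}" by blast
  define W where "W k = {r [^]\<^bsub>R\<^esub> k \<odot> y \<oplus> b |y b. y \<in> N \<and> b \<in> B}" for k :: nat
  have W1: "submodule (W k) R X" for k
    unfolding W_def by (rule submodule_smult_image_sum) (use X N B r in auto)
  have W2: "B \<subseteq> W k" for k
  proof
    fix b assume b: "b \<in> B"
    then have "b = r [^]\<^bsub>R\<^esub> k \<odot> \<zero> \<oplus> b" using Bc r by simp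
    then show "b \<in> W k" unfolding W_def using b submodule_zero[OF N(1)] by blast
  qed
  have W3: "W k \<subseteq> N" for k
    unfolding W_def using r N(2) by (auto intro!: submodule_add[OF N(1)] submodule_smult[OF N(1)])
  have W4: "W (Suc k) \<subseteq> W k" for k
  proof
    fix w assume "w \<in> W (Suc k)"
    then obtain y b where yb: "y \<in> N" "b \<in> B" "w = r [^]\<^bsub>R\<^esub> Suc k \<odot> y \<oplus> b" unfolding W_def by blast
    then have "w = r [^]\<^bsub>R\<^esub> k \<odot> (r \<odot> y) \<oplus> b" using smult_pow_Suc(1)[OF r Nc] by simp
    then show "w \<in> W k" unfolding W_def using yb submodule_smult[OF N(1) r] by blast
  qed
  have "\<And>i. W i \<subseteq> Z" using W3 N(3) by blast
  then obtain i where i: "\<And>j. j \<ge> i \<Longrightarrow> W j = W i"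
    using artinian_subquotientD[OF art, of W] W1 W2 W4 by blast
  \<comment> \<open>The successor ensures \<open>W k \<subseteq> W 1\<close>, a proper submodule of
    N because r is not surjective.\<close>
  define k where "k = Suc i"
  have k: "W (k + k) = W k" using i[of "k + k"] i[of k] by (simp add: k_def)
  define N2 where "N2 = {y \<in> N. r [^]\<^bsub>R\<^esub> k \<odot> y \<in> B}"
  have N2: "submodule N2 R X" "B \<subseteq> N2" "N2 \<subset> N"
  proof -
    show "submodule N2 R X" unfolding N2_def by (rule submodule_smult_preimage) (use X N B r in auto)
    show "B \<subseteq> N2" unfolding N2_def using N(2) submodule_smult[OF B(1)] r by auto
    show "N2 \<subset> N" unfolding N2_def using notnil[of k] by blast
  qed
  have "W k \<subset> N"
  proof -
    have "W 1 \<noteq> N" unfolding W_def using notsurj r by auto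
    moreover have "W k \<subseteq> W 1" using lift_Suc_antimono_le[of W 1 k] W4 by (auto simp: k_def)
    ultimately show ?thesis using W3 by blast
  qed
  then obtain Y1 P1 where core1: "surjective_core R X B \<aa> (W k) Y1 P1"
    using smaller[OF W1 W2, of k] by blast
  obtain Y2 P2 where core2: "surjective_core R X B \<aa> N2 Y2 P2" using smaller[OF N2] by blast
  \<comment> \<open>Since \<open>W (k + k) = W k\<close>, the multiple r^k y equals r^(2k) y' modulo
    \<open>B\<close>, and r^k sends the difference y - r^k y' into \<open>B\<close>.\<close>
  have "N \<subseteq> {a \<oplus> b |a b. a \<in> W k \<and> b \<in> N2}"
  proof
    fix y assume y: "y \<in> N"
    have "r [^]\<^bsub>R\<^esub> k \<odot> y = r [^]\<^bsub>R\<^esub> k \<odot> y \<oplus> \<zero>" using Nc[OF y] r by simp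
    then have "r [^]\<^bsub>R\<^esub> k \<odot> y \<in> W (k + k)"
      unfolding k unfolding W_def using y submodule_zero[OF B(1)] by blast
    then obtain y' b where y': "y' \<in> N" "b \<in> B" and e: "r [^]\<^bsub>R\<^esub> k \<odot> y = r [^]\<^bsub>R\<^esub> (k + k) \<odot> y' \<oplus> b"
      unfolding W_def by blast
    let ?w = "r [^]\<^bsub>R\<^esub> k \<odot> y'"
    have wN: "?w \<in> N" using submodule_smult[OF N(1)] r y' by simp
    have "r [^]\<^bsub>R\<^esub> (k + k) \<odot> y' = r [^]\<^bsub>R\<^esub> k \<odot> ?w"
      using r Nc[OF y'(1)] by (simp add: R.nat_pow_mult flip: smult_assoc1)
    then have "r [^]\<^bsub>R\<^esub> k \<odot> (y \<ominus> ?w) = b"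
      using diff_solve[OF _ _ _ e] Nc[OF y] Nc[OF wN] Bc[OF y'(2)] r Nc[OF y'(1)] by (simp add: smult_diff)
    then have d: "y \<ominus> ?w \<in> N2" unfolding N2_def using submodule_diff[OF N(1) y wN] y'(2) by simp
    have "?w = ?w \<oplus> \<zero>" using Nc[OF wN] by simp
    then have "?w \<in> W k" unfolding W_def using y' submodule_zero[OF B(1)] by blast
    moreover have "y = ?w \<oplus> (y \<ominus> ?w)"
      using diff_add_cancel[OF Nc[OF y] Nc[OF wN]] Nc[OF y] Nc[OF wN] by (simp add: M.a_comm)
    ultimately show "y \<in> {a \<oplus> b |a b. a \<in> W k \<and> b \<in> N2}" using d by blast
  qed
  then have "?E N"
    using surjective_core_sum[OF X B(1) a W1 N2(1) N(1) W3 _ _ core1 core2] N2(3) by blast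
  then show False using notE by contradiction
qed

text \<open>Every element of \<aa> is nilpotent modulo the core, so Z = (xs)Z + B forces the core to
  be all of \<open>Z\<close> by Nakayama. An element of \<aa> outside its finitely many primes then
  acts surjectively.\<close>

lemma artinian_exists_surjective:
  fixes X (structure)
  assumes X: "module R X" and Z: "submodule Z R X" and B: "submodule B R X" "B \<subseteq> Z"
    and art: "artinian_subquotient R X Z B" and a: "ideal \<aa> R"
    and xs: "set xs \<subseteq> \<aa>" and ZxZ: "Z \<subseteq> linear_combinations X xs Z B"
  shows "\<exists>x\<in>\<aa>. Z \<subseteq> {x \<odot> z \<oplus> b |z b. z \<in> Z \<and> b \<in> B}"
proof -
  interpret module R X by fact
  have ac: "\<aa> \<subseteq> carrier R" using ideal.Icarr[OF a] by auto
  obtain Y P where core: "surjective_core R X B \<aa> Z Y P"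
    using artinian_surjective_core[OF X Z B art ac] by blast
  then have Y: "submodule Y R X" "B \<subseteq> Y" "Y \<subseteq> Z" unfolding surjective_core_def by auto
  have "Z \<subseteq> Y"
  proof (rule nakayama_nilpotent[OF X Z Y(1)])
    show "set xs \<subseteq> carrier R" using xs ac by auto
    show "\<exists>k::nat. \<forall>z\<in>Z. x [^]\<^bsub>R\<^esub> k \<odot> z \<in> Y" if "x \<in> set xs" for x
      using core that xs unfolding surjective_core_def by blast
    show "Z \<subseteq> linear_combinations X xs Z Y"
      using ZxZ linear_combinations_mono[OF Y(2)] by (rule subset_trans)
  qed
  then have "Z = Y" using Y by auto
  moreover obtain x where "x \<in> \<aa>" "\<forall>p\<in>P. x \<notin> p"
    using prime_avoidance[OF is_cring a surjective_coreD(4,5)[OF core]] by blast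
  ultimately show ?thesis using surjective_coreD(6)[OF core, of x] ac by auto
qed

section \<open>Koszul complexes as iterated mapping cones\<close>

text \<open>All iterated cones of a complex have to live in one type, hence the nested pairs.\<close>

datatype 'b nest = Leaf (the_leaf: 'b) | Node (lft: "'b nest") (rgt: "'b nest")

text \<open>Opaque successors keep the simplifier from rearranging degrees.\<close>

definition sc :: "int \<Rightarrow> int" where "sc q = q + 1"
definition pd :: "int \<Rightarrow> int" where "pd q = q - 1"

lemma sc_pd [simp]: "sc (pd q) = q" "pd (sc q) = q"
  by (simp_all add: sc_def pd_def)

text \<open>The direct sum, with \<open>Node\<close> as pairing so that it stays in the type of its
  summands.\<close>

definition pair_module ::
  "('r, 'b nest) module \<Rightarrow> ('r, 'b nest) module \<Rightarrow> ('r, 'b nest) module" where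
  "pair_module A B =
     \<lparr>carrier = {Node f g |f g. f \<in> carrier A \<and> g \<in> carrier B},
      monoid.mult = undefined, monoid.one = undefined,
      ring.zero = Node \<zero>\<^bsub>A\<^esub> \<zero>\<^bsub>B\<^esub>,
      ring.add = (\<lambda>u v. Node (lft u \<oplus>\<^bsub>A\<^esub> lft v) (rgt u \<oplus>\<^bsub>B\<^esub> rgt v)),
      module.smult = (\<lambda>r u. Node (r \<odot>\<^bsub>A\<^esub> lft u) (r \<odot>\<^bsub>B\<^esub> rgt u))\<rparr>"

lemma pair_module_simps [simp]:
  "carrier (pair_module A B) = {Node f g |f g. f \<in> carrier A \<and> g \<in> carrier B}"
  "\<zero>\<^bsub>pair_module A B\<^esub> = Node \<zero>\<^bsub>A\<^esub> \<zero>\<^bsub>B\<^esub>"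
  "u \<oplus>\<^bsub>pair_module A B\<^esub> v = Node (lft u \<oplus>\<^bsub>A\<^esub> lft v) (rgt u \<oplus>\<^bsub>B\<^esub> rgt v)"
  "r \<odot>\<^bsub>pair_module A B\<^esub> u = Node (r \<odot>\<^bsub>A\<^esub> lft u) (r \<odot>\<^bsub>B\<^esub> rgt u)"
  unfolding pair_module_def by simp_all

lemma module_pair_module:
  assumes "module R A" "module R B"
  shows "module R (pair_module A B)"
proof -
  interpret A: module R A by fact
  interpret B: module R B by fact
  show ?thesis
  proof (rule moduleI)
    show "abelian_group (pair_module A B)"
    proof (rule abelian_groupI)
      fix u assume "u \<in> carrier (pair_module A B)"
      then obtain f g where u: "u = Node f g" "f \<in> carrier A" "g \<in> carrier B" by auto
      then show "\<exists>v\<in>carrier (pair_module A B). v \<oplus>\<^bsub>pair_module A B\<^esub> u = \<zero>\<^bsub>pair_module A B\<^esub>"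
        by (intro bexI[of _ "Node (\<ominus>\<^bsub>A\<^esub> f) (\<ominus>\<^bsub>B\<^esub> g)"]) (auto simp: A.M.l_neg B.M.l_neg)
    qed (auto simp: A.M.a_ac B.M.a_ac)
  qed (auto simp: A.is_cring A.smult_l_distr A.smult_r_distr A.smult_assoc1
      B.smult_l_distr B.smult_r_distr B.smult_assoc1)
qed

text \<open>The mapping cone of multiplication by an element, in its unshifted grading: each cone
  extends a complex by one degree downwards.\<close>

definition cone_module :: "(int \<Rightarrow> ('r, 'b nest) module) \<Rightarrow> int \<Rightarrow> ('r, 'b nest) module" where
  "cone_module C q = pair_module (C q) (C (sc q))"

text \<open>With the minus sign the square vanishes: D(xg) cancels against x(-Dg).\<close>

definition cone_map ::
  "'r \<Rightarrow> (int \<Rightarrow> ('r, 'b nest) module) \<Rightarrow> (int \<Rightarrow> 'b nest \<Rightarrow> 'b nest) \<Rightarrow> int \<Rightarrow> 'b nest \<Rightarrow> 'b nest" where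
  "cone_map x C D q u =
     Node (D q (lft u) \<oplus>\<^bsub>C (sc q)\<^esub> x \<odot>\<^bsub>C (sc q)\<^esub> rgt u) (\<ominus>\<^bsub>C (sc (sc q))\<^esub> D (sc q) (rgt u))"

definition cone_set :: "(int \<Rightarrow> 'b nest set) \<Rightarrow> int \<Rightarrow> 'b nest set" where
  "cone_set G q = {Node f g |f g. f \<in> G q \<and> g \<in> G (sc q)}"

definition cocycles ::
  "(int \<Rightarrow> ('r, 'b nest) module) \<Rightarrow> (int \<Rightarrow> 'b nest \<Rightarrow> 'b nest) \<Rightarrow> (int \<Rightarrow> 'b nest set) \<Rightarrow> int \<Rightarrow> 'b nest set" where
  "cocycles C D G q = {z \<in> G q. D q z = \<zero>\<^bsub>C (sc q)\<^esub>}"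

definition coboundaries ::
  "(int \<Rightarrow> 'b nest \<Rightarrow> 'b nest) \<Rightarrow> (int \<Rightarrow> 'b nest set) \<Rightarrow> int \<Rightarrow> 'b nest set" where
  "coboundaries D G q = D (pd q) ` G (pd q)"

lemma coboundaries_Suc: "coboundaries D G (sc p) = D p ` G p"
  by (simp add: coboundaries_def)

text \<open>The complex \<open>C\<close> carries a chosen subcomplex \<open>G\<close>, given by
  sets. A resolution and its torsion subcomplexes then share modules and differentials, and
  comparison maps are inclusions.\<close>

locale subcomplex = R?: cring R for R :: "('r, 'k) ring_scheme" (structure) +
  fixes C :: "int \<Rightarrow> ('r, 'b nest) module" and D :: "int \<Rightarrow> 'b nest \<Rightarrow> 'b nest"
    and G :: "int \<Rightarrow> 'b nest set"
  assumes mod: "module R (C q)"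
    and lin: "linear_map R (C q) (C (sc q)) (D q)"
    and DD: "u \<in> carrier (C q) \<Longrightarrow> D (sc q) (D q u) = \<zero>\<^bsub>C (sc (sc q))\<^esub>"
    and sub: "submodule (G q) R (C q)"
    and DG: "u \<in> G q \<Longrightarrow> D q u \<in> G (sc q)"
begin

lemmas Gc = submodule_carrier[OF sub]
lemmas D_closed = linear_mapD(1)[OF lin]
lemmas D_add = linear_mapD(2)[OF lin]
lemmas D_smult = linear_mapD(3)[OF lin]
lemmas D_zero = linear_map_zero_neg_diff(1)[OF mod mod lin]
lemmas D_neg = linear_map_zero_neg_diff(2)[OF mod mod lin]
lemmas ab = module.axioms(2)[OF mod]

lemma neg_zero: "\<ominus>\<^bsub>C q\<^esub> \<zero>\<^bsub>C q\<^esub> = \<zero>\<^bsub>C q\<^esub>"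
proof -
  interpret module R "C q" by (rule mod)
  show ?thesis using M.add.inv_one by (simp add: a_inv_def)
qed

lemmas module_simps = neg_zero abelian_monoid.zero_closed[OF abelian_group.axioms(1)[OF ab]]
  abelian_monoid.a_closed[OF abelian_group.axioms(1)[OF ab]]
  abelian_group.a_inv_closed[OF ab] module.smult_closed[OF mod]
  abelian_monoid.l_zero[OF abelian_group.axioms(1)[OF ab]]
  abelian_monoid.r_zero[OF abelian_group.axioms(1)[OF ab]]
  module.smult_r_null[OF mod] abelian_group.minus_minus[OF ab]
  abelian_group.r_neg[OF ab] abelian_group.l_neg[OF ab]
  module.smult_r_distr[OF mod] module.smult_r_minus[OF mod] abelian_group.minus_add[OF ab]
  D_closed D_add D_smult D_zero D_neg

lemma smult_comm:
  assumes "a \<in> carrier R" "b \<in> carrier R" "u \<in> carrier (C q)"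
  shows "a \<odot>\<^bsub>C q\<^esub> (b \<odot>\<^bsub>C q\<^esub> u) = b \<odot>\<^bsub>C q\<^esub> (a \<odot>\<^bsub>C q\<^esub> u)"
  using assms by (simp add: R.m_comm flip: module.smult_assoc1[OF mod])

lemmas assoc = abelian_monoid.a_assoc[OF abelian_group.axioms(1)[OF ab]]
lemmas comm = abelian_monoid.a_comm[OF abelian_group.axioms(1)[OF ab]]
lemmas lcomm = abelian_monoid.a_lcomm[OF abelian_group.axioms(1)[OF ab]]

lemma cocycles_submodule: "submodule (cocycles C D G q) R (C q)"
  unfolding cocycles_def by (rule submodule_kernel[OF mod mod lin sub])

lemma coboundaries_submodule: "submodule (coboundaries D G q) R (C q)"
proof -
  have "submodule (D (pd q) ` G (pd q)) R (C (sc (pd q)))"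
    by (rule submodule_image[OF mod mod lin sub])
  then show ?thesis by (simp add: coboundaries_def)
qed

lemma coboundaries_subset: "coboundaries D G q \<subseteq> cocycles C D G q"
  using DG[of _ "pd q"] DD[of _ "pd q"] Gc[of _ "pd q"]
  by (auto simp: cocycles_def coboundaries_def)

lemma cone:
  assumes x: "x \<in> carrier R"
  shows "subcomplex R (cone_module C) (cone_map x C D) (cone_set G)"
proof (rule subcomplex.intro[OF R.is_cring], rule subcomplex_axioms.intro)
  fix q
  show 1: "module R (cone_module C q)" for q
    unfolding cone_module_def by (rule module_pair_module[OF mod mod])
  show "linear_map R (cone_module C q) (cone_module C (sc q)) (cone_map x C D q)"
    unfolding linear_map_def cone_module_def cone_map_def
    using x by (auto simp: module_simps assoc lcomm comm smult_comm)
  show "cone_map x C D (sc q) (cone_map x C D q u) = \<zero>\<^bsub>cone_module C (sc (sc q))\<^esub>"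
    if "u \<in> carrier (cone_module C q)" for u
    using that x by (auto simp: cone_module_def cone_map_def module_simps DD)
  show "submodule (cone_set G q) R (cone_module C q)"
    by (rule submodule_of_closed[OF 1])
      (use submoduleD[OF sub] in \<open>auto simp: cone_set_def cone_module_def\<close>)
  show "cone_map x C D q u \<in> cone_set G (sc q)" if "u \<in> cone_set G q" for u
    using that x submoduleD[OF sub] DG by (auto simp: cone_set_def cone_map_def)
qed

lemma neg_cancel:
  assumes "u \<in> carrier (C q)" "\<ominus>\<^bsub>C q\<^esub> u = \<zero>\<^bsub>C q\<^esub>"
  shows "u = \<zero>\<^bsub>C q\<^esub>"
proof -
  interpret module R "C q" by (rule mod)
  show ?thesis using assms neg_zero by (metis M.minus_minus)
qed

text \<open>The stretch H^q(C) -> H^q(cone) -> H^(q+1)(C) of the long exact sequence. A cocycle (f,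
  Dk) differs from (f + xk, 0) by the coboundary of (0, -k).\<close>

lemma cone_exact:
  assumes x: "x \<in> carrier R"
  shows "exact_subquotients R (C q) (cone_module C q) (C (sc q)) (cocycles C D G q) (coboundaries D G q)
    (\<lambda>f. Node f \<zero>\<^bsub>C (sc q)\<^esub>)
    (cocycles (cone_module C) (cone_map x C D) (cone_set G) q)
    (coboundaries (cone_map x C D) (cone_set G) q)
    rgt (cocycles C D G (sc q)) (coboundaries D G (sc q))"
proof -
  interpret K: subcomplex R "cone_module C" "cone_map x C D" "cone_set G" by (rule cone[OF x])
  have q: "q = sc (pd q)" by simp
  note s = submoduleD[OF sub]
  show ?thesis
  proof (intro exact_subquotients.intro exact_subquotients_axioms.intro)
    show "linear_map R (C q) (cone_module C q) (\<lambda>f. Node f \<zero>\<^bsub>C (sc q)\<^esub>)"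
      unfolding linear_map_def cone_module_def by (auto simp: module_simps)
    show "linear_map R (cone_module C q) (C (sc q)) rgt"
      unfolding linear_map_def cone_module_def by (auto simp: module_simps)
    show "(\<lambda>f. Node f \<zero>\<^bsub>C (sc q)\<^esub>) ` coboundaries D G q
        \<subseteq> coboundaries (cone_map x C D) (cone_set G) q"
    proof
      fix v assume "v \<in> (\<lambda>f. Node f \<zero>\<^bsub>C (sc q)\<^esub>) ` coboundaries D G q"
      then obtain h where h: "h \<in> G (pd q)" and v: "v = Node (D (pd q) h) \<zero>\<^bsub>C (sc q)\<^esub>"
        unfolding coboundaries_def by auto
      have Dh: "D (pd q) h \<in> carrier (C q)" using DG[OF h] Gc by auto
      have "v = cone_map x C D (pd q) (Node h \<zero>\<^bsub>C q\<^esub>)"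
        unfolding v cone_map_def using h x Gc Dh D_neg[of "\<zero>\<^bsub>C q\<^esub>" q] by (simp add: module_simps)
      moreover have "Node h \<zero>\<^bsub>C q\<^esub> \<in> cone_set G (pd q)" using h s(2) by (simp add: cone_set_def)
      ultimately show "v \<in> coboundaries (cone_map x C D) (cone_set G) q"
        unfolding coboundaries_def by blast
    qed
    show "rgt ` cocycles (cone_module C) (cone_map x C D) (cone_set G) q \<subseteq> cocycles C D G (sc q)"
      unfolding cocycles_def
      by (auto simp: cone_set_def cone_map_def cone_module_def intro!: neg_cancel D_closed intro: Gc)
    show "rgt ` coboundaries (cone_map x C D) (cone_set G) q \<subseteq> coboundaries D G (sc q)"
    proof
      fix v assume "v \<in> rgt ` coboundaries (cone_map x C D) (cone_set G) q"
      then obtain k where k: "k \<in> G q" "v = \<ominus>\<^bsub>C (sc q)\<^esub> D q k"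
        unfolding coboundaries_def cone_set_def cone_map_def by auto
      then have "v = D q (\<ominus>\<^bsub>C q\<^esub> k)" using Gc by (simp add: module_simps)
      then show "v \<in> coboundaries D G (sc q)" unfolding coboundaries_def using s(4)[OF k(1)] by simp
    qed
    fix z assume z: "z \<in> cocycles (cone_module C) (cone_map x C D) (cone_set G) q"
      and rz: "rgt z \<in> coboundaries D G (sc q)"
    then obtain f g where fg: "z = Node f g" "f \<in> G q" "g \<in> G (sc q)"
      and Df: "D q f \<oplus>\<^bsub>C (sc q)\<^esub> x \<odot>\<^bsub>C (sc q)\<^esub> g = \<zero>\<^bsub>C (sc q)\<^esub>"
      unfolding cocycles_def cone_set_def cone_map_def cone_module_def by auto
    obtain k where k: "k \<in> G q" "g = D q k" using rz fg unfolding coboundaries_def by auto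
    have c: "f \<in> carrier (C q)" "k \<in> carrier (C q)" using fg k Gc by auto
    let ?z = "f \<oplus>\<^bsub>C q\<^esub> x \<odot>\<^bsub>C q\<^esub> k"
    have "?z \<in> cocycles C D G q"
      unfolding cocycles_def using c x Df k fg s(3,6) by (simp add: module_simps)
    moreover have "cone_map x C D (pd q) (Node \<zero>\<^bsub>C (pd q)\<^esub> (\<ominus>\<^bsub>C q\<^esub> k)) = Node (\<ominus>\<^bsub>C q\<^esub> (x \<odot>\<^bsub>C q\<^esub> k)) g"
      unfolding cone_map_def using c x k D_zero[of "pd q"] by (simp add: module_simps)
    then have "Node (\<ominus>\<^bsub>C q\<^esub> (x \<odot>\<^bsub>C q\<^esub> k)) g \<in> coboundaries (cone_map x C D) (cone_set G) q"
      unfolding coboundaries_def cone_set_def using s(2,4) k by force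
    moreover have "z = Node ?z \<zero>\<^bsub>C (sc q)\<^esub> \<oplus>\<^bsub>cone_module C q\<^esub> Node (\<ominus>\<^bsub>C q\<^esub> (x \<odot>\<^bsub>C q\<^esub> k)) g"
      unfolding fg cone_module_def using c x fg Gc by (simp add: module_simps assoc)
    ultimately show "\<exists>z1\<in>cocycles C D G q. \<exists>b\<in>coboundaries (cone_map x C D) (cone_set G) q.
        z = Node z1 \<zero>\<^bsub>C (sc q)\<^esub> \<oplus>\<^bsub>cone_module C q\<^esub> b" by blast
  qed (rule mod K.mod cocycles_submodule coboundaries_submodule K.cocycles_submodule
      K.coboundaries_submodule coboundaries_subset)+
qed

end

section \<open>Koszul complexes of lists and their top cohomology\<close>

fun koszul_module :: "'r list \<Rightarrow> (int \<Rightarrow> ('r, 'b nest) module) \<Rightarrow> int \<Rightarrow> ('r, 'b nest) module" where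
  "koszul_module [] C = C"
| "koszul_module (x # xs) C = cone_module (koszul_module xs C)"

fun koszul_map ::
  "'r list \<Rightarrow> (int \<Rightarrow> ('r, 'b nest) module) \<Rightarrow> (int \<Rightarrow> 'b nest \<Rightarrow> 'b nest) \<Rightarrow> int \<Rightarrow> 'b nest \<Rightarrow> 'b nest" where
  "koszul_map [] C D = D"
| "koszul_map (x # xs) C D = cone_map x (koszul_module xs C) (koszul_map xs C D)"

fun koszul_set :: "'r list \<Rightarrow> (int \<Rightarrow> 'b nest set) \<Rightarrow> int \<Rightarrow> 'b nest set" where
  "koszul_set [] G = G"
| "koszul_set (x # xs) G = cone_set (koszul_set xs G)"

text \<open>The inclusion of \<open>C\<close> as the subcomplex whose second components all vanish;
  on top cohomology it induces the projection of H onto H/(xs)H.\<close>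

fun koszul_incl :: "(int \<Rightarrow> ('r, 'b nest) module) \<Rightarrow> int \<Rightarrow> 'r list \<Rightarrow> 'b nest \<Rightarrow> 'b nest" where
  "koszul_incl C q [] z = z"
| "koszul_incl C q (x # xs) z = Node (koszul_incl C q xs z) \<zero>\<^bsub>koszul_module xs C (sc q)\<^esub>"

text \<open>Always taking the second entry projects degree q onto the component of \<open>C\<close>
  in degree q + n, for a list of length n. Up to sign this is a cochain map, and it detects the
  bottom cohomology of the Koszul complex.\<close>

fun koszul_top :: "'r list \<Rightarrow> 'b nest \<Rightarrow> 'b nest" where
  "koszul_top [] u = u"
| "koszul_top (x # xs) u = koszul_top xs (rgt u)"

context subcomplex
begin

abbreviation "KM xs \<equiv> koszul_module xs C"
abbreviation "KZ xs \<equiv> cocycles (koszul_module xs C) (koszul_map xs C D) (koszul_set xs G)"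
abbreviation "KB xs \<equiv> coboundaries (koszul_map xs C D) (koszul_set xs G)"

lemma koszul:
  assumes "set xs \<subseteq> carrier R"
  shows "subcomplex R (koszul_module xs C) (koszul_map xs C D) (koszul_set xs G)"
  using assms
proof (induction xs)
  case Nil
  then show ?case by (simp add: subcomplex_axioms)
next
  case (Cons x xs)
  then interpret K: subcomplex R "koszul_module xs C" "koszul_map xs C D" "koszul_set xs G" by simp
  show ?case using K.cone[of x] Cons.prems by simp
qed

lemma koszul_exact:
  assumes "set (x # xs) \<subseteq> carrier R"
  shows "exact_subquotients R (KM xs q) (KM (x # xs) q) (KM xs (sc q)) (KZ xs q) (KB xs q)
    (\<lambda>f. Node f \<zero>\<^bsub>KM xs (sc q)\<^esub>) (KZ (x # xs) q) (KB (x # xs) q) rgt (KZ xs (sc q)) (KB xs (sc q))"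
proof -
  interpret K: subcomplex R "koszul_module xs C" "koszul_map xs C D" "koszul_set xs G"
    using koszul assms by simp
  show ?thesis using K.cone_exact[of x q] assms by simp
qed

lemma koszul_noetherian:
  assumes "set xs \<subseteq> carrier R"
    and "\<And>q. noetherian_subquotient R (C q) (cocycles C D G q) (coboundaries D G q)"
  shows "noetherian_subquotient R (KM xs q) (KZ xs q) (KB xs q)"
  using assms(1)
proof (induction xs arbitrary: q)
  case (Cons x xs)
  then show ?case using exact_subquotients.noetherian_middle[OF koszul_exact] by simp
qed (simp add: assms)

lemma koszul_locally_zero:
  assumes "set xs \<subseteq> carrier R" "primeideal p R"
    and "\<And>q. locally_zero_subquotient R p (C q) (cocycles C D G q) (coboundaries D G q)"
  shows "locally_zero_subquotient R p (KM xs q) (KZ xs q) (KB xs q)"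
  using assms(1)
proof (induction xs arbitrary: q)
  case (Cons x xs)
  then show ?case 
    using exact_subquotients.locally_zero_middle[OF koszul_exact[OF Cons.prems] assms(2)] by simp
qed (simp add: assms)

lemma koszul_vanishing_above:
  assumes "set xs \<subseteq> carrier R" "\<And>q. q > c \<Longrightarrow> cocycles C D G q \<subseteq> coboundaries D G q" "q > c"
  shows "KZ xs q \<subseteq> KB xs q"
  using assms(1,3)
proof (induction xs arbitrary: q)
  case (Cons x xs)
  have "sc q > c" using Cons.prems by (simp add: sc_def)
  then show ?case
    using exact_subquotients.zero_middle[OF koszul_exact[OF Cons.prems(1)], of q] Cons by simp
qed (simp add: assms)

text \<open>In degree q, the complex on n elements is assembled from \<open>C\<close> in degrees q
  to q + n.\<close>

lemma koszul_vanishing_below: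
  assumes "set xs \<subseteq> carrier R" "\<And>q. q < c \<Longrightarrow> cocycles C D G q \<subseteq> coboundaries D G q"
    "q < c - int (length xs)"
  shows "KZ xs q \<subseteq> KB xs q"
  using assms(1,3)
proof (induction xs arbitrary: q)
  case (Cons x xs)
  have "sc q < c - int (length xs)" "q < c - int (length xs)" using Cons.prems by (simp_all add: sc_def)
  then show ?case
    using exact_subquotients.zero_middle[OF koszul_exact[OF Cons.prems(1)], of q] Cons by simp
qed (simp add: assms)

lemma koszul_incl_linear:
  assumes "set xs \<subseteq> carrier R"
  shows "linear_map R (C q) (KM xs q) (koszul_incl C q xs)"
  using assms
proof (induction xs)
  case Nil
  then show ?case by (simp add: linear_map_def)
next
  case (Cons x xs)
  interpret K: subcomplex R "koszul_module xs C" "koszul_map xs C D" "koszul_set xs G"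
    using koszul Cons.prems by simp
  have "linear_map R (C q) (KM xs q) (koszul_incl C q xs)" using Cons by simp
  then show ?case by (auto simp: linear_map_def cone_module_def K.module_simps)
qed

lemma koszul_incl_cocycle:
  assumes "set xs \<subseteq> carrier R" "z \<in> cocycles C D G q"
  shows "koszul_incl C q xs z \<in> KZ xs q"
  using assms(1)
proof (induction xs)
  case Nil
  then show ?case using assms by simp
next
  case (Cons x xs)
  interpret K: subcomplex R "koszul_module xs C" "koszul_map xs C D" "koszul_set xs G"
    using koszul Cons.prems by simp
  show ?case using Cons submodule_zero[OF K.sub]
    by (simp add: cocycles_def cone_set_def cone_map_def cone_module_def K.module_simps)
qed

text \<open>In each cone step the outer term in degree c + 1 vanishes, so the cohomology in degree c
  is covered by that of the inner complex, and in the end by that of \<open>C\<close>.\<close>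

lemma koszul_cocycle_decomp:
  assumes "set xs \<subseteq> carrier R" "\<And>q. q > c \<Longrightarrow> cocycles C D G q \<subseteq> coboundaries D G q"
    and "g \<in> KZ xs c"
  shows "\<exists>w\<in>cocycles C D G c. \<exists>b\<in>KB xs c. g = koszul_incl C c xs w \<oplus>\<^bsub>KM xs c\<^esub> b"
  using assms(1,3)
proof (induction xs arbitrary: g)
  case Nil
  have "g \<in> carrier (C c)" using Nil cocycles_submodule submodule_carrier by fastforce
  then have "g = koszul_incl C c [] g \<oplus>\<^bsub>KM [] c\<^esub> \<zero>\<^bsub>C c\<^esub>" by (simp add: module_simps)
  then show ?case using Nil submodule_zero[OF coboundaries_submodule] by (metis koszul_map.simps(1) koszul_module.simps(1) koszul_set.simps(1))
next
  case (Cons x xs)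
  interpret K: subcomplex R "koszul_module xs C" "koszul_map xs C D" "koszul_set xs G"
    using koszul Cons.prems by simp
  interpret K': subcomplex R "koszul_module (x # xs) C" "koszul_map (x # xs) C D" "koszul_set (x # xs) G"
    using koszul Cons.prems by blast
  interpret E: exact_subquotients R "KM xs c" "KM (x # xs) c" "KM xs (sc c)" "KZ xs c" "KB xs c"
    "\<lambda>f. Node f \<zero>\<^bsub>KM xs (sc c)\<^esub>" "KZ (x # xs) c" "KB (x # xs) c" rgt "KZ xs (sc c)" "KB xs (sc c)"
    by (rule koszul_exact[OF Cons.prems(1)])
  have "rgt g \<in> KB xs (sc c)"
  proof -
    have "c < sc c" by (simp add: sc_def)
    then have "KZ xs (sc c) \<subseteq> KB xs (sc c)"
      using koszul_vanishing_above[of xs c "sc c"] assms(2) Cons.prems by auto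
    then show ?thesis using E.\<beta>(2) Cons.prems(2) by blast
  qed
  then obtain z1 b where zb: "z1 \<in> KZ xs c" "b \<in> KB (x # xs) c"
    and g: "g = Node z1 \<zero>\<^bsub>KM xs (sc c)\<^esub> \<oplus>\<^bsub>KM (x # xs) c\<^esub> b" using E.ex[OF Cons.prems(2)] by blast
  obtain w b' where wb: "w \<in> cocycles C D G c" "b' \<in> KB xs c" and z1: "z1 = koszul_incl C c xs w \<oplus>\<^bsub>KM xs c\<^esub> b'"
    using Cons.IH[OF _ zb(1)] Cons.prems by auto
  have b'': "Node b' \<zero>\<^bsub>KM xs (sc c)\<^esub> \<in> KB (x # xs) c" using E.\<alpha>(2) wb(2) by blast
  have cw: "koszul_incl C c xs w \<in> carrier (KM xs c)"
    using koszul_incl_cocycle[OF _ wb(1), of xs] submodule_carrier[OF K.cocycles_submodule] Cons.prems by auto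
  have "g = koszul_incl C c (x # xs) w \<oplus>\<^bsub>KM (x # xs) c\<^esub> (Node b' \<zero>\<^bsub>KM xs (sc c)\<^esub> \<oplus>\<^bsub>KM (x # xs) c\<^esub> b)"
  proof -
    have "Node z1 \<zero>\<^bsub>KM xs (sc c)\<^esub> = koszul_incl C c (x # xs) w \<oplus>\<^bsub>KM (x # xs) c\<^esub> Node b' \<zero>\<^bsub>KM xs (sc c)\<^esub>"
      unfolding z1 by (simp add: cone_module_def K.module_simps)
    moreover have "koszul_incl C c (x # xs) w \<in> carrier (KM (x # xs) c)"
      using cw by (simp add: cone_module_def K.module_simps)
    ultimately show ?thesis unfolding g
      using K'.assoc submodule_carrier[OF K'.coboundaries_submodule] b'' zb(2) by metis
  qed
  then show ?case using wb(1) submodule_add[OF K'.coboundaries_submodule b'' zb(2)] by blast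
qed

text \<open>If z is the coboundary of (h, k), then k is a cocycle of the inner complex, hence
  represented by some w of \<open>C\<close>. So z - xw becomes a coboundary already for the shorter
  list.\<close>

lemma koszul_incl_coboundary:
  assumes "set xs \<subseteq> carrier R" "\<And>q. q > c \<Longrightarrow> cocycles C D G q \<subseteq> coboundaries D G q"
    and "z \<in> cocycles C D G c" "koszul_incl C c xs z \<in> KB xs c"
  shows "z \<in> linear_combinations (C c) xs (cocycles C D G c) (coboundaries D G c)"
  using assms(1,3,4)
proof (induction xs arbitrary: z)
  case Nil
  then show ?case by simp
next
  case (Cons x xs)
  interpret K: subcomplex R "koszul_module xs C" "koszul_map xs C D" "koszul_set xs G"
    using koszul Cons.prems by simp
  interpret Cc: module R "C c" by (rule mod)
  interpret Kc: module R "KM xs c" by (rule K.mod)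
  have x: "x \<in> carrier R" and xs: "set xs \<subseteq> carrier R" using Cons.prems by auto
  obtain h k where h: "h \<in> koszul_set xs G (pd c)" and k: "k \<in> koszul_set xs G c"
    and e1: "koszul_incl C c xs z = koszul_map xs C D (pd c) h \<oplus>\<^bsub>KM xs c\<^esub> x \<odot>\<^bsub>KM xs c\<^esub> k"
    and e2: "\<zero>\<^bsub>KM xs (sc c)\<^esub> = \<ominus>\<^bsub>KM xs (sc c)\<^esub> koszul_map xs C D c k"
    using Cons.prems(3) by (auto simp: coboundaries_def cone_set_def cone_map_def)
  have "k \<in> KZ xs c" unfolding cocycles_def using k K.neg_cancel[OF _ e2[symmetric]] K.Gc[OF k] by (simp add: K.D_closed)
  then obtain w b where w: "w \<in> cocycles C D G c" "b \<in> KB xs c" and k': "k = koszul_incl C c xs w \<oplus>\<^bsub>KM xs c\<^esub> b"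
    using koszul_cocycle_decomp[OF xs assms(2)] by blast
  have zc: "z \<in> carrier (C c)" "w \<in> carrier (C c)"
    using Cons.prems w submodule_carrier[OF cocycles_submodule] by auto
  let ?\<iota> = "koszul_incl C c xs"
  note lin\<iota> = koszul_incl_linear[OF xs, of c]
  have \<iota>c: "?\<iota> z \<in> carrier (KM xs c)" "?\<iota> w \<in> carrier (KM xs c)"
    using linear_mapD(1)[OF lin\<iota>] zc by auto
  have bc: "b \<in> carrier (KM xs c)" using w(2) submodule_carrier[OF K.coboundaries_submodule] by auto
  have hB: "koszul_map xs C D (pd c) h \<in> KB xs c" unfolding coboundaries_def using h by blast
  have hc: "koszul_map xs C D (pd c) h \<in> carrier (KM xs c)"
    using submodule_carrier[OF K.coboundaries_submodule hB] .
  have "?\<iota> (z \<ominus>\<^bsub>C c\<^esub> x \<odot>\<^bsub>C c\<^esub> w) = ?\<iota> z \<ominus>\<^bsub>KM xs c\<^esub> x \<odot>\<^bsub>KM xs c\<^esub> ?\<iota> w"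
    using linear_map_zero_neg_diff(3)[OF mod K.mod lin\<iota>] linear_mapD(3)[OF lin\<iota>] zc x by simp
  also have "\<dots> = koszul_map xs C D (pd c) h \<oplus>\<^bsub>KM xs c\<^esub> x \<odot>\<^bsub>KM xs c\<^esub> b"
  proof (rule Kc.diff_solve)
    show "?\<iota> z = x \<odot>\<^bsub>KM xs c\<^esub> ?\<iota> w \<oplus>\<^bsub>KM xs c\<^esub> (koszul_map xs C D (pd c) h \<oplus>\<^bsub>KM xs c\<^esub> x \<odot>\<^bsub>KM xs c\<^esub> b)"
      unfolding e1 k' using hc x \<iota>c bc by (simp add: Kc.smult_r_distr Kc.M.a_ac)
  qed (use \<iota>c x hc bc in auto)
  also have "\<dots> \<in> KB xs c"
    using submodule_add[OF K.coboundaries_submodule hB] submodule_smult[OF K.coboundaries_submodule x w(2)] .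
  finally have "?\<iota> (z \<ominus>\<^bsub>C c\<^esub> x \<odot>\<^bsub>C c\<^esub> w) \<in> KB xs c" .
  moreover have "z \<ominus>\<^bsub>C c\<^esub> x \<odot>\<^bsub>C c\<^esub> w \<in> cocycles C D G c"
    using submodule_diff[OF cocycles_submodule Cons.prems(2) submodule_smult[OF cocycles_submodule x w(1)]] .
  ultimately have "z \<ominus>\<^bsub>C c\<^esub> x \<odot>\<^bsub>C c\<^esub> w \<in> linear_combinations (C c) xs (cocycles C D G c) (coboundaries D G c)"
    using Cons.IH xs by blast
  moreover have "z = x \<odot>\<^bsub>C c\<^esub> w \<oplus>\<^bsub>C c\<^esub> (z \<ominus>\<^bsub>C c\<^esub> x \<odot>\<^bsub>C c\<^esub> w)"
    using Cc.diff_add_cancel[of z "x \<odot>\<^bsub>C c\<^esub> w"] zc x by (simp add: Cc.M.a_comm)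
  ultimately show ?case using w(1) by auto
qed

text \<open>The top cohomology of the Koszul complex is \<open>H/(xs)H\<close>.\<close>

lemma koszul_top_quotient:
  assumes "set xs \<subseteq> carrier R" "\<And>q. q > c \<Longrightarrow> cocycles C D G q \<subseteq> coboundaries D G q"
    and "KZ xs c \<subseteq> KB xs c"
  shows "cocycles C D G c \<subseteq> linear_combinations (C c) xs (cocycles C D G c) (coboundaries D G c)"
  using koszul_incl_coboundary[OF assms(1,2)] koszul_incl_cocycle[OF assms(1)] assms(3) by blast

end

section \<open>Bottom cohomology of the Koszul complex\<close>

context subcomplex
begin

lemma koszul_top_linear:
  assumes "set xs \<subseteq> carrier R"
  shows "linear_map R (KM xs q) (C (q + int (length xs))) (koszul_top xs)"
  using assms
proof (induction xs arbitrary: q)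
  case Nil
  then show ?case by (simp add: linear_map_def)
next
  case (Cons x xs)
  have "linear_map R (KM xs (sc q)) (C (sc q + int (length xs))) (koszul_top xs)" using Cons by simp
  moreover have "sc q + int (length xs) = q + int (length (x # xs))" by (simp add: sc_def)
  ultimately show ?case by (auto simp: linear_map_def cone_module_def)
qed

lemma koszul_top_coboundary:
  assumes "set xs \<subseteq> carrier R" "u \<in> KB xs q"
  shows "koszul_top xs u \<in> coboundaries D G (q + int (length xs))"
  using assms
proof (induction xs arbitrary: q u)
  case Nil
  then show ?case by simp
next
  case (Cons x xs)
  interpret E: exact_subquotients R "KM xs q" "KM (x # xs) q" "KM xs (sc q)" "KZ xs q" "KB xs q"
    "\<lambda>f. Node f \<zero>\<^bsub>KM xs (sc q)\<^esub>" "KZ (x # xs) q" "KB (x # xs) q" rgt "KZ xs (sc q)" "KB xs (sc q)"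
    by (rule koszul_exact[OF Cons.prems(1)])
  have "rgt u \<in> KB xs (sc q)" using E.\<beta>(3) Cons.prems(2) by blast
  then have "koszul_top xs (rgt u) \<in> coboundaries D G (sc q + int (length xs))"
    using Cons by simp
  moreover have "sc q + int (length xs) = q + int (length (x # xs))" by (simp add: sc_def)
  ultimately show ?case by simp
qed

text \<open>In the bottom degree, the inner complex has no cohomology on the left of the cone
  sequence, so each projection \<open>rgt\<close> is injective on cohomology.\<close>

lemma koszul_top_injective:
  assumes "set xs \<subseteq> carrier R" "\<And>q. q < c \<Longrightarrow> cocycles C D G q \<subseteq> coboundaries D G q"
    and "u \<in> KZ xs (c - int (length xs))" "koszul_top xs u \<in> coboundaries D G c"
  shows "u \<in> KB xs (c - int (length xs))"
  using assms(1,3,4)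
proof (induction xs arbitrary: u)
  case Nil
  then show ?case by simp
next
  case (Cons x xs)
  define q where "q = c - int (length (x # xs))"
  have q: "sc q = c - int (length xs)" "q < c - int (length xs)" by (simp_all add: q_def sc_def)
  interpret E: exact_subquotients R "KM xs q" "KM (x # xs) q" "KM xs (sc q)" "KZ xs q" "KB xs q"
    "\<lambda>f. Node f \<zero>\<^bsub>KM xs (sc q)\<^esub>" "KZ (x # xs) q" "KB (x # xs) q" rgt "KZ xs (sc q)" "KB xs (sc q)"
    by (rule koszul_exact[OF Cons.prems(1)])
  have u: "u \<in> KZ (x # xs) q" using Cons.prems(2) by (simp only: q_def)
  then have "rgt u \<in> KZ xs (sc q)" using E.\<beta>(2) by blast
  moreover have "koszul_top xs (rgt u) \<in> coboundaries D G c" using Cons.prems by simp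
  ultimately have "rgt u \<in> KB xs (sc q)" using Cons.IH[of "rgt u"] Cons.prems(1) unfolding q(1) by simp
  then obtain z1 b where zb: "z1 \<in> KZ xs q" "b \<in> KB (x # xs) q"
    and e: "u = Node z1 \<zero>\<^bsub>KM xs (sc q)\<^esub> \<oplus>\<^bsub>KM (x # xs) q\<^esub> b" using E.ex[OF u] by blast
  have "z1 \<in> KB xs q" using koszul_vanishing_below[of xs c q] assms(2) Cons.prems(1) q(2) zb(1) by auto
  then have "Node z1 \<zero>\<^bsub>KM xs (sc q)\<^esub> \<in> KB (x # xs) q" using E.\<alpha>(2) by blast
  then have "u \<in> KB (x # xs) q" unfolding e using submodule_add[OF E.B _ zb(2)] by blast
  then show ?case by (simp only: q_def)
qed

text \<open>Let u lift z for the shorter list. The projection of xu is xz, a coboundary, so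
  injectivity gives xu = Dh; then (-h, u) is a cocycle of the cone lifting z.\<close>

lemma koszul_top_surjective:
  assumes "set xs \<subseteq> carrier R" "\<And>q. q < c \<Longrightarrow> cocycles C D G q \<subseteq> coboundaries D G q"
    and z: "z \<in> cocycles C D G c" and "\<And>x. x \<in> set xs \<Longrightarrow> x \<odot>\<^bsub>C c\<^esub> z \<in> coboundaries D G c"
  shows "\<exists>u\<in>KZ xs (c - int (length xs)). koszul_top xs u = z"
  using assms(1,4)
proof (induction xs)
  case Nil
  then show ?case using z by simp
next
  case (Cons x xs)
  define q where "q = c - int (length (x # xs))"
  have q: "sc q = c - int (length xs)" by (simp_all add: q_def sc_def)
  have x: "x \<in> carrier R" and xs: "set xs \<subseteq> carrier R" using Cons.prems by auto
  interpret K: subcomplex R "koszul_module xs C" "koszul_map xs C D" "koszul_set xs G"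
    by (rule koszul[OF xs])
  obtain u where u: "u \<in> KZ xs (sc q)" "koszul_top xs u = z" using Cons q by auto
  have uc: "u \<in> carrier (KM xs (sc q))" using submodule_carrier[OF K.cocycles_submodule u(1)] .
  have xu: "x \<odot>\<^bsub>KM xs (sc q)\<^esub> u \<in> KZ xs (sc q)" using submodule_smult[OF K.cocycles_submodule x u(1)] .
  have "koszul_top xs (x \<odot>\<^bsub>KM xs (sc q)\<^esub> u) = x \<odot>\<^bsub>C c\<^esub> z"
    using linear_mapD(3)[OF koszul_top_linear[OF xs, of "sc q"] x uc] u(2) q by simp
  then have "koszul_top xs (x \<odot>\<^bsub>KM xs (sc q)\<^esub> u) \<in> coboundaries D G c" using Cons.prems by simp
  then have "x \<odot>\<^bsub>KM xs (sc q)\<^esub> u \<in> KB xs (sc q)"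
    using koszul_top_injective[OF xs assms(2)] xu unfolding q by blast
  then obtain h where h: "h \<in> koszul_set xs G q" "x \<odot>\<^bsub>KM xs (sc q)\<^esub> u = koszul_map xs C D q h"
    unfolding coboundaries_Suc by blast
  have hc: "h \<in> carrier (KM xs q)" using K.Gc h by blast
  let ?v = "Node (\<ominus>\<^bsub>KM xs q\<^esub> h) u"
  have "?v \<in> KZ (x # xs) q"
    using u h hc uc submodule_neg[OF K.sub h(1)]
    by (auto simp: cocycles_def cone_set_def cone_map_def cone_module_def K.module_simps)
  moreover have "koszul_top (x # xs) ?v = z" using u(2) by simp
  ultimately show ?case unfolding q_def by blast
qed

text \<open>\<open>H[xs]\<close> is a quotient of the bottom cohomology of the Koszul complex.\<close>

lemma koszul_bottom_exact:
  assumes xs: "set xs \<subseteq> carrier R" and van: "\<And>q. q < c \<Longrightarrow> cocycles C D G q \<subseteq> coboundaries D G q"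
  defines "V \<equiv> {z \<in> cocycles C D G c. \<forall>x\<in>set xs. x \<odot>\<^bsub>C c\<^esub> z \<in> coboundaries D G c}"
  shows "exact_subquotients R (KM xs (c - int (length xs))) (C c) (C c)
    (KZ xs (c - int (length xs))) (KB xs (c - int (length xs))) (koszul_top xs)
    V (coboundaries D G c) (\<lambda>x. x) V V" and "submodule V R (C c)" and "coboundaries D G c \<subseteq> V"
proof -
  interpret K: subcomplex R "koszul_module xs C" "koszul_map xs C D" "koszul_set xs G"
    by (rule koszul[OF xs])
  interpret Cc: module R "C c" by (rule mod)
  note B = submoduleD[OF coboundaries_submodule]
  show V: "submodule V R (C c)"
    unfolding V_def by (rule submodule_colon[OF mod cocycles_submodule coboundaries_submodule xs])
  show BV: "coboundaries D G c \<subseteq> V"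
    using coboundaries_subset B(6) xs unfolding V_def by blast
  show "exact_subquotients R (KM xs (c - int (length xs))) (C c) (C c)
    (KZ xs (c - int (length xs))) (KB xs (c - int (length xs))) (koszul_top xs)
    V (coboundaries D G c) (\<lambda>x. x) V V"
  proof (intro exact_subquotients.intro exact_subquotients_axioms.intro)
    show "linear_map R (KM xs (c - int (length xs))) (C c) (koszul_top xs)"
      using koszul_top_linear[OF xs, of "c - int (length xs)"] by simp
    show "koszul_top xs ` KB xs (c - int (length xs)) \<subseteq> coboundaries D G c"
      using koszul_top_coboundary[OF xs, of _ "c - int (length xs)"] by auto
    fix z assume z: "z \<in> V"
    then have "\<exists>u\<in>KZ xs (c - int (length xs)). koszul_top xs u = z"
      using koszul_top_surjective[OF xs van, where z = z] unfolding V_def by blast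
    moreover have "z = z \<oplus>\<^bsub>C c\<^esub> \<zero>\<^bsub>C c\<^esub>" using submodule_carrier[OF V z] by simp
    ultimately show "\<exists>z1\<in>KZ xs (c - int (length xs)). \<exists>b\<in>coboundaries D G c.
        z = koszul_top xs z1 \<oplus>\<^bsub>C c\<^esub> b" using B(2) by metis
  qed (use V BV linear_map_id in \<open>auto intro: mod K.mod K.cocycles_submodule coboundaries_submodule
      subsetD[OF K.coboundaries_subset]\<close>)
qed

end

section \<open>Comparing subcomplexes\<close>

text \<open>Vanishing cohomology of the complex G/G', phrased by representatives.\<close>

definition acyclic_quotient ::
  "(int \<Rightarrow> ('r, 'b nest) module) \<Rightarrow> (int \<Rightarrow> 'b nest \<Rightarrow> 'b nest) \<Rightarrow>
   (int \<Rightarrow> 'b nest set) \<Rightarrow> (int \<Rightarrow> 'b nest set) \<Rightarrow> bool" where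
  "acyclic_quotient C D G G' \<longleftrightarrow>
     (\<forall>q. \<forall>f\<in>G q. D q f \<in> G' (sc q) \<longrightarrow> (\<exists>h\<in>G (pd q). \<exists>g\<in>G' q. f = D (pd q) h \<oplus>\<^bsub>C q\<^esub> g))"

definition bijective_quotient ::
  "'r \<Rightarrow> (int \<Rightarrow> ('r, 'b nest) module) \<Rightarrow> (int \<Rightarrow> 'b nest set) \<Rightarrow> (int \<Rightarrow> 'b nest set) \<Rightarrow> bool" where
  "bijective_quotient x C G G' \<longleftrightarrow>
     (\<forall>q. \<forall>f\<in>G q. (\<exists>h\<in>G q. \<exists>g\<in>G' q. f = x \<odot>\<^bsub>C q\<^esub> h \<oplus>\<^bsub>C q\<^esub> g) \<and>
        (x \<odot>\<^bsub>C q\<^esub> f \<in> G' q \<longrightarrow> f \<in> G' q))"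

locale subcomplex_pair = subcomplex R C D G + S': subcomplex R C D G'
  for R :: "('r, 'k) ring_scheme" (structure) and C :: "int \<Rightarrow> ('r, 'b nest) module"
    and D G G' +
  assumes le: "G' q \<subseteq> G q"
begin

lemma cone_pair:
  assumes "x \<in> carrier R"
  shows "subcomplex_pair R (cone_module C) (cone_map x C D) (cone_set G) (cone_set G')"
  using cone[OF assms] S'.cone[OF assms] le
  by (intro subcomplex_pair.intro subcomplex_pair_axioms.intro) (auto simp: cone_set_def)

lemma koszul_pair:
  assumes "set xs \<subseteq> carrier R"
  shows "subcomplex_pair R (koszul_module xs C) (koszul_map xs C D) (koszul_set xs G) (koszul_set xs G')"
  using assms
proof (induction xs)
  case Nil
  then show ?case by (simp add: subcomplex_pair_axioms)
next
  case (Cons x xs)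
  then show ?case using subcomplex_pair.cone_pair[of R _ _ _ _ x] by simp
qed

lemma cone_bijective:
  assumes "bijective_quotient x C G G'"
  shows "bijective_quotient x (cone_module C) (cone_set G) (cone_set G')"
  unfolding bijective_quotient_def
proof (intro allI ballI conjI)
  fix q u assume "u \<in> cone_set G q"
  then obtain f g where u: "u = Node f g" "f \<in> G q" "g \<in> G (sc q)" by (auto simp: cone_set_def)
  obtain h1 g1 h2 g2 where *: "h1 \<in> G q" "g1 \<in> G' q" "f = x \<odot>\<^bsub>C q\<^esub> h1 \<oplus>\<^bsub>C q\<^esub> g1"
    "h2 \<in> G (sc q)" "g2 \<in> G' (sc q)" "g = x \<odot>\<^bsub>C (sc q)\<^esub> h2 \<oplus>\<^bsub>C (sc q)\<^esub> g2"
    using assms u(2,3) unfolding bijective_quotient_def by meson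
  then have "u = x \<odot>\<^bsub>cone_module C q\<^esub> Node h1 h2 \<oplus>\<^bsub>cone_module C q\<^esub> Node g1 g2"
    using u(1) by (simp add: cone_module_def)
  moreover have "Node h1 h2 \<in> cone_set G q" "Node g1 g2 \<in> cone_set G' q" using * by (auto simp: cone_set_def)
  ultimately show "\<exists>h\<in>cone_set G q. \<exists>g\<in>cone_set G' q. u = x \<odot>\<^bsub>cone_module C q\<^esub> h \<oplus>\<^bsub>cone_module C q\<^esub> g"
    by blast
  show "x \<odot>\<^bsub>cone_module C q\<^esub> u \<in> cone_set G' q \<longrightarrow> u \<in> cone_set G' q"
    using assms u(2,3) unfolding bijective_quotient_def u(1) by (auto simp: cone_set_def cone_module_def)
qed

text \<open>The cone of an automorphism is acyclic. Writing f0 = x h1 modulo \<open>G'\<close>, the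
  element (0, h1) bounds (f0, f1) modulo \<open>G'\<close>: the error f1 + D h1 lies in
  \<open>G'\<close> because x times it does.\<close>

lemma cone_acyclic_of_bijective:
  assumes x: "x \<in> carrier R" and bij: "bijective_quotient x C G G'"
  shows "acyclic_quotient (cone_module C) (cone_map x C D) (cone_set G) (cone_set G')"
  unfolding acyclic_quotient_def
proof (intro allI ballI impI)
  fix q u assume "u \<in> cone_set G q" and Du: "cone_map x C D q u \<in> cone_set G' (sc q)"
  then obtain f0 f1 where u: "u = Node f0 f1" "f0 \<in> G q" "f1 \<in> G (sc q)" by (auto simp: cone_set_def)
  note s = submoduleD[OF sub] and s' = submoduleD[OF S'.sub]
  have Df: "D q f0 \<oplus>\<^bsub>C (sc q)\<^esub> x \<odot>\<^bsub>C (sc q)\<^esub> f1 \<in> G' (sc q)"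
    using Du unfolding u by (simp add: cone_set_def cone_map_def)
  obtain h1 g0 where h1: "h1 \<in> G q" and g0: "g0 \<in> G' q" and f0: "f0 = x \<odot>\<^bsub>C q\<^esub> h1 \<oplus>\<^bsub>C q\<^esub> g0"
    using bij u(2) unfolding bijective_quotient_def by meson
  have c: "h1 \<in> carrier (C q)" "g0 \<in> carrier (C q)" "f1 \<in> carrier (C (sc q))"
    using h1 g0 u Gc S'.Gc by auto
  let ?g = "f1 \<oplus>\<^bsub>C (sc q)\<^esub> D q h1"
  interpret M: module R "C (sc q)" by (rule mod)
  have "x \<odot>\<^bsub>C (sc q)\<^esub> ?g = (D q f0 \<oplus>\<^bsub>C (sc q)\<^esub> x \<odot>\<^bsub>C (sc q)\<^esub> f1) \<ominus>\<^bsub>C (sc q)\<^esub> D q g0"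
  proof (rule M.diff_solve[symmetric])
    show "D q f0 \<oplus>\<^bsub>C (sc q)\<^esub> x \<odot>\<^bsub>C (sc q)\<^esub> f1 = D q g0 \<oplus>\<^bsub>C (sc q)\<^esub> x \<odot>\<^bsub>C (sc q)\<^esub> ?g"
      unfolding f0 using c x by (simp add: module_simps assoc comm lcomm)
  qed (use c x f0 in \<open>auto simp: module_simps\<close>)
  also have "\<dots> \<in> G' (sc q)" using s'(5)[OF Df S'.DG[OF g0]] .
  finally have "?g \<in> G' (sc q)" using bij s(3)[OF u(3) DG[OF h1]] unfolding bijective_quotient_def by blast
  then have "Node g0 ?g \<in> cone_set G' q" using g0 by (simp add: cone_set_def)
  moreover have "Node \<zero>\<^bsub>C (pd q)\<^esub> h1 \<in> cone_set G (pd q)" using h1 s(2) by (simp add: cone_set_def)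
  moreover have "u = cone_map x C D (pd q) (Node \<zero>\<^bsub>C (pd q)\<^esub> h1) \<oplus>\<^bsub>cone_module C q\<^esub> Node g0 ?g"
  proof -
    have "D (pd q) \<zero>\<^bsub>C (pd q)\<^esub> = \<zero>\<^bsub>C q\<^esub>" using D_zero[of "pd q"] by simp
    moreover have "f1 = \<ominus>\<^bsub>C (sc q)\<^esub> D q h1 \<oplus>\<^bsub>C (sc q)\<^esub> ?g"
      using c by (simp add: comm[of f1] module_simps flip: assoc)
    ultimately show ?thesis
      unfolding u(1) f0 cone_map_def cone_module_def using c x by (simp add: module_simps)
  qed
  ultimately show "\<exists>h\<in>cone_set G (pd q). \<exists>g\<in>cone_set G' q.
      u = cone_map x C D (pd q) h \<oplus>\<^bsub>cone_module C q\<^esub> g" by blast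
qed

text \<open>Acyclicity is used twice. It gives f1 = D h1 modulo \<open>G'\<close>, which makes f0 +
  x h1 a cocycle modulo \<open>G'\<close>, and then a bounding h0 of the latter. The pair (h0, -h1)
  bounds (f0, f1).\<close>

lemma cone_acyclic:
  assumes x: "x \<in> carrier R" and ac: "acyclic_quotient C D G G'"
  shows "acyclic_quotient (cone_module C) (cone_map x C D) (cone_set G) (cone_set G')"
  unfolding acyclic_quotient_def
proof (intro allI ballI impI)
  fix q u assume "u \<in> cone_set G q" and Du: "cone_map x C D q u \<in> cone_set G' (sc q)"
  then obtain f0 f1 where u: "u = Node f0 f1" "f0 \<in> G q" "f1 \<in> G (sc q)" by (auto simp: cone_set_def)
  note s = submoduleD[OF sub] and s' = submoduleD[OF S'.sub]
  have Df: "D q f0 \<oplus>\<^bsub>C (sc q)\<^esub> x \<odot>\<^bsub>C (sc q)\<^esub> f1 \<in> G' (sc q)" "\<ominus>\<^bsub>C (sc (sc q))\<^esub> D (sc q) f1 \<in> G' (sc (sc q))"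
    using Du unfolding u by (simp_all add: cone_set_def cone_map_def)
  have c: "f0 \<in> carrier (C q)" "f1 \<in> carrier (C (sc q))" using u Gc by auto
  have "D (sc q) f1 \<in> G' (sc (sc q))" using s'(4)[OF Df(2)] c by (simp add: module_simps)
  then obtain h1 g1 where h1: "h1 \<in> G q" and g1: "g1 \<in> G' (sc q)" and f1: "f1 = D q h1 \<oplus>\<^bsub>C (sc q)\<^esub> g1"
    using ac u(3) unfolding acyclic_quotient_def by (metis sc_pd(2))
  have c1: "h1 \<in> carrier (C q)" "g1 \<in> carrier (C (sc q))" using h1 g1 Gc S'.Gc by auto
  let ?f = "f0 \<oplus>\<^bsub>C q\<^esub> x \<odot>\<^bsub>C q\<^esub> h1"
  interpret M: module R "C (sc q)" by (rule mod)
  have "(D q f0 \<oplus>\<^bsub>C (sc q)\<^esub> x \<odot>\<^bsub>C (sc q)\<^esub> f1) \<ominus>\<^bsub>C (sc q)\<^esub> x \<odot>\<^bsub>C (sc q)\<^esub> g1 = D q ?f"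
  proof (rule M.diff_solve)
    show "D q f0 \<oplus>\<^bsub>C (sc q)\<^esub> x \<odot>\<^bsub>C (sc q)\<^esub> f1 = x \<odot>\<^bsub>C (sc q)\<^esub> g1 \<oplus>\<^bsub>C (sc q)\<^esub> D q ?f"
      unfolding f1 using c c1 x by (simp add: module_simps assoc comm lcomm)
  qed (use c c1 x in \<open>auto simp: module_simps\<close>)
  then have "D q ?f \<in> G' (sc q)" using s'(5)[OF Df(1) s'(6)[OF x g1]] by simp
  moreover have fG: "?f \<in> G q" using s(3)[OF u(2) s(6)[OF x h1]] .
  ultimately obtain h0 g0 where h0: "h0 \<in> G (pd q)" and g0: "g0 \<in> G' q" and f: "?f = D (pd q) h0 \<oplus>\<^bsub>C q\<^esub> g0"
    using ac unfolding acyclic_quotient_def by meson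
  have c0: "D (pd q) h0 \<in> carrier (C q)" "g0 \<in> carrier (C q)" using DG[OF h0] Gc g0 S'.Gc by auto
  have "Node g0 g1 \<in> cone_set G' q" using g0 g1 by (simp add: cone_set_def)
  moreover have "Node h0 (\<ominus>\<^bsub>C q\<^esub> h1) \<in> cone_set G (pd q)" using h0 s(4)[OF h1] by (simp add: cone_set_def)
  moreover have "u = cone_map x C D (pd q) (Node h0 (\<ominus>\<^bsub>C q\<^esub> h1)) \<oplus>\<^bsub>cone_module C q\<^esub> Node g0 g1"
  proof -
    have "D (pd q) h0 \<oplus>\<^bsub>C q\<^esub> \<ominus>\<^bsub>C q\<^esub> (x \<odot>\<^bsub>C q\<^esub> h1) \<oplus>\<^bsub>C q\<^esub> g0 = ?f \<oplus>\<^bsub>C q\<^esub> \<ominus>\<^bsub>C q\<^esub> (x \<odot>\<^bsub>C q\<^esub> h1)"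
      unfolding f using c0 c1 x by (simp add: module_simps assoc comm lcomm)
    also have "\<dots> = f0" using c c1 x by (simp add: module_simps assoc)
    finally show ?thesis
      unfolding u(1) f1 cone_map_def cone_module_def using c1 x by (simp add: module_simps)
  qed
  ultimately show "\<exists>h\<in>cone_set G (pd q). \<exists>g\<in>cone_set G' q.
      u = cone_map x C D (pd q) h \<oplus>\<^bsub>cone_module C q\<^esub> g" by blast
qed

lemma koszul_bijective:
  assumes "set xs \<subseteq> carrier R" "bijective_quotient x C G G'"
  shows "bijective_quotient x (koszul_module xs C) (koszul_set xs G) (koszul_set xs G')"
  using assms(1)
proof (induction xs)
  case (Cons y xs)
  then show ?case using subcomplex_pair.cone_bijective[OF koszul_pair] by simp
qed (simp add: assms)

text \<open>The inner cones preserve bijectivity of x on G/G', the cone on x itself makes the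
  quotient acyclic, and the outer cones keep it so.\<close>

lemma koszul_acyclic:
  assumes "set xs \<subseteq> carrier R" "x \<in> set xs" "bijective_quotient x C G G'"
  shows "acyclic_quotient (koszul_module xs C) (koszul_map xs C D) (koszul_set xs G) (koszul_set xs G')"
  using assms(1,2)
proof (induction xs)
  case (Cons y xs)
  interpret K: subcomplex_pair R "koszul_module xs C" "koszul_map xs C D" "koszul_set xs G" "koszul_set xs G'"
    using koszul_pair Cons.prems by simp
  show ?case
  proof (cases "x = y")
    case True
    then show ?thesis using K.cone_acyclic_of_bijective koszul_bijective[OF _ assms(3), of xs] Cons.prems by simp
  next
    case False
    then show ?thesis using K.cone_acyclic Cons by simp
  qed
qed simp

text \<open>Injectivity of H(G') -> H(G), encoded by a zero left term: if z = Df with f in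
  \<open>G\<close>, acyclicity replaces f by an element of \<open>G'\<close> with the same
  differential.\<close>

lemma acyclic_quotient_exact:
  assumes "acyclic_quotient C D G G'"
  shows "exact_subquotients R (C q) (C q) (C q) {\<zero>\<^bsub>C q\<^esub>} {\<zero>\<^bsub>C q\<^esub>} (\<lambda>x. x)
    (cocycles C D G' q) (coboundaries D G' q) (\<lambda>x. x) (cocycles C D G q) (coboundaries D G q)"
proof (intro exact_subquotients.intro exact_subquotients_axioms.intro)
  show "(\<lambda>x. x) ` {\<zero>\<^bsub>C q\<^esub>} \<subseteq> coboundaries D G' q"
    using submodule_zero[OF S'.coboundaries_submodule] by simp
  show "(\<lambda>x. x) ` cocycles C D G' q \<subseteq> cocycles C D G q" using le by (auto simp: cocycles_def)
  show "(\<lambda>x. x) ` coboundaries D G' q \<subseteq> coboundaries D G q" using le by (auto simp: coboundaries_def)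
  fix z assume z: "z \<in> cocycles C D G' q" "z \<in> coboundaries D G q"
  then obtain f where f: "f \<in> G (pd q)" "z = D (pd q) f" unfolding coboundaries_def by blast
  have "D (pd q) f \<in> G' (sc (pd q))" using z f unfolding cocycles_def by simp
  then obtain h g where h: "h \<in> G (pd (pd q))" and g: "g \<in> G' (pd q)"
    and e: "f = D (pd (pd q)) h \<oplus>\<^bsub>C (pd q)\<^esub> g"
    using assms f(1) unfolding acyclic_quotient_def by blast
  have c: "h \<in> carrier (C (pd (pd q)))" "g \<in> carrier (C (pd q))" using h g Gc S'.Gc by auto
  have "D (pd q) (D (pd (pd q)) h) = \<zero>\<^bsub>C q\<^esub>" using DD[OF c(1)] by simp
  moreover have "D (pd (pd q)) h \<in> carrier (C (pd q))" using D_closed[OF c(1)] by simp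
  moreover have "D (pd q) g \<in> carrier (C q)" using D_closed[OF c(2)] by simp
  ultimately have "z = D (pd q) g"
    unfolding f(2) e using c D_add[of _ "pd q" g] by (simp add: module_simps)
  then have "z \<in> coboundaries D G' q" using g unfolding coboundaries_def by blast
  moreover have "z = \<zero>\<^bsub>C q\<^esub> \<oplus>\<^bsub>C q\<^esub> z"
    using submodule_carrier[OF S'.cocycles_submodule z(1)] by (simp add: module_simps)
  ultimately show "\<exists>z1\<in>{\<zero>\<^bsub>C q\<^esub>}. \<exists>b\<in>coboundaries D G' q. z = z1 \<oplus>\<^bsub>C q\<^esub> b" by blast
qed (rule mod submodule_zero_singleton cocycles_submodule coboundaries_submodule
    S'.cocycles_submodule S'.coboundaries_submodule coboundaries_subset linear_map_id subset_refl)+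

end

text \<open>The first quotient replaces f by some g in \<open>G'\<close> with the same differential;
  the second one then applies to g.\<close>

lemma acyclic_quotient_trans:
  assumes "subcomplex_pair R C D G G'" "subcomplex_pair R C D G' G''"
    and "acyclic_quotient C D G G'" "acyclic_quotient C D G' G''"
  shows "acyclic_quotient C D G G''"
  unfolding acyclic_quotient_def
proof (intro allI ballI impI)
  interpret A: subcomplex_pair R C D G G' by fact
  interpret B: subcomplex_pair R C D G' G'' by fact
  fix q f assume f: "f \<in> G q" and Df: "D q f \<in> G'' (sc q)"
  then obtain h g where h: "h \<in> G (pd q)" and g: "g \<in> G' q" and e: "f = D (pd q) h \<oplus>\<^bsub>C q\<^esub> g"
    using assms(3) B.le unfolding acyclic_quotient_def by (meson subsetD)
  have c: "h \<in> carrier (C (pd q))" "g \<in> carrier (C q)" using h g A.Gc A.S'.Gc by auto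
  have Dh: "D (pd q) h \<in> carrier (C q)" using A.D_closed[OF c(1)] by simp
  have "D q (D (pd q) h) = \<zero>\<^bsub>C (sc q)\<^esub>" using A.DD[OF c(1)] by simp
  then have "D q f = D q g" unfolding e using c Dh by (simp add: A.module_simps)
  then obtain h' g' where h': "h' \<in> G' (pd q)" and g': "g' \<in> G'' q" and e': "g = D (pd q) h' \<oplus>\<^bsub>C q\<^esub> g'"
    using assms(4) g Df unfolding acyclic_quotient_def by metis
  have h'G: "h' \<in> G (pd q)" using h' A.le by blast
  have c': "h' \<in> carrier (C (pd q))" "g' \<in> carrier (C q)" using h'G g' A.Gc B.S'.Gc by auto
  have "D (pd q) (h \<oplus>\<^bsub>C (pd q)\<^esub> h') = D (pd q) h \<oplus>\<^bsub>C q\<^esub> D (pd q) h'"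
    using A.D_add[OF c(1) c'(1)] by simp
  moreover have "D (pd q) h' \<in> carrier (C q)" using A.D_closed[OF c'(1)] by simp
  ultimately have "f = D (pd q) (h \<oplus>\<^bsub>C (pd q)\<^esub> h') \<oplus>\<^bsub>C q\<^esub> g'"
    unfolding e e' using Dh c'(2) by (simp add: A.assoc)
  then show "\<exists>h\<in>G (pd q). \<exists>g\<in>G'' q. f = D (pd q) h \<oplus>\<^bsub>C q\<^esub> g"
    using submodule_add[OF A.sub h h'G] g' by blast
qed

section \<open>Noetherian rings and finitely generated modules\<close>

lemma self_module_simps [simp]:
  "carrier (self_module R) = carrier R" "\<zero>\<^bsub>self_module R\<^esub> = \<zero>\<^bsub>R\<^esub>"
  "x \<oplus>\<^bsub>self_module R\<^esub> y = x \<oplus>\<^bsub>R\<^esub> y" "r \<odot>\<^bsub>self_module R\<^esub> x = r \<otimes>\<^bsub>R\<^esub> x"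
  unfolding self_module_def by simp_all

lemma module_self_module:
  assumes "cring R"
  shows "module R (self_module R)"
proof -
  interpret cring R by fact
  show ?thesis
    by (rule moduleI; (rule abelian_groupI)?)
      (auto simp: assms a_ac l_distr r_distr m_assoc intro: bexI[of _ "\<ominus>\<^bsub>R\<^esub> _"] l_neg)
qed

lemma submodule_self_module_iff:
  assumes "cring R"
  shows "submodule J R (self_module R) \<longleftrightarrow> ideal J R"
proof
  assume "submodule J R (self_module R)"
  note J = submoduleD[OF this]
  show "ideal J R" by (rule ideal_of_closed[OF assms]) (use J in auto)
next
  assume J: "ideal J R"
  interpret ideal J R by fact
  show "submodule J R (self_module R)"
    by (rule submodule_of_closed[OF module_self_module[OF assms]])
      (use Icarr I_l_closed in \<open>auto simp: zero_closed\<close>)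
qed

lemma noetherian_ring_chain:
  assumes "noetherian_ring R" "\<And>i::nat. ideal (N i) R" "\<And>i. N i \<subseteq> N (Suc i)"
  shows "\<exists>i. \<forall>j\<ge>i. N j = N i"
proof -
  have mono: "N i \<subseteq> N j" if "i \<le> j" for i j using lift_Suc_mono_le[of N] assms(3) that by blast
  have "N i \<subseteq> N j \<or> N j \<subseteq> N i" for i j using mono[of i j] mono[of j i] by linarith
  then have "subset.chain {I. ideal I R} (range N)"
    using assms(2) unfolding subset_chain_def by auto
  then have "\<Union>(range N) \<in> range N" using noetherian_ring.ideal_chain_is_trivial[OF assms(1), of "range N"] by auto
  then obtain i where "\<Union>(range N) = N i" by auto
  then show ?thesis using mono by blast
qed

lemma noetherian_self_module:
  assumes "cring R" "noetherian_ring R"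
  shows "noetherian_subquotient R (self_module R) (carrier R) {\<zero>\<^bsub>R\<^esub>}"
  unfolding noetherian_subquotient_def submodule_self_module_iff[OF assms(1)]
  by (intro allI impI noetherian_ring_chain[OF assms(2)]) simp_all

section \<open>Finitely generated modules over a Noetherian ring\<close>

lemma noetherian_subquotient_self: "noetherian_subquotient R X Z Z"
  unfolding noetherian_subquotient_def
proof (intro allI impI)
  fix N :: "nat \<Rightarrow> _" assume "\<forall>i. submodule (N i) R X \<and> Z \<subseteq> N i \<and> N i \<subseteq> Z \<and> N i \<subseteq> N (Suc i)"
  then have "N i = Z" for i by (simp add: subset_antisym)
  then show "\<exists>i. \<forall>j\<ge>i. N j = N i" by simp
qed

lemma noetherian_subquotient_mono:
  assumes "noetherian_subquotient R X Z B" "Z' \<subseteq> Z"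
  shows "noetherian_subquotient R X Z' B"
  unfolding noetherian_subquotient_def
proof (intro allI impI)
  fix N :: "nat \<Rightarrow> _" assume "\<forall>i. submodule (N i) R X \<and> B \<subseteq> N i \<and> N i \<subseteq> Z' \<and> N i \<subseteq> N (Suc i)"
  then have "\<forall>i. submodule (N i) R X \<and> B \<subseteq> N i \<and> N i \<subseteq> Z \<and> N i \<subseteq> N (Suc i)"
    using assms(2) by (meson subset_trans)
  then show "\<exists>i. \<forall>j\<ge>i. N j = N i" using assms(1) unfolding noetherian_subquotient_def by simp
qed

text \<open>The coefficient ideal is a parameter: for generators of X, \<open>J = carrier R\<close>
  gives X itself, while a smaller ideal \<aa> gives the combinations in which elements of \<aa>X are
  expressed for Nakayama's lemma.\<close>

fun ideal_span :: "('r, 'x) module \<Rightarrow> 'r set \<Rightarrow> 'x list \<Rightarrow> 'x set" where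
  "ideal_span X J [] = {\<zero>\<^bsub>X\<^esub>}"
| "ideal_span X J (m # ms) = {a \<odot>\<^bsub>X\<^esub> m \<oplus>\<^bsub>X\<^esub> y |a y. a \<in> J \<and> y \<in> ideal_span X J ms}"

lemma submodule_cyclic:
  fixes X :: "('r, 'x) module"
  assumes X: "module R X" and J: "ideal J R" and m: "m \<in> carrier X"
  shows "submodule ((\<lambda>a. a \<odot>\<^bsub>X\<^esub> m) ` J) R X"
proof -
  interpret module R X by fact
  interpret J: ideal J R by fact
  have "linear_map R (self_module R) X (\<lambda>a. a \<odot>\<^bsub>X\<^esub> m)"
    unfolding linear_map_def using m by (auto simp: smult_l_distr smult_assoc1)
  then show ?thesis
    by (rule submodule_image[OF module_self_module[OF is_cring] X])
      (simp add: submodule_self_module_iff[OF is_cring] J)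
qed

lemma ideal_span_submodule:
  assumes X: "module R X" and J: "ideal J R" and "set ms \<subseteq> carrier X"
  shows "submodule (ideal_span X J ms) R X"
  using assms(3)
proof (induction ms)
  case Nil
  then show ?case using submodule_zero_singleton[OF X] by simp
next
  case (Cons m ms)
  have "ideal_span X J (m # ms) = {a \<oplus>\<^bsub>X\<^esub> y |a y. a \<in> (\<lambda>a. a \<odot>\<^bsub>X\<^esub> m) ` J \<and> y \<in> ideal_span X J ms}" by auto
  then show ?case using submodule_sum[OF X submodule_cyclic[OF X J]] Cons by simp
qed

lemma ideal_span_mem:
  fixes X (structure)
  assumes X: "module R X" and J: "ideal J R" and "set ms \<subseteq> carrier X"
    and "m \<in> set ms" "a \<in> J"
  shows "a \<odot> m \<in> ideal_span X J ms"
  using assms(3,4)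
proof (induction ms)
  case (Cons n ms)
  interpret module R X by fact
  interpret J: ideal J R by fact
  have ac: "a \<in> carrier R" using J.Icarr assms(5) by simp
  note S = submoduleD[OF ideal_span_submodule[OF X J, of ms]]
  show ?case
  proof (cases "m = n")
    case True
    have "a \<odot> m = a \<odot> n \<oplus> \<zero>" using True Cons.prems ac by simp
    moreover have "\<zero> \<in> ideal_span X J ms" using S(2) Cons.prems by simp
    ultimately show ?thesis using assms(5) unfolding ideal_span.simps by blast
  next
    case False
    then have "a \<odot> m \<in> ideal_span X J ms" using Cons by simp
    moreover from this have "a \<odot> m = \<zero>\<^bsub>R\<^esub> \<odot> n \<oplus> a \<odot> m" using Cons.prems ac by auto
    ultimately show ?thesis using J.zero_closed unfolding ideal_span.simps by blast
  qed
qed simp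

lemma carrier_eq_ideal_span:
  assumes "finitely_generated_module R X"
  obtains ms where "set ms \<subseteq> carrier X" "carrier X = ideal_span X (carrier R) ms"
proof -
  obtain S where X: "module R X" and S: "finite S" "S \<subseteq> carrier X" "module_span R X S = carrier X"
    using assms unfolding finitely_generated_module_def by blast
  interpret module R X by fact
  obtain ms where ms: "set ms = S" using finite_list[OF S(1)] by blast
  have sub: "submodule (ideal_span X (carrier R) ms) R X"
    using ideal_span_submodule[OF X R.oneideal] ms S(2) by simp
  have "S \<subseteq> ideal_span X (carrier R) ms"
  proof
    fix m assume "m \<in> S"
    then show "m \<in> ideal_span X (carrier R) ms"
      using ideal_span_mem[OF X R.oneideal, of ms m "\<one>\<^bsub>R\<^esub>"] ms S(2) by auto
  qed
  then have "carrier X \<subseteq> ideal_span X (carrier R) ms"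
    using sub S(3) unfolding module_span_def by blast
  then have "carrier X = ideal_span X (carrier R) ms" using submodule_carrier[OF sub] by blast
  then show thesis using that[of ms] ms S(2) by simp
qed

text \<open>Each new generator adds a cyclic layer, an image of the ring, on top of the submodule
  spanned by the others.\<close>

lemma noetherian_finitely_generated:
  fixes X (structure)
  assumes R: "noetherian_ring R" and fg: "finitely_generated_module R X"
  shows "noetherian_subquotient R X (carrier X) {\<zero>}"
proof -
  have X: "module R X" using fg unfolding finitely_generated_module_def by blast
  interpret module R X by fact
  obtain ms where ms: "set ms \<subseteq> carrier X" "carrier X = ideal_span X (carrier R) ms"
    using carrier_eq_ideal_span[OF fg] .
  let ?L = "ideal_span X (carrier R)"
  have "noetherian_subquotient R X (?L ms) {\<zero>}" using ms(1)
  proof (induction ms)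
    case Nil
    then show ?case by (simp add: noetherian_subquotient_self)
  next
    case (Cons m ms)
    have m: "m \<in> carrier X" using Cons.prems by simp
    have S: "submodule (?L ms) R X" and S': "submodule (?L (m # ms)) R X"
      using ideal_span_submodule[OF X R.oneideal] Cons.prems by (auto simp del: ideal_span.simps)
    have le: "?L ms \<subseteq> ?L (m # ms)"
    proof
      fix y assume y: "y \<in> ?L ms"
      then have "y = \<zero>\<^bsub>R\<^esub> \<odot> m \<oplus> y" using m submodule_carrier[OF S] by simp
      then show "y \<in> ?L (m # ms)" using y by auto
    qed
    interpret E: exact_subquotients R "self_module R" X X "carrier R" "{\<zero>\<^bsub>R\<^esub>}" "\<lambda>a. a \<odot> m"
      "?L (m # ms)" "?L ms" "\<lambda>x. x" "?L (m # ms)" "?L (m # ms)"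
    proof (intro exact_subquotients.intro exact_subquotients_axioms.intro)
      show "linear_map R (self_module R) X (\<lambda>a. a \<odot> m)"
        unfolding linear_map_def using m by (auto simp: smult_l_distr smult_assoc1)
      show "submodule (carrier R) R (self_module R)"
        by (simp add: submodule_self_module_iff[OF is_cring] R.oneideal)
      show "(\<lambda>a. a \<odot> m) ` {\<zero>\<^bsub>R\<^esub>} \<subseteq> ?L ms" using m submodule_zero[OF S] by simp
      show "\<exists>z1\<in>carrier R. \<exists>b\<in>?L ms. z = z1 \<odot> m \<oplus> b" if "z \<in> ?L (m # ms)" for z
        using that by auto
    qed (use S S' le X module_self_module[OF is_cring] linear_map_id in \<open>auto simp del: ideal_span.simps\<close>)
    have 1: "noetherian_subquotient R X (?L (m # ms)) (?L ms)"
      by (rule E.noetherian_middle[OF noetherian_self_module[OF is_cring R] noetherian_subquotient_self])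
    interpret F: exact_subquotients R X X X "?L ms" "{\<zero>}" "\<lambda>x. x"
      "?L (m # ms)" "{\<zero>}" "\<lambda>x. x" "?L (m # ms)" "?L ms"
    proof (intro exact_subquotients.intro exact_subquotients_axioms.intro)
      show "\<exists>z1\<in>?L ms. \<exists>b\<in>{\<zero>}. z = z1 \<oplus> b" if "z \<in> ?L ms" for z
        using that submodule_carrier[OF S] by simp
    qed (use S S' le X submodule_zero[OF S] submodule_zero_singleton[OF X] linear_map_id in
        \<open>auto simp del: ideal_span.simps\<close>)
    show ?case using F.noetherian_middle 1 Cons by simp
  qed
  then show ?thesis using ms(2) by simp
qed

text \<open>An ideal maximal among those that contain \<open>J\<close> and no power of t is prime:
  for a and b outside p, both p + (a) and p + (b) contain powers of t, whose product would lie in p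
  if ab did.\<close>

lemma prime_avoiding_powers:
  fixes R (structure)
  assumes R: "cring R" "noetherian_ring R" and J: "ideal J R" and t: "t \<in> carrier R"
    and tJ: "\<And>k::nat. t [^] k \<notin> J"
  obtains p where "primeideal p R" "J \<subseteq> p" "t \<notin> p"
proof -
  interpret cring R by fact
  let ?A = "{I. ideal I R \<and> J \<subseteq> I \<and> (\<forall>k::nat. t [^] k \<notin> I)}"
  have "\<exists>p\<in>?A. \<forall>q\<in>?A. p \<subseteq> q \<longrightarrow> q = p"
  proof (rule subset_Zorn)
    fix \<C> assume C: "subset.chain ?A \<C>"
    show "\<exists>U\<in>?A. \<forall>X\<in>\<C>. X \<subseteq> U"
    proof (cases "\<C> = {}")
      case True
      then show ?thesis using J tJ by blast
    next
      case False
      have "subset.chain {I. ideal I R} \<C>" using C unfolding subset_chain_def by blast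
      \<comment> \<open>By the Noetherian property the union of a nonempty chain is one of its
        members, hence an upper bound within the family.\<close>
      then have "\<Union>\<C> \<in> \<C>" using noetherian_ring.ideal_chain_is_trivial[OF R(2) False] by blast
      moreover have "\<C> \<subseteq> ?A" using C unfolding subset_chain_def by blast
      ultimately show ?thesis by blast
    qed
  qed
  then obtain p where p: "ideal p R" "J \<subseteq> p" "\<And>k::nat. t [^] k \<notin> p"
    and max: "\<And>q. ideal q R \<Longrightarrow> J \<subseteq> q \<Longrightarrow> (\<And>k::nat. t [^] k \<notin> q) \<Longrightarrow> p \<subseteq> q \<Longrightarrow> q = p" by auto
  interpret p: ideal p R by fact
  have pow: "\<exists>k::nat. \<exists>u\<in>p. \<exists>s\<in>carrier R. t [^] k = u \<oplus> s \<otimes> a"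
    if a: "a \<in> carrier R" "a \<notin> p" for a
  proof (rule ccontr)
    assume no: "\<not> ?thesis"
    let ?q = "p <+>\<^bsub>R\<^esub> PIdl a"
    have q: "ideal ?q R" by (rule add_ideals[OF p(1) cgenideal_ideal[OF a(1)]])
    have qI: "u \<oplus> s \<otimes> a \<in> ?q" if "u \<in> p" "s \<in> carrier R" for u s
      using that unfolding set_add_def' cgenideal_def by auto
    have "p \<subseteq> ?q"
    proof
      fix u assume u: "u \<in> p"
      then show "u \<in> ?q" using qI[OF u zero_closed] p.Icarr a by simp
    qed
    moreover have "a \<in> ?q" using qI[OF p.zero_closed one_closed] a by simp
    moreover have "t [^] k \<notin> ?q" for k :: nat using no unfolding set_add_def' cgenideal_def by auto
    ultimately show False using max[OF q] p(2) a by blast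
  qed
  have "primeideal p R"
  proof (rule primeidealI[OF p(1) R(1)])
    show "carrier R \<noteq> p" using p(3)[of 0] by auto
    fix a b assume ab: "a \<in> carrier R" "b \<in> carrier R" "a \<otimes> b \<in> p"
    show "a \<in> p \<or> b \<in> p"
    proof (rule ccontr)
      assume "\<not> ?thesis"
      then obtain k l :: nat and u s u' s' where *: "u \<in> p" "s \<in> carrier R" "t [^] k = u \<oplus> s \<otimes> a"
        "u' \<in> p" "s' \<in> carrier R" "t [^] l = u' \<oplus> s' \<otimes> b" using pow ab(1,2) by meson
      have c: "u \<in> carrier R" "u' \<in> carrier R" using * p.Icarr by auto
      have "t [^] (k + l) = (u \<oplus> s \<otimes> a) \<otimes> (u' \<oplus> s' \<otimes> b)"
        using * t by (simp flip: nat_pow_mult)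
      also have "\<dots> = u \<otimes> (u' \<oplus> s' \<otimes> b) \<oplus> ((s \<otimes> a) \<otimes> u' \<oplus> (s \<otimes> s') \<otimes> (a \<otimes> b))"
        using c * ab by (simp add: l_distr r_distr a_ac m_ac)
      also have "\<dots> \<in> p"
        using p.I_r_closed[OF *(1), of "u' \<oplus> s' \<otimes> b"] p.I_l_closed[OF *(4), of "s \<otimes> a"]
          p.I_l_closed[OF ab(3), of "s \<otimes> s'"] *(2,5) ab(1,2) c
        by (intro ideal_add[OF p(1)]) simp_all
      finally show False using p(3) by blast
    qed
  qed
  moreover have "t \<notin> p" using p(3)[of 1] t by simp
  ultimately show thesis using that p(2) by blast
qed


section \<open>Quotient modules\<close>

lemma quotient_module_simps [simp]:
  "carrier (quotient_module X N) = a_rcosets\<^bsub>X\<^esub> N" "\<zero>\<^bsub>quotient_module X N\<^esub> = N"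
  "A \<oplus>\<^bsub>quotient_module X N\<^esub> B = A <+>\<^bsub>X\<^esub> B"
  "r \<odot>\<^bsub>quotient_module X N\<^esub> A = (\<Union>x\<in>A. N +>\<^bsub>X\<^esub> (r \<odot>\<^bsub>X\<^esub> x))"
  unfolding quotient_module_def by simp_all

lemma a_rcosets_iff: "A \<in> a_rcosets\<^bsub>X\<^esub> N \<longleftrightarrow> (\<exists>x\<in>carrier X. A = N +>\<^bsub>X\<^esub> x)"
  unfolding A_RCOSETS_def' by blast

locale quotient = X?: module R X for R and X :: "('r, 'x) module" + fixes N
  assumes N: "submodule N R X"
begin

sublocale ab: abelian_subgroup N X
proof (rule abelian_subgroupI3)
  show "additive_subgroup N X" using submodule.axioms(1)[OF N] by (simp add: additive_subgroup_def)
qed (rule module.axioms(2)[OF X.module_axioms])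

lemma coset_self: "x \<in> carrier X \<Longrightarrow> x \<in> N +>\<^bsub>X\<^esub> x"
  using submodule_zero[OF N] unfolding a_r_coset_def' by force

lemma coset_eq_iff:
  assumes "x \<in> carrier X"
  shows "N +>\<^bsub>X\<^esub> x = N \<longleftrightarrow> x \<in> N"
  using assms coset_self ab.a_rcos_const by auto

lemma coset_add: "x \<in> carrier X \<Longrightarrow> y \<in> carrier X \<Longrightarrow> (N +>\<^bsub>X\<^esub> x) <+>\<^bsub>X\<^esub> (N +>\<^bsub>X\<^esub> y) = N +>\<^bsub>X\<^esub> (x \<oplus>\<^bsub>X\<^esub> y)"
  by (rule ab.a_rcos_sum)

lemma coset_add_mem:
  assumes "n \<in> N" "x \<in> carrier X"
  shows "N +>\<^bsub>X\<^esub> (n \<oplus>\<^bsub>X\<^esub> x) = N +>\<^bsub>X\<^esub> x"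
proof -
  have n: "n \<in> carrier X" using submodule_carrier[OF N assms(1)] .
  have "N +>\<^bsub>X\<^esub> (n \<oplus>\<^bsub>X\<^esub> x) = (N +>\<^bsub>X\<^esub> n) <+>\<^bsub>X\<^esub> (N +>\<^bsub>X\<^esub> x)" using coset_add n assms(2) by simp
  also have "\<dots> = (N +>\<^bsub>X\<^esub> \<zero>\<^bsub>X\<^esub>) <+>\<^bsub>X\<^esub> (N +>\<^bsub>X\<^esub> x)"
    using coset_eq_iff[OF n] coset_eq_iff[of "\<zero>\<^bsub>X\<^esub>"] assms(1) submodule_zero[OF N] by simp
  also have "\<dots> = N +>\<^bsub>X\<^esub> x" using coset_add assms(2) by simp
  finally show ?thesis .
qed

lemma coset_smult:
  assumes r: "r \<in> carrier R" and x: "x \<in> carrier X"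
  shows "r \<odot>\<^bsub>quotient_module X N\<^esub> (N +>\<^bsub>X\<^esub> x) = N +>\<^bsub>X\<^esub> (r \<odot>\<^bsub>X\<^esub> x)"
proof -
  have eq: "N +>\<^bsub>X\<^esub> (r \<odot>\<^bsub>X\<^esub> y) = N +>\<^bsub>X\<^esub> (r \<odot>\<^bsub>X\<^esub> x)" if y: "y \<in> N +>\<^bsub>X\<^esub> x" for y
  proof -
    obtain n where n: "n \<in> N" "y = n \<oplus>\<^bsub>X\<^esub> x" using y unfolding a_r_coset_def' by blast
    have "r \<odot>\<^bsub>X\<^esub> y = r \<odot>\<^bsub>X\<^esub> n \<oplus>\<^bsub>X\<^esub> r \<odot>\<^bsub>X\<^esub> x"
      using n r x submodule_carrier[OF N] by (simp add: X.smult_r_distr)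
    then show ?thesis using coset_add_mem[OF submodule_smult[OF N r n(1)]] r x by simp
  qed
  have "(\<Union>y\<in>N +>\<^bsub>X\<^esub> x. N +>\<^bsub>X\<^esub> (r \<odot>\<^bsub>X\<^esub> y)) = (\<Union>y\<in>N +>\<^bsub>X\<^esub> x. N +>\<^bsub>X\<^esub> (r \<odot>\<^bsub>X\<^esub> x))"
    by (rule SUP_cong[OF refl]) (rule eq)
  also have "\<dots> = N +>\<^bsub>X\<^esub> (r \<odot>\<^bsub>X\<^esub> x)" using coset_self[OF x] by blast
  finally show ?thesis by simp
qed

lemma module_quotient: "module R (quotient_module X N)"
proof (rule moduleI)
  show "abelian_group (quotient_module X N)"
  proof (rule abelian_groupI)
    fix A assume "A \<in> carrier (quotient_module X N)"
    then obtain x where x: "x \<in> carrier X" "A = N +>\<^bsub>X\<^esub> x" by (auto simp: a_rcosets_iff)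
    have N0: "N = N +>\<^bsub>X\<^esub> \<zero>\<^bsub>X\<^esub>" using coset_eq_iff[of "\<zero>\<^bsub>X\<^esub>"] submodule_zero[OF N] by simp
    show "\<zero>\<^bsub>quotient_module X N\<^esub> \<oplus>\<^bsub>quotient_module X N\<^esub> A = A"
      using coset_add[of "\<zero>\<^bsub>X\<^esub>" x] x N0 by simp
    have "(N +>\<^bsub>X\<^esub> (\<ominus>\<^bsub>X\<^esub> x)) <+>\<^bsub>X\<^esub> A = N" using coset_add[of "\<ominus>\<^bsub>X\<^esub> x" x] x N0 by (simp add: X.M.l_neg)
    moreover have "N +>\<^bsub>X\<^esub> (\<ominus>\<^bsub>X\<^esub> x) \<in> a_rcosets\<^bsub>X\<^esub> N" using x by (auto simp: a_rcosets_iff)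
    ultimately show "\<exists>B\<in>carrier (quotient_module X N). B \<oplus>\<^bsub>quotient_module X N\<^esub> A = \<zero>\<^bsub>quotient_module X N\<^esub>"
      by auto
  next
    show "\<zero>\<^bsub>quotient_module X N\<^esub> \<in> carrier (quotient_module X N)"
      using coset_eq_iff[of "\<zero>\<^bsub>X\<^esub>"] submodule_zero[OF N] by (auto simp: a_rcosets_iff)
  qed (auto simp: a_rcosets_iff coset_add X.M.a_ac)
next
  fix r A assume "r \<in> carrier R" "A \<in> carrier (quotient_module X N)"
  then show "r \<odot>\<^bsub>quotient_module X N\<^esub> A \<in> carrier (quotient_module X N)"
    using coset_smult by (auto simp: a_rcosets_iff simp del: quotient_module_simps(4))
next
  fix r s A assume "r \<in> carrier R" "s \<in> carrier R" "A \<in> carrier (quotient_module X N)"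
  then show "(r \<oplus>\<^bsub>R\<^esub> s) \<odot>\<^bsub>quotient_module X N\<^esub> A =
      r \<odot>\<^bsub>quotient_module X N\<^esub> A \<oplus>\<^bsub>quotient_module X N\<^esub> s \<odot>\<^bsub>quotient_module X N\<^esub> A"
    "(r \<otimes>\<^bsub>R\<^esub> s) \<odot>\<^bsub>quotient_module X N\<^esub> A = r \<odot>\<^bsub>quotient_module X N\<^esub> (s \<odot>\<^bsub>quotient_module X N\<^esub> A)"
    by (auto simp: a_rcosets_iff coset_smult coset_add X.smult_l_distr X.smult_assoc1
        simp del: quotient_module_simps(4))
next
  fix r A B assume "r \<in> carrier R" "A \<in> carrier (quotient_module X N)" "B \<in> carrier (quotient_module X N)"
  then show "r \<odot>\<^bsub>quotient_module X N\<^esub> (A \<oplus>\<^bsub>quotient_module X N\<^esub> B) =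
      r \<odot>\<^bsub>quotient_module X N\<^esub> A \<oplus>\<^bsub>quotient_module X N\<^esub> r \<odot>\<^bsub>quotient_module X N\<^esub> B"
    by (auto simp: a_rcosets_iff coset_smult coset_add X.smult_r_distr simp del: quotient_module_simps(4))
next
  fix A assume "A \<in> carrier (quotient_module X N)"
  then show "\<one>\<^bsub>R\<^esub> \<odot>\<^bsub>quotient_module X N\<^esub> A = A"
    by (auto simp: a_rcosets_iff coset_smult simp del: quotient_module_simps(4))
qed (rule is_cring)

text \<open>In a zero localization the fraction (N + x)/1 agrees with 0/1; unfolding this equality
  gives the multiplier.\<close>

lemma not_in_Supp:
  assumes p: "primeideal p R" "p \<notin> Supp R (quotient_module X N)" and x: "x \<in> carrier X"
  shows "\<exists>u\<in>carrier R - p. u \<odot>\<^bsub>X\<^esub> x \<in> N"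
proof -
  let ?Q = "quotient_module X N" and ?A = "N +>\<^bsub>X\<^esub> x"
  interpret Q: module R ?Q by (rule module_quotient)
  interpret p: primeideal p R by fact
  have one: "\<one>\<^bsub>R\<^esub> \<in> carrier R - p" using p.I_notcarr p.one_imp_carrier by auto
  have A: "?A \<in> carrier ?Q" using x by (auto simp: a_rcosets_iff)
  let ?rel = "fraction_rel R p ?Q"
  have "?rel `` {(?A, \<one>\<^bsub>R\<^esub>)} \<in> localization_carrier R p ?Q"
    unfolding localization_carrier_def by (rule quotientI) (use A one in auto)
  then have eq: "?rel `` {(?A, \<one>\<^bsub>R\<^esub>)} = ?rel `` {(\<zero>\<^bsub>?Q\<^esub>, \<one>\<^bsub>R\<^esub>)}" using p unfolding Supp_def by auto
  have "\<one>\<^bsub>R\<^esub> \<odot>\<^bsub>?Q\<^esub> (\<one>\<^bsub>R\<^esub> \<odot>\<^bsub>?Q\<^esub> ?A \<ominus>\<^bsub>?Q\<^esub> \<one>\<^bsub>R\<^esub> \<odot>\<^bsub>?Q\<^esub> ?A) = \<zero>\<^bsub>?Q\<^esub>"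
    unfolding Q.smult_one[OF A] a_minus_def Q.M.r_neg[OF A] using Q.smult_one[OF Q.M.zero_closed] .
  \<comment> \<open>By reflexivity the pair lies in its own class, which is the class of
    zero.\<close>
  then have "((?A, \<one>\<^bsub>R\<^esub>), (?A, \<one>\<^bsub>R\<^esub>)) \<in> ?rel"
    unfolding fraction_rel_def using A one by blast
  then have "(?A, \<one>\<^bsub>R\<^esub>) \<in> ?rel `` {(\<zero>\<^bsub>?Q\<^esub>, \<one>\<^bsub>R\<^esub>)}" unfolding eq[symmetric] by blast
  then obtain u where u: "u \<in> carrier R - p"
    and e: "u \<odot>\<^bsub>?Q\<^esub> (\<one>\<^bsub>R\<^esub> \<odot>\<^bsub>?Q\<^esub> \<zero>\<^bsub>?Q\<^esub> \<ominus>\<^bsub>?Q\<^esub> \<one>\<^bsub>R\<^esub> \<odot>\<^bsub>?Q\<^esub> ?A) = \<zero>\<^bsub>?Q\<^esub>"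
    unfolding fraction_rel_def by blast
  have uA: "u \<odot>\<^bsub>?Q\<^esub> ?A \<in> carrier ?Q" using Q.smult_closed[OF _ A] u by blast
  have "\<ominus>\<^bsub>?Q\<^esub> (u \<odot>\<^bsub>?Q\<^esub> ?A) = \<zero>\<^bsub>?Q\<^esub>"
    using e Q.smult_one[OF A] Q.smult_one[OF Q.M.zero_closed] Q.smult_r_minus[OF _ A, of u] u
      Q.M.l_zero[OF Q.M.a_inv_closed[OF A]]
    unfolding a_minus_def by simp
  then have "u \<odot>\<^bsub>?Q\<^esub> ?A = \<zero>\<^bsub>?Q\<^esub>" using uA Q.M.minus_minus[OF uA] Q.M.add.inv_one by (metis a_inv_def monoid.select_convs(2))
  then have "N +>\<^bsub>X\<^esub> (u \<odot>\<^bsub>X\<^esub> x) = N" using coset_smult[of u x] u x by simp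
  then show ?thesis using coset_eq_iff[of "u \<odot>\<^bsub>X\<^esub> x"] u x by blast
qed

end

section \<open>Support and Nakayama's lemma at a prime\<close>

lemma ideal_span_locally_zero:
  fixes X (structure)
  assumes X: "module R X" and p: "primeideal p R" and J: "ideal J R" and "set ms \<subseteq> carrier X"
    and "\<And>m. m \<in> set ms \<Longrightarrow> \<exists>v\<in>carrier R - p. v \<odot> m = \<zero>" and "y \<in> ideal_span X J ms"
  shows "\<exists>v\<in>carrier R - p. v \<odot> y = \<zero>"
  using assms(4-)
proof (induction ms arbitrary: y)
  case Nil
  interpret module R X by fact
  interpret p: primeideal p R by fact
  have "\<one>\<^bsub>R\<^esub> \<in> carrier R - p" using p.I_notcarr p.one_imp_carrier by auto
  then show ?case using Nil by auto
next
  case (Cons m ms)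
  interpret module R X by fact
  interpret p: primeideal p R by fact
  obtain a z where a: "a \<in> J" and z: "z \<in> ideal_span X J ms" and y: "y = a \<odot> m \<oplus> z" using Cons.prems by auto
  obtain v where v: "v \<in> carrier R - p" "v \<odot> z = \<zero>" using Cons.IH[OF _ _ z] Cons.prems by auto
  obtain u where u: "u \<in> carrier R - p" "u \<odot> m = \<zero>" using Cons.prems(2)[of m] by auto
  have c: "a \<in> carrier R" "m \<in> carrier X" "z \<in> carrier X"
    using ideal.Icarr[OF J a] Cons.prems submodule_carrier[OF ideal_span_submodule[OF X J] z] by auto
  have "(v \<otimes>\<^bsub>R\<^esub> u) \<odot> y = (v \<otimes>\<^bsub>R\<^esub> a) \<odot> (u \<odot> m) \<oplus> u \<odot> (v \<odot> z)"
    unfolding y using c u(1) v(1) by (simp add: smult_r_distr R.m_ac flip: smult_assoc1)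
  then have "(v \<otimes>\<^bsub>R\<^esub> u) \<odot> y = \<zero>" using u v c by simp
  moreover have "v \<otimes>\<^bsub>R\<^esub> u \<in> carrier R - p" using u v p.I_prime by auto
  ultimately show ?case by blast
qed

text \<open>Nakayama's lemma for the localization at \<open>p\<close>, by eliminating one generator at a time.\<close>

lemma nakayama_local:
  fixes X (structure)
  assumes X: "module R X" and p: "primeideal p R" and a: "ideal \<aa> R" "\<aa> \<subseteq> p" and "set ms \<subseteq> carrier X"
    and "\<And>m. m \<in> set ms \<Longrightarrow> \<exists>u\<in>carrier R - p. u \<odot> m \<in> ideal_span X \<aa> ms"
  shows "m \<in> set ms \<Longrightarrow> \<exists>v\<in>carrier R - p. v \<odot> m = \<zero>"
  using assms(5,6)
proof (induction ms arbitrary: m)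
  case (Cons n ms)
  interpret module R X by fact
  interpret p: primeideal p R by fact
  have n: "n \<in> carrier X" and ms: "set ms \<subseteq> carrier X" using Cons.prems by auto
  have ac: "b \<in> carrier R" if "b \<in> \<aa>" for b using ideal.Icarr[OF a(1) that] .
  note S = submoduleD[OF ideal_span_submodule[OF X a(1) ms]]
  obtain u b y where u: "u \<in> carrier R - p" and b: "b \<in> \<aa>" and y: "y \<in> ideal_span X \<aa> ms"
    and e: "u \<odot> n = b \<odot> n \<oplus> y" using Cons.prems(3)[of n] by auto
  \<comment> \<open>Collecting the terms in n leaves the multiplier u - b, which stays outside p
    because b belongs to \<aa>, inside p.\<close>
  define w where "w = u \<ominus>\<^bsub>R\<^esub> b"
  have w: "w \<in> carrier R - p"
  proof -
    have "u \<oplus>\<^bsub>R\<^esub> (\<ominus>\<^bsub>R\<^esub> b) \<notin> p"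
      by (rule ideal_add_notin) (use u b a ideal_neg[OF p.is_ideal] p.is_ideal in auto)
    then show ?thesis unfolding w_def a_minus_def using u ac[OF b] by simp
  qed
  have wn: "w \<odot> n = y"
  proof -
    have "w \<odot> n = u \<odot> n \<ominus> b \<odot> n"
      unfolding w_def a_minus_def using u ac[OF b] n by (simp add: smult_l_distr smult_l_minus)
    also have "\<dots> = y" by (rule diff_solve[OF _ _ _ e]) (use u ac[OF b] n S(1)[OF y] in auto)
    finally show ?thesis .
  qed
  \<comment> \<open>Multiplication by w turns n into the combination y of the remaining generators,
    so n disappears from every relation.\<close>
  have "\<exists>u\<in>carrier R - p. u \<odot> m' \<in> ideal_span X \<aa> ms" if m': "m' \<in> set ms" for m'
  proof -
    obtain u' b' y' where u': "u' \<in> carrier R - p" and b': "b' \<in> \<aa>" and y': "y' \<in> ideal_span X \<aa> ms"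
      and e': "u' \<odot> m' = b' \<odot> n \<oplus> y'" using Cons.prems(3)[of m'] m' by auto
    have "(w \<otimes>\<^bsub>R\<^esub> u') \<odot> m' = w \<odot> (b' \<odot> n \<oplus> y')"
      using w u' m' ms e' by (auto simp: smult_assoc1)
    also have "\<dots> = b' \<odot> y \<oplus> w \<odot> y'"
      unfolding wn[symmetric] using w ac[OF b'] n S(1)[OF y']
      by (simp add: smult_r_distr R.m_comm flip: smult_assoc1)
    also have "\<dots> \<in> ideal_span X \<aa> ms" using S(3)[OF S(6)[OF ac[OF b'] y] S(6)[OF _ y']] w by blast
    finally have "(w \<otimes>\<^bsub>R\<^esub> u') \<odot> m' \<in> ideal_span X \<aa> ms" .
    moreover have "w \<otimes>\<^bsub>R\<^esub> u' \<in> carrier R - p" using w u' p.I_prime by auto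
    ultimately show ?thesis by blast
  qed
  then have IH: "\<exists>v\<in>carrier R - p. v \<odot> m' = \<zero>" if "m' \<in> set ms" for m'
    using Cons.IH[OF that ms] by blast
  show ?case
  proof (cases "m = n")
    case True
    obtain v where v: "v \<in> carrier R - p" "v \<odot> y = \<zero>"
      using ideal_span_locally_zero[OF X p a(1) ms IH y] by blast
    have "(v \<otimes>\<^bsub>R\<^esub> w) \<odot> m = \<zero>" using v w wn n True by (simp add: smult_assoc1)
    moreover have "v \<otimes>\<^bsub>R\<^esub> w \<in> carrier R - p" using w v p.I_prime by auto
    ultimately show ?thesis by blast
  next
    case False
    then show ?thesis using IH Cons.prems(1) by simp
  qed
qed simp

lemma ideal_smult_subset_span:
  fixes X (structure)
  assumes X: "module R X" and a: "ideal \<aa> R" and ms: "set ms \<subseteq> carrier X" "carrier X = ideal_span X (carrier R) ms"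
  shows "ideal_smult R \<aa> X \<subseteq> ideal_span X \<aa> ms"
proof -
  interpret module R X by fact
  have S: "submodule (ideal_span X \<aa> ms) R X" by (rule ideal_span_submodule[OF X a ms(1)])
  have "r \<odot> x \<in> ideal_span X \<aa> ns" if r: "r \<in> \<aa>" and "x \<in> ideal_span X (carrier R) ns" "set ns \<subseteq> carrier X" for r x ns
    using that(2,3)
  proof (induction ns arbitrary: x)
    case Nil
    then show ?case using ideal.Icarr[OF a r] by simp
  next
    case (Cons n ns)
    then obtain s y where sy: "s \<in> carrier R" "y \<in> ideal_span X (carrier R) ns" "x = s \<odot> n \<oplus> y" by auto
    have yc: "y \<in> carrier X"
      using submodule_carrier[OF ideal_span_submodule[OF X R.oneideal] sy(2)] Cons.prems by auto
    have "r \<odot> x = (r \<otimes>\<^bsub>R\<^esub> s) \<odot> n \<oplus> r \<odot> y"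
      unfolding sy(3) using sy(1) yc Cons.prems ideal.Icarr[OF a r] by (simp add: smult_r_distr smult_assoc1)
    moreover have "r \<otimes>\<^bsub>R\<^esub> s \<in> \<aa>" using ideal.I_r_closed[OF a r sy(1)] .
    moreover have "r \<odot> y \<in> ideal_span X \<aa> ns" using Cons.IH[OF sy(2)] Cons.prems by simp
    ultimately show ?case by auto
  qed
  then have "{r \<odot> x |r x. r \<in> \<aa> \<and> x \<in> carrier X} \<subseteq> ideal_span X \<aa> ms" using ms by blast
  then show ?thesis unfolding ideal_smult_def module_span_def using S by blast
qed

lemma ideal_smult_submodule:
  assumes X: "module R X" and a: "ideal \<aa> R"
  shows "submodule (ideal_smult R \<aa> X) R X"
proof -
  interpret module R X by fact
  have "{r \<odot>\<^bsub>X\<^esub> x |r x. r \<in> \<aa> \<and> x \<in> carrier X} \<subseteq> carrier X" using ideal.Icarr[OF a] by auto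
  then have "\<Inter>{N. submodule N R X \<and> {r \<odot>\<^bsub>X\<^esub> x |r x. r \<in> \<aa> \<and> x \<in> carrier X} \<subseteq> N} \<subseteq> carrier X"
    using carrier_is_submodule by blast
  then show ?thesis unfolding ideal_smult_def module_span_def
    by (rule submodule_of_closed[OF X])
      (auto intro: submodule_zero submodule_add submodule_smult)
qed

text \<open>Outside the support of X/\<aa>X, the localizations of X and \<aa>X agree; as \<aa> lies
  in p, Nakayama's lemma makes the localization of X zero.\<close>

lemma locally_zero_if_not_in_Supp:
  fixes X (structure)
  assumes fg: "finitely_generated_module R X" and p: "primeideal p R" and a: "ideal \<aa> R" "\<aa> \<subseteq> p"
    and "p \<notin> Supp R (quotient_module X (ideal_smult R \<aa> X))"
  shows "locally_zero_subquotient R p X (carrier X) {\<zero>}"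
proof -
  have X: "module R X" using fg unfolding finitely_generated_module_def by blast
  interpret module R X by fact
  obtain ms where ms: "set ms \<subseteq> carrier X" "carrier X = ideal_span X (carrier R) ms"
    using carrier_eq_ideal_span[OF fg] .
  interpret Q: quotient R X "ideal_smult R \<aa> X"
    by (intro quotient.intro quotient_axioms.intro X ideal_smult_submodule a)
  have "\<exists>u\<in>carrier R - p. u \<odot> m \<in> ideal_span X \<aa> ms" if "m \<in> set ms" for m
    using Q.not_in_Supp[OF p assms(5), of m] ideal_smult_subset_span[OF X a(1) ms] that ms(1) by blast
  then have kill: "\<exists>v\<in>carrier R - p. v \<odot> m = \<zero>" if "m \<in> set ms" for m
    using nakayama_local[OF X p a ms(1) _ that] by blast
  show ?thesis unfolding locally_zero_subquotient_def
    using ideal_span_locally_zero[OF X p R.oneideal ms(1) kill] ms(2) by auto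
qed


section \<open>Injective modules\<close>

text \<open>For \<open>I\<close> injective, \<open>I = xI + \<Gamma>\<^sub>x(I)\<close>, and this decomposition does not leave the elements
  killed by a given ideal: the map \<open>u + r x\<^sup>s\<^sup>+\<^sup>1 \<mapsto> r x\<^sup>s v\<close> on \<open>Ann v + (x\<^sup>s\<^sup>+\<^sup>1)\<close> is well defined
  once the ideals \<open>Ann (x\<^sup>s v)\<close> have become stationary, and it extends to the ring.\<close>

lemma injective_divide:
  fixes R (structure)
  assumes R: "noetherian_ring R" and inj: "injective_module R X" and v: "v \<in> carrier X" and x: "x \<in> carrier R"
  shows "\<exists>w\<in>carrier X. \<exists>s::nat. (\<forall>r\<in>carrier R. r \<odot>\<^bsub>X\<^esub> v = \<zero>\<^bsub>X\<^esub> \<longrightarrow> r \<odot>\<^bsub>X\<^esub> w = \<zero>\<^bsub>X\<^esub>) \<and>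
    x [^] s \<odot>\<^bsub>X\<^esub> v = x [^] Suc s \<odot>\<^bsub>X\<^esub> w"
proof -
  have X: "module R X" using inj unfolding injective_module_def by blast
  interpret module R X by fact
  have annI: "ideal {r \<in> carrier R. r \<odot>\<^bsub>X\<^esub> y = \<zero>\<^bsub>X\<^esub>} R" if "y \<in> carrier X" for y
    by (rule ideal_of_closed[OF is_cring]) (use that in \<open>auto simp: smult_l_distr smult_assoc1\<close>)
  have "\<exists>s::nat. \<forall>j\<ge>s. {r \<in> carrier R. r \<odot>\<^bsub>X\<^esub> (x [^] j \<odot>\<^bsub>X\<^esub> v) = \<zero>\<^bsub>X\<^esub>} =
      {r \<in> carrier R. r \<odot>\<^bsub>X\<^esub> (x [^] s \<odot>\<^bsub>X\<^esub> v) = \<zero>\<^bsub>X\<^esub>}"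
  proof (rule noetherian_ring_chain[OF R, of "\<lambda>j. {r \<in> carrier R. r \<odot>\<^bsub>X\<^esub> (x [^] j \<odot>\<^bsub>X\<^esub> v) = \<zero>\<^bsub>X\<^esub>}"])
    fix i :: nat
    show "ideal {r \<in> carrier R. r \<odot>\<^bsub>X\<^esub> (x [^] i \<odot>\<^bsub>X\<^esub> v) = \<zero>\<^bsub>X\<^esub>} R" using annI v x by simp
    have "r \<odot>\<^bsub>X\<^esub> (x [^] Suc i \<odot>\<^bsub>X\<^esub> v) = x \<odot>\<^bsub>X\<^esub> (r \<odot>\<^bsub>X\<^esub> (x [^] i \<odot>\<^bsub>X\<^esub> v))" if "r \<in> carrier R" for r
      using that x v by (simp add: R.m_ac flip: smult_assoc1)
    then show "{r \<in> carrier R. r \<odot>\<^bsub>X\<^esub> (x [^] i \<odot>\<^bsub>X\<^esub> v) = \<zero>\<^bsub>X\<^esub>} \<subseteq>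
        {r \<in> carrier R. r \<odot>\<^bsub>X\<^esub> (x [^] Suc i \<odot>\<^bsub>X\<^esub> v) = \<zero>\<^bsub>X\<^esub>}" using x by (auto simp del: nat_pow_Suc)
  qed
  then obtain s where "{r \<in> carrier R. r \<odot>\<^bsub>X\<^esub> (x [^] Suc s \<odot>\<^bsub>X\<^esub> v) = \<zero>\<^bsub>X\<^esub>} =
      {r \<in> carrier R. r \<odot>\<^bsub>X\<^esub> (x [^] s \<odot>\<^bsub>X\<^esub> v) = \<zero>\<^bsub>X\<^esub>}" by (meson le_SucI le_refl)
  then have stab: "r \<odot>\<^bsub>X\<^esub> (x [^] s \<odot>\<^bsub>X\<^esub> v) = \<zero>\<^bsub>X\<^esub>"
    if "r \<in> carrier R" "r \<odot>\<^bsub>X\<^esub> (x [^] Suc s \<odot>\<^bsub>X\<^esub> v) = \<zero>\<^bsub>X\<^esub>" for r using that by blast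
  define A where "A = {r \<in> carrier R. r \<odot>\<^bsub>X\<^esub> v = \<zero>\<^bsub>X\<^esub>}"
  define z where "z = x [^] s \<odot>\<^bsub>X\<^esub> v"
  define t where "t = x [^] Suc s"
  have t: "t \<in> carrier R" and z: "z \<in> carrier X" unfolding t_def z_def using x v by auto
  have A: "ideal A R" unfolding A_def using annI v by simp
  have Ac: "a \<in> carrier R" if "a \<in> A" for a using that unfolding A_def by simp
  define J where "J = {u \<oplus> r \<otimes> t |u r. u \<in> A \<and> r \<in> carrier R}"
  have A0: "\<zero> \<in> A" unfolding A_def using v by simp
  \<comment> \<open>Applied to v, the two expressions show that r - r' kills x^(s+1) v, hence
    already x^s v by stationarity.\<close>
  have wd: "r \<odot>\<^bsub>X\<^esub> z = r' \<odot>\<^bsub>X\<^esub> z"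
    if *: "u \<in> A" "u' \<in> A" "r \<in> carrier R" "r' \<in> carrier R" "u \<oplus> r \<otimes> t = u' \<oplus> r' \<otimes> t" for u u' r r'
  proof -
    have "(u \<oplus> r \<otimes> t) \<odot>\<^bsub>X\<^esub> v = (u' \<oplus> r' \<otimes> t) \<odot>\<^bsub>X\<^esub> v" using * by simp
    then have "r \<odot>\<^bsub>X\<^esub> (t \<odot>\<^bsub>X\<^esub> v) = r' \<odot>\<^bsub>X\<^esub> (t \<odot>\<^bsub>X\<^esub> v)"
      using *(1-4) t v unfolding A_def by (simp add: smult_l_distr smult_assoc1)
    then have "(r \<ominus> r') \<odot>\<^bsub>X\<^esub> (t \<odot>\<^bsub>X\<^esub> v) = \<zero>\<^bsub>X\<^esub>"
      using * t v by (simp add: a_minus_def smult_l_distr smult_l_minus M.r_neg)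
    then have "(r \<ominus> r') \<odot>\<^bsub>X\<^esub> z = \<zero>\<^bsub>X\<^esub>" using stab[of "r \<ominus> r'"] * unfolding t_def z_def by simp
    then have "r \<odot>\<^bsub>X\<^esub> z \<ominus>\<^bsub>X\<^esub> r' \<odot>\<^bsub>X\<^esub> z = \<zero>\<^bsub>X\<^esub>"
      using * z by (simp add: a_minus_def smult_l_distr smult_l_minus)
    then show ?thesis using * z diff_add_cancel[of "r \<odot>\<^bsub>X\<^esub> z" "r' \<odot>\<^bsub>X\<^esub> z"] by simp
  qed
  define g where "g y = (SOME r. r \<in> carrier R \<and> (\<exists>u\<in>A. y = u \<oplus> r \<otimes> t)) \<odot>\<^bsub>X\<^esub> z" for y
  have g: "g (u \<oplus> r \<otimes> t) = r \<odot>\<^bsub>X\<^esub> z" if "u \<in> A" "r \<in> carrier R" for u r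
  proof -
    let ?r = "SOME r'. r' \<in> carrier R \<and> (\<exists>u'\<in>A. u \<oplus> r \<otimes> t = u' \<oplus> r' \<otimes> t)"
    have "?r \<in> carrier R \<and> (\<exists>u'\<in>A. u \<oplus> r \<otimes> t = u' \<oplus> ?r \<otimes> t)"
      by (rule someI[of _ r]) (use that in blast)
    then obtain u' where "u' \<in> A" "?r \<in> carrier R" "u \<oplus> r \<otimes> t = u' \<oplus> ?r \<otimes> t" by blast
    then show ?thesis unfolding g_def using wd[OF \<open>u' \<in> A\<close> that(1) _ that(2)] by simp
  qed
  have add: "(u \<oplus> r \<otimes> t) \<oplus> (u' \<oplus> r' \<otimes> t) = (u \<oplus> u') \<oplus> (r \<oplus> r') \<otimes> t"
    if "u \<in> A" "u' \<in> A" "r \<in> carrier R" "r' \<in> carrier R" for u u' r r'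
    using that Ac t by (simp add: R.l_distr R.a_ac)
  have mul: "b \<otimes> (u \<oplus> r \<otimes> t) = b \<otimes> u \<oplus> (b \<otimes> r) \<otimes> t"
    if "u \<in> A" "r \<in> carrier R" "b \<in> carrier R" for u r b
    using that Ac t by (simp add: R.r_distr R.m_assoc)
  note Acl = ideal_add[OF A] ideal.I_l_closed[OF A]
  have J: "ideal J R"
  proof (rule ideal_of_closed[OF is_cring])
    show "J \<subseteq> carrier R" unfolding J_def using Ac t by auto
    have "\<zero> = \<zero> \<oplus> \<zero> \<otimes> t" using t by simp
    then show "\<zero> \<in> J" unfolding J_def using A0 by blast
    show "a \<oplus> b \<in> J" if ab: "a \<in> J" "b \<in> J" for a b
    proof -
      obtain u r u' r' where *: "u \<in> A" "r \<in> carrier R" "a = u \<oplus> r \<otimes> t"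
        "u' \<in> A" "r' \<in> carrier R" "b = u' \<oplus> r' \<otimes> t" using ab unfolding J_def by blast
      have "a \<oplus> b = (u \<oplus> u') \<oplus> (r \<oplus> r') \<otimes> t" unfolding *(3,6) by (rule add) (use * in auto)
      then show ?thesis unfolding J_def using Acl(1)[OF *(1,4)] *(2,5) by blast
    qed
    show "b \<otimes> a \<in> J" if ba: "b \<in> carrier R" "a \<in> J" for b a
    proof -
      obtain u r where *: "u \<in> A" "r \<in> carrier R" "a = u \<oplus> r \<otimes> t" using ba unfolding J_def by blast
      have "b \<otimes> a = b \<otimes> u \<oplus> (b \<otimes> r) \<otimes> t" unfolding *(3) by (rule mul) (use * that in auto)
      then show ?thesis unfolding J_def using Acl(2)[OF *(1) that(1)] *(2) that(1) by blast
    qed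
  qed
  \<comment> \<open>The inclusion of this ideal into the ring is the test map for
    injectivity.\<close>
  let ?J = "(self_module R)\<lparr>carrier := J\<rparr>"
  have modJ: "module R ?J"
    by (rule submodule.submodule_is_module[OF _ module_self_module[OF is_cring]])
      (simp add: submodule_self_module_iff[OF is_cring] J)
  have "linear_map R ?J X g"
    unfolding linear_map_def
  proof (intro conjI ballI)
    show "g \<in> carrier ?J \<rightarrow> carrier X" using g z by (auto simp: J_def)
    show "g (a \<oplus>\<^bsub>?J\<^esub> b) = g a \<oplus>\<^bsub>X\<^esub> g b" if ab: "a \<in> carrier ?J" "b \<in> carrier ?J" for a b
    proof -
      obtain u r u' r' where *: "u \<in> A" "r \<in> carrier R" "a = u \<oplus> r \<otimes> t"
        "u' \<in> A" "r' \<in> carrier R" "b = u' \<oplus> r' \<otimes> t" using ab unfolding J_def by auto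
      have "g (a \<oplus> b) = (r \<oplus> r') \<odot>\<^bsub>X\<^esub> z"
        unfolding *(3,6) add[OF *(1,4,2,5)] by (rule g) (use * Acl in auto)
      then show ?thesis using * z g by (simp add: smult_l_distr)
    qed
    show "g (b \<odot>\<^bsub>?J\<^esub> a) = b \<odot>\<^bsub>X\<^esub> g a" if ba: "b \<in> carrier R" "a \<in> carrier ?J" for b a
    proof -
      obtain u r where *: "u \<in> A" "r \<in> carrier R" "a = u \<oplus> r \<otimes> t" using ba unfolding J_def by auto
      have "g (b \<otimes> a) = (b \<otimes> r) \<odot>\<^bsub>X\<^esub> z"
        unfolding *(3) mul[OF *(1,2) that(1)] by (rule g) (use * Acl that in auto)
      then show ?thesis using * z g that by (simp add: smult_assoc1)
    qed
  qed
  moreover have "linear_map R ?J (self_module R) (\<lambda>a. a)" unfolding linear_map_def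
    using ideal.Icarr[OF J] by auto
  ultimately have "\<exists>h. linear_map R (self_module R) X h \<and> (\<forall>a\<in>carrier ?J. h a = g a)"
    using inj[unfolded injective_module_def, THEN conjunct2, rule_format, of ?J "self_module R" "\<lambda>a. a" g]
      modJ module_self_module[OF is_cring] by (simp add: inj_on_def)
  then obtain h where h: "linear_map R (self_module R) X h" and hg: "\<And>a. a \<in> J \<Longrightarrow> h a = g a" by auto
  \<comment> \<open>The required w is \<open>h \<one>\<close>: the extension h takes the value r w
    at each r, vanishes on the annihilator of v and equals x^s v at x^(s+1).\<close>
  have hr: "r \<odot>\<^bsub>X\<^esub> h \<one> = h r" if "r \<in> carrier R" for r
    using linear_mapD(3)[OF h, of r "\<one>"] that by simp
  have "r \<odot>\<^bsub>X\<^esub> h \<one> = \<zero>\<^bsub>X\<^esub>" if r: "r \<in> carrier R" "r \<odot>\<^bsub>X\<^esub> v = \<zero>\<^bsub>X\<^esub>" for r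
  proof -
    have rA: "r \<in> A" and e: "r = r \<oplus> \<zero> \<otimes> t" using r t unfolding A_def by auto
    then have "r \<in> J" unfolding J_def by blast
    then have "h r = g (r \<oplus> \<zero> \<otimes> t)" using hg e by simp
    then show ?thesis using g[OF rA] hr[OF r(1)] z by simp
  qed
  moreover have "x [^] s \<odot>\<^bsub>X\<^esub> v = x [^] Suc s \<odot>\<^bsub>X\<^esub> h \<one>"
  proof -
    have e: "t = \<zero> \<oplus> \<one> \<otimes> t" using t by simp
    then have "t \<in> J" unfolding J_def using A0 by blast
    then have "h t = g (\<zero> \<oplus> \<one> \<otimes> t)" using hg e by simp
    then have "h t = z" using g[OF A0] z by simp
    then show ?thesis using hr[OF t] unfolding t_def z_def by simp
  qed
  moreover have "h \<one> \<in> carrier X" using linear_mapD(1)[OF h] by simp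
  ultimately show ?thesis by blast
qed

section \<open>Torsion\<close>

text \<open>Torsion is tested separately for each element, so that enlarging S by one element x cuts
  out the x-torsion and complexes can be compared one element at a time.\<close>

definition power_torsion :: "('r, 'k) ring_scheme \<Rightarrow> 'r set \<Rightarrow> ('r, 'x) module \<Rightarrow> 'x set" where
  "power_torsion R S X = {v \<in> carrier X. \<forall>x\<in>S. \<exists>k::nat. x [^]\<^bsub>R\<^esub> k \<odot>\<^bsub>X\<^esub> v = \<zero>\<^bsub>X\<^esub>}"

lemma power_torsion_submodule:
  fixes X (structure)
  assumes X: "module R X" and S: "S \<subseteq> carrier R"
  shows "submodule (power_torsion R S X) R X"
proof -
  interpret module R X by fact
  show ?thesis
  proof (rule submodule_of_closed[OF X])
    show "power_torsion R S X \<subseteq> carrier X" "\<zero> \<in> power_torsion R S X"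
      unfolding power_torsion_def using S by auto
  next
    fix v w assume v: "v \<in> power_torsion R S X" and w: "w \<in> power_torsion R S X"
    have "\<exists>k::nat. x [^]\<^bsub>R\<^esub> k \<odot> (v \<oplus> w) = \<zero>" if x: "x \<in> S" for x
    proof -
      obtain k :: nat where k: "x [^]\<^bsub>R\<^esub> k \<odot> v = \<zero>"
        using v x unfolding power_torsion_def by blast
      obtain l :: nat where l: "x [^]\<^bsub>R\<^esub> l \<odot> w = \<zero>"
        using w x unfolding power_torsion_def by blast
      have c: "x \<in> carrier R" "v \<in> carrier X" "w \<in> carrier X" using S x v w unfolding power_torsion_def by auto
      have "x [^]\<^bsub>R\<^esub> (k + l) \<odot> (v \<oplus> w) =
          x [^]\<^bsub>R\<^esub> l \<odot> (x [^]\<^bsub>R\<^esub> k \<odot> v) \<oplus> x [^]\<^bsub>R\<^esub> k \<odot> (x [^]\<^bsub>R\<^esub> l \<odot> w)"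
        using c by (simp add: smult_r_distr R.nat_pow_mult add.commute flip: smult_assoc1)
      also have "\<dots> = \<zero>" using k l c by simp
      finally show ?thesis by blast
    qed
    then show "v \<oplus> w \<in> power_torsion R S X" using v w unfolding power_torsion_def by auto
  next
    fix r v assume r: "r \<in> carrier R" and v: "v \<in> power_torsion R S X"
    have "\<exists>k::nat. x [^]\<^bsub>R\<^esub> k \<odot> (r \<odot> v) = \<zero>" if x: "x \<in> S" for x
    proof -
      obtain k :: nat where k: "x [^]\<^bsub>R\<^esub> k \<odot> v = \<zero>" using v x unfolding power_torsion_def by auto
      have c: "x \<in> carrier R" "v \<in> carrier X" using S x v unfolding power_torsion_def by auto
      have "x [^]\<^bsub>R\<^esub> k \<odot> (r \<odot> v) = r \<odot> (x [^]\<^bsub>R\<^esub> k \<odot> v)"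
        using c r by (simp add: R.m_comm flip: smult_assoc1)
      then show ?thesis using k r by auto
    qed
    then show "r \<odot> v \<in> power_torsion R S X" using v r unfolding power_torsion_def by auto
  qed
qed

lemma ideals_set_simps [simp]:
  "\<one>\<^bsub>ideals_set R\<^esub> = carrier R" "A \<otimes>\<^bsub>ideals_set R\<^esub> B = ideal_prod R A B"
  by (simp_all add: ideals_set_def)

lemma ideal_power_simps:
  "ideal_power R J 0 = carrier R" "ideal_power R J (Suc n) = ideal_prod R (ideal_power R J n) J"
  by simp_all

lemma ideal_power_subset:
  assumes "cring R" "ideal J R"
  shows "ideal_power R J n \<subseteq> carrier R"
proof -
  interpret cring R by fact
  have "ideal (ideal_power R J n) R"
    by (induction n) (auto simp: oneideal assms intro: ideal_prod_is_ideal)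
  then show ?thesis by (meson ideal.Icarr subsetI)
qed

lemma ideal_power_annihilates:
  fixes X (structure)
  assumes X: "module R X" and J: "ideal J R" and s: "\<And>s a. s \<in> ideal_power R J n \<Longrightarrow> a \<in> J \<Longrightarrow> (s \<otimes>\<^bsub>R\<^esub> a) \<odot> v = \<zero>"
    and v: "v \<in> carrier X" and r: "r \<in> ideal_power R J (Suc n)"
  shows "r \<odot> v = \<zero>"
proof -
  interpret module R X by fact
  have sub: "ideal_power R J n \<subseteq> carrier R" using ideal_power_subset[OF is_cring J] .
  have "r \<in> ideal_prod R (ideal_power R J n) J" using r by (simp only: ideal_power_simps)
  then have "r \<in> carrier R \<and> r \<odot> v = \<zero>"
    by (induction rule: ideal_prod.induct)
      (use s sub ideal.Icarr[OF J] v in \<open>auto simp: smult_l_distr\<close>)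
  then show ?thesis ..
qed

text \<open>Pigeonhole: if x^(k x) kills v for each generator x, then the ideal power of order 1 +
  sum of the k x kills v. The induction on a bound for that sum passes from v to xv, which lowers
  \<open>k x\<close> by one.\<close>

lemma torsion_part_eq_power_torsion:
  fixes X (structure)
  assumes X: "module R X" and S: "finite S" "S \<subseteq> carrier R" and a: "\<aa> = Idl\<^bsub>R\<^esub> S"
  shows "torsion_part R \<aa> X = power_torsion R S X"
proof -
  interpret module R X by fact
  have aI: "ideal \<aa> R" unfolding a by (rule R.genideal_ideal[OF S(2)])
  have Sa: "S \<subseteq> \<aa>" unfolding a by (rule R.genideal_self[OF S(2)])
  have pow: "x [^]\<^bsub>R\<^esub> n \<in> ideal_power R \<aa> n" if "x \<in> \<aa>" for x and n :: nat
    by (induction n) (use that ideal.Icarr[OF aI that] in \<open>auto intro: ideal_prod.prod\<close>)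
  have kill: "r \<odot> v = \<zero>" if "v \<in> carrier X" "\<And>x. x \<in> S \<Longrightarrow> x [^]\<^bsub>R\<^esub> (k x :: nat) \<odot> v = \<zero>"
      "sum k S \<le> n" "r \<in> ideal_power R \<aa> (Suc n)" for v k n r
    using that
  proof (induction n arbitrary: v k r)
    case (0 v k r)
    show ?case
    proof (rule ideal_power_annihilates[OF X aI _ 0(1,4)])
      fix s b assume s: "s \<in> ideal_power R \<aa> 0" and b: "b \<in> \<aa>"
      \<comment> \<open>All exponents are 0, so v = 0 as soon as S has an element. Arguing through
        the annihilator also covers empty S, where \<aa> is the zero ideal and v need not
        vanish.\<close>
      have "ideal {b \<in> carrier R. b \<odot> v = \<zero>} R"
        by (rule ideal_of_closed[OF is_cring]) (use 0(1) in \<open>auto simp: smult_l_distr smult_assoc1\<close>)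
      moreover have "S \<subseteq> {b \<in> carrier R. b \<odot> v = \<zero>}"
      proof
        fix x assume x: "x \<in> S"
        then have "k x = 0" using 0(3) S(1) by simp
        then have "v = \<zero>" using 0(2)[OF x] 0(1) by simp
        then show "x \<in> {b \<in> carrier R. b \<odot> v = \<zero>}" using x S by auto
      qed
      ultimately have "\<aa> \<subseteq> {b \<in> carrier R. b \<odot> v = \<zero>}" unfolding a by (rule R.genideal_minimal)
      then show "(s \<otimes>\<^bsub>R\<^esub> b) \<odot> v = \<zero>"
        using s b 0(1) by (auto simp: smult_assoc1)
    qed
  next
    case (Suc n v k r)
    show ?case
    proof (rule ideal_power_annihilates[OF X aI _ Suc.prems(1,4)])
      fix s b assume s: "s \<in> ideal_power R \<aa> (Suc n)" and b: "b \<in> \<aa>"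
      have sc: "s \<in> carrier R" using s ideal_power_subset[OF is_cring aI] by blast
      have "ideal {b \<in> carrier R. s \<odot> (b \<odot> v) = \<zero>} R"
      proof (rule ideal_of_closed[OF is_cring])
        fix r x assume r: "r \<in> carrier R" and x: "x \<in> {b \<in> carrier R. s \<odot> (b \<odot> v) = \<zero>}"
        have xc: "x \<in> carrier R" using x by simp
        have "s \<odot> ((r \<otimes>\<^bsub>R\<^esub> x) \<odot> v) = r \<odot> (s \<odot> (x \<odot> v))"
          using sc r xc Suc.prems(1) by (simp add: R.m_ac flip: smult_assoc1)
        then show "r \<otimes>\<^bsub>R\<^esub> x \<in> {b \<in> carrier R. s \<odot> (b \<odot> v) = \<zero>}" using r x by simp
      qed (use sc Suc.prems(1) in \<open>auto simp: smult_l_distr smult_r_distr\<close>)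
      moreover have "S \<subseteq> {b \<in> carrier R. s \<odot> (b \<odot> v) = \<zero>}"
      proof
        fix x assume x: "x \<in> S"
        have xc: "x \<in> carrier R" using x S by blast
        have "s \<odot> (x \<odot> v) = \<zero>"
        proof (cases "k x")
          case 0
          then have "v = \<zero>" using Suc.prems(2)[OF x] Suc.prems(1) by simp
          then show ?thesis using sc xc by simp
        next
          case (Suc m)
          show ?thesis
          proof (rule Suc.IH[where k = "k(x := m)"])
            show "x \<odot> v \<in> carrier X" using xc Suc.prems(1) by simp
            have "sum k S = k x + sum k (S - {x})" using x S(1) by (simp add: sum.remove)
            moreover have "sum (k(x := m)) S = m + sum k (S - {x})"
              using x S(1) by (simp add: sum.remove)
            ultimately show "sum (k(x := m)) S \<le> n" using Suc Suc.prems(3) by simp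
            fix y assume y: "y \<in> S"
            have yc: "y \<in> carrier R" using y S by blast
            show "y [^]\<^bsub>R\<^esub> (k(x := m)) y \<odot> (x \<odot> v) = \<zero>"
            proof (cases "y = x")
              case True
              then show ?thesis
                using Suc.prems(2)[OF x] Suc smult_pow_Suc(1)[OF xc Suc.prems(1), of m] by simp
            next
              case False
              have "y [^]\<^bsub>R\<^esub> k y \<odot> (x \<odot> v) = x \<odot> (y [^]\<^bsub>R\<^esub> k y \<odot> v)"
                using xc yc Suc.prems(1) by (simp add: R.m_comm flip: smult_assoc1)
              then show ?thesis using False Suc.prems(2)[OF y] xc by simp
            qed
          qed (rule s)
        qed
        then show "x \<in> {b \<in> carrier R. s \<odot> (b \<odot> v) = \<zero>}" using xc by simp
      qed
      ultimately have "\<aa> \<subseteq> {b \<in> carrier R. s \<odot> (b \<odot> v) = \<zero>}" unfolding a by (rule R.genideal_minimal)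
      then show "(s \<otimes>\<^bsub>R\<^esub> b) \<odot> v = \<zero>" using sc b Suc.prems(1) by (auto simp: smult_assoc1)
    qed
  qed
  show ?thesis
  proof
    show "torsion_part R \<aa> X \<subseteq> power_torsion R S X"
      unfolding torsion_part_def power_torsion_def using pow Sa by blast
    show "power_torsion R S X \<subseteq> torsion_part R \<aa> X"
    proof
      fix v assume v: "v \<in> power_torsion R S X"
      then have vc: "v \<in> carrier X" unfolding power_torsion_def by simp
      have "\<exists>k. \<forall>x\<in>S. x [^]\<^bsub>R\<^esub> (k x :: nat) \<odot> v = \<zero>"
        by (rule bchoice) (use v in \<open>simp add: power_torsion_def\<close>)
      then obtain k where "\<And>x. x \<in> S \<Longrightarrow> x [^]\<^bsub>R\<^esub> (k x :: nat) \<odot> v = \<zero>" by blast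
      then have "\<forall>r\<in>ideal_power R \<aa> (Suc (sum k S)). r \<odot> v = \<zero>" using kill[OF vc _ order_refl] by blast
      then show "v \<in> torsion_part R \<aa> X" unfolding torsion_part_def using vc by blast
    qed
  qed
qed


section \<open>The complex of a resolution\<close>

text \<open>The resolution, extended by zero in negative degrees.\<close>

definition base_carrier :: "(nat \<Rightarrow> ('r, 'b) module) \<Rightarrow> int \<Rightarrow> 'b set" where
  "base_carrier I q = (if q < 0 then {\<zero>\<^bsub>I (nat q)\<^esub>} else carrier (I (nat q)))"

definition base_module :: "(nat \<Rightarrow> ('r, 'b) module) \<Rightarrow> int \<Rightarrow> ('r, 'b nest) module" where
  "base_module I q =
     \<lparr>carrier = Leaf ` base_carrier I q, monoid.mult = undefined, monoid.one = undefined,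
      ring.zero = Leaf \<zero>\<^bsub>I (nat q)\<^esub>,
      ring.add = (\<lambda>u v. Leaf (the_leaf u \<oplus>\<^bsub>I (nat q)\<^esub> the_leaf v)),
      module.smult = (\<lambda>r u. Leaf (r \<odot>\<^bsub>I (nat q)\<^esub> the_leaf u))\<rparr>"

definition base_map :: "(nat \<Rightarrow> ('r, 'b) module) \<Rightarrow> (nat \<Rightarrow> 'b \<Rightarrow> 'b) \<Rightarrow> int \<Rightarrow> 'b nest \<Rightarrow> 'b nest" where
  "base_map I d q u = Leaf (if q < 0 then \<zero>\<^bsub>I (nat (sc q))\<^esub> else d (nat q) (the_leaf u))"

text \<open>For empty \<open>S\<close> the torsion condition is void and this is the whole
  resolution.\<close>

definition base_set :: "('r, 'k) ring_scheme \<Rightarrow> (nat \<Rightarrow> ('r, 'b) module) \<Rightarrow> 'r set \<Rightarrow> int \<Rightarrow> 'b nest set" where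
  "base_set R I S q = Leaf ` (base_carrier I q \<inter> power_torsion R S (I (nat q)))"

lemma base_module_simps [simp]:
  "carrier (base_module I q) = Leaf ` base_carrier I q"
  "\<zero>\<^bsub>base_module I q\<^esub> = Leaf \<zero>\<^bsub>I (nat q)\<^esub>"
  "u \<oplus>\<^bsub>base_module I q\<^esub> v = Leaf (the_leaf u \<oplus>\<^bsub>I (nat q)\<^esub> the_leaf v)"
  "r \<odot>\<^bsub>base_module I q\<^esub> u = Leaf (r \<odot>\<^bsub>I (nat q)\<^esub> the_leaf u)"
  unfolding base_module_def by simp_all

lemma nat_sc: "q \<ge> 0 \<Longrightarrow> nat (sc q) = Suc (nat q)"
  by (simp add: sc_def)

locale resolution = R?: cring R for R :: "('r, 'k) ring_scheme" (structure) +
  fixes M :: "('r, 'a) module" and \<epsilon> :: "'a \<Rightarrow> 'b" and I :: "nat \<Rightarrow> ('r, 'b) module" and d :: "nat \<Rightarrow> 'b \<Rightarrow> 'b"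
  assumes noeth: "noetherian_ring R" and res: "injective_resolution R M \<epsilon> I d" and modM: "module R M"
begin

lemma inj: "injective_module R (I i)" and lin: "linear_map R (I i) (I (Suc i)) (d i)"
  and eps: "linear_map R M (I 0) \<epsilon>" "\<epsilon> ` carrier M = {x \<in> carrier (I 0). d 0 x = \<zero>\<^bsub>I 1\<^esub>}"
  and ex: "d i ` carrier (I i) = {x \<in> carrier (I (Suc i)). d (Suc i) x = \<zero>\<^bsub>I (Suc (Suc i))\<^esub>}"
  using res unfolding injective_resolution_def by blast+

lemma modI: "module R (I i)"
  using inj unfolding injective_module_def by blast

lemma base_carrier_submodule: "submodule (base_carrier I q) R (I (nat q))"
  unfolding base_carrier_def
  using submodule_zero_singleton[OF modI] module.carrier_is_submodule[OF modI] by simp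

lemma module_base: "module R (base_module I q)"
proof -
  interpret module R "I (nat q)" by (rule modI)
  note B = submoduleD[OF base_carrier_submodule[of q]]
  show ?thesis
  proof (rule moduleI)
    show "abelian_group (base_module I q)"
    proof (rule abelian_groupI)
      fix u assume "u \<in> carrier (base_module I q)"
      then show "\<exists>v\<in>carrier (base_module I q). v \<oplus>\<^bsub>base_module I q\<^esub> u = \<zero>\<^bsub>base_module I q\<^esub>"
        using B(1,4) M.l_neg by fastforce
    qed (use B in \<open>auto simp: M.a_ac\<close>)
  qed (use B in \<open>auto simp: is_cring smult_l_distr smult_r_distr smult_assoc1\<close>)
qed

lemma dd: "v \<in> carrier (I i) \<Longrightarrow> d (Suc i) (d i v) = \<zero>\<^bsub>I (Suc (Suc i))\<^esub>"
  using ex by blast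

lemma d_torsion:
  assumes "v \<in> power_torsion R S (I i)" "S \<subseteq> carrier R"
  shows "d i v \<in> power_torsion R S (I (Suc i))"
proof -
  have v: "v \<in> carrier (I i)" using assms unfolding power_torsion_def by simp
  have "\<exists>k::nat. x [^] k \<odot>\<^bsub>I (Suc i)\<^esub> d i v = \<zero>\<^bsub>I (Suc i)\<^esub>" if x: "x \<in> S" for x
  proof -
    obtain k :: nat where "x [^] k \<odot>\<^bsub>I i\<^esub> v = \<zero>\<^bsub>I i\<^esub>" using assms x unfolding power_torsion_def by auto
    then have "x [^] k \<odot>\<^bsub>I (Suc i)\<^esub> d i v = \<zero>\<^bsub>I (Suc i)\<^esub>"
      using linear_mapD(3)[OF lin, of "x [^] k" v i] v x assms(2) linear_map_zero_neg_diff(1)[OF modI modI lin]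
      by auto
    then show ?thesis by blast
  qed
  then show ?thesis using linear_mapD(1)[OF lin v] unfolding power_torsion_def by simp
qed

lemma base_subcomplex:
  assumes S: "S \<subseteq> carrier R"
  shows "subcomplex R (base_module I) (base_map I d) (base_set R I S)"
proof (rule subcomplex.intro[OF is_cring], rule subcomplex_axioms.intro)
  fix q
  show "module R (base_module I q)" by (rule module_base)
  note l = linear_mapD[OF lin]
  have bc: "q < 0 \<Longrightarrow> base_carrier I q = {\<zero>\<^bsub>I (nat q)\<^esub>}" "q \<ge> 0 \<Longrightarrow> base_carrier I q = carrier (I (nat q))" for q
    unfolding base_carrier_def by auto
  have z: "\<zero>\<^bsub>I (nat q)\<^esub> \<in> base_carrier I q" for q using submodule_zero[OF base_carrier_submodule] .
  have zz: "\<zero>\<^bsub>I i\<^esub> \<oplus>\<^bsub>I i\<^esub> \<zero>\<^bsub>I i\<^esub> = \<zero>\<^bsub>I i\<^esub>" "r \<in> carrier R \<Longrightarrow> r \<odot>\<^bsub>I i\<^esub> \<zero>\<^bsub>I i\<^esub> = \<zero>\<^bsub>I i\<^esub>" for i r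
  proof -
    interpret module R "I i" by (rule modI)
    show "\<zero>\<^bsub>I i\<^esub> \<oplus>\<^bsub>I i\<^esub> \<zero>\<^bsub>I i\<^esub> = \<zero>\<^bsub>I i\<^esub>" "r \<in> carrier R \<Longrightarrow> r \<odot>\<^bsub>I i\<^esub> \<zero>\<^bsub>I i\<^esub> = \<zero>\<^bsub>I i\<^esub>" by auto
  qed
  show "linear_map R (base_module I q) (base_module I (sc q)) (base_map I d q)"
  proof (cases "q < 0")
    case True
    then show ?thesis unfolding linear_map_def base_map_def using z zz by auto
  next
    case False
    then have "base_carrier I (sc q) = carrier (I (Suc (nat q)))" "base_carrier I q = carrier (I (nat q))"
      "nat (sc q) = Suc (nat q)" using bc(2)[of "sc q"] bc(2)[of q] nat_sc[of q] by (auto simp: sc_def)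
    then show ?thesis unfolding linear_map_def base_map_def using False l by auto
  qed
  show "base_map I d (sc q) (base_map I d q u) = \<zero>\<^bsub>base_module I (sc (sc q))\<^esub>"
    if u: "u \<in> carrier (base_module I q)" for u
  proof (cases "q < 0")
    case True
    then show ?thesis using linear_map_zero_neg_diff(1)[OF modI modI lin] nat_sc[of "sc q"]
      by (auto simp: base_map_def)
  next
    case False
    then have "\<not> sc q < 0" "nat (sc q) = Suc (nat q)" "nat (sc (sc q)) = Suc (Suc (nat q))"
      using nat_sc[of q] nat_sc[of "sc q"] by (auto simp: sc_def)
    then show ?thesis using False u dd by (auto simp: base_map_def bc(2))
  qed
  show "submodule (base_set R I S q) R (base_module I q)"
    by (rule submodule_of_closed[OF module_base])
      (use submoduleD[OF base_carrier_submodule[of q]] submoduleD[OF power_torsion_submodule[OF modI S, of "nat q"]]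
        in \<open>auto simp: base_set_def\<close>)
  show "base_map I d q u \<in> base_set R I S (sc q)" if u: "u \<in> base_set R I S q" for u
  proof (cases "q < 0")
    case True
    then show ?thesis using z submodule_zero[OF power_torsion_submodule[OF modI S]]
      by (auto simp: base_map_def base_set_def)
  next
    case False
    then have "base_carrier I (sc q) = carrier (I (Suc (nat q)))" "nat (sc q) = Suc (nat q)"
      using bc(2)[of "sc q"] nat_sc[of q] by (auto simp: sc_def)
    moreover obtain v where v: "u = Leaf v" "v \<in> power_torsion R S (I (nat q))" using u by (auto simp: base_set_def)
    moreover have "d (nat q) v \<in> carrier (I (Suc (nat q)))" using v l(1) by (auto simp: power_torsion_def)
    ultimately show ?thesis using False d_torsion[OF v(2) S] by (auto simp: base_map_def base_set_def)
  qed
qed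

lemma base_pair:
  assumes "S \<subseteq> T" "T \<subseteq> carrier R"
  shows "subcomplex_pair R (base_module I) (base_map I d) (base_set R I S) (base_set R I T)"
  using base_subcomplex[of S] base_subcomplex[of T] assms
  by (intro subcomplex_pair.intro subcomplex_pair_axioms.intro) (auto simp: base_set_def power_torsion_def)

text \<open>Dividing v by x in the injective module gives a w that is again S-torsion, because it is
  killed by whatever kills v, and v - xw is killed by a power of x. Conversely, if a power of x
  kills xv, the next power kills v.\<close>

lemma base_bijective:
  assumes S: "S \<subseteq> carrier R" and x: "x \<in> carrier R"
  shows "bijective_quotient x (base_module I) (base_set R I S) (base_set R I (insert x S))"
  unfolding bijective_quotient_def
proof (intro allI ballI conjI impI)
  fix q u assume "u \<in> base_set R I S q"
  then obtain v where u: "u = Leaf v" and v: "v \<in> base_carrier I q" "v \<in> power_torsion R S (I (nat q))"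
    by (auto simp: base_set_def)
  interpret M: module R "I (nat q)" by (rule modI)
  have vc: "v \<in> carrier (I (nat q))" using v by (simp add: power_torsion_def)
  note T = submoduleD[OF power_torsion_submodule[OF modI S, of "nat q"]]
  note T' = submoduleD[OF power_torsion_submodule[OF modI, of "insert x S" "nat q"]]
  show "\<exists>h\<in>base_set R I S q. \<exists>g\<in>base_set R I (insert x S) q.
      u = x \<odot>\<^bsub>base_module I q\<^esub> h \<oplus>\<^bsub>base_module I q\<^esub> g"
  proof (cases "q < 0")
    case True
    then have v0: "v = \<zero>\<^bsub>I (nat q)\<^esub>" using v by (simp add: base_carrier_def)
    have "Leaf \<zero>\<^bsub>I (nat q)\<^esub> \<in> base_set R I S q" "Leaf \<zero>\<^bsub>I (nat q)\<^esub> \<in> base_set R I (insert x S) q"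
      using T(2) T'(2) S x submodule_zero[OF base_carrier_submodule] by (auto simp: base_set_def)
    moreover have "u = x \<odot>\<^bsub>base_module I q\<^esub> Leaf \<zero>\<^bsub>I (nat q)\<^esub> \<oplus>\<^bsub>base_module I q\<^esub> Leaf \<zero>\<^bsub>I (nat q)\<^esub>"
      using u v0 x by simp
    ultimately show ?thesis by blast
  next
    case False
    obtain w and s :: nat where w: "w \<in> carrier (I (nat q))"
      and ann: "\<And>r. r \<in> carrier R \<Longrightarrow> r \<odot>\<^bsub>I (nat q)\<^esub> v = \<zero>\<^bsub>I (nat q)\<^esub> \<Longrightarrow> r \<odot>\<^bsub>I (nat q)\<^esub> w = \<zero>\<^bsub>I (nat q)\<^esub>"
      and e: "x [^] s \<odot>\<^bsub>I (nat q)\<^esub> v = x [^] Suc s \<odot>\<^bsub>I (nat q)\<^esub> w"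
      using injective_divide[OF noeth inj vc x] by blast
    have wS: "w \<in> power_torsion R S (I (nat q))"
    proof -
      have "\<exists>k::nat. y [^] k \<odot>\<^bsub>I (nat q)\<^esub> w = \<zero>\<^bsub>I (nat q)\<^esub>" if y: "y \<in> S" for y
      proof -
        obtain k :: nat where "y [^] k \<odot>\<^bsub>I (nat q)\<^esub> v = \<zero>\<^bsub>I (nat q)\<^esub>"
          using v(2) y unfolding power_torsion_def by blast
        then show ?thesis using ann[of "y [^] k"] y S by blast
      qed
      then show ?thesis unfolding power_torsion_def using w by blast
    qed
    let ?g = "v \<ominus>\<^bsub>I (nat q)\<^esub> x \<odot>\<^bsub>I (nat q)\<^esub> w"
    have "?g \<in> power_torsion R S (I (nat q))" using T(5)[OF v(2) T(6)[OF x wS]] .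
    moreover have "x [^] s \<odot>\<^bsub>I (nat q)\<^esub> ?g = \<zero>\<^bsub>I (nat q)\<^esub>"
    proof -
      have "x [^] s \<odot>\<^bsub>I (nat q)\<^esub> (x \<odot>\<^bsub>I (nat q)\<^esub> w) = x [^] s \<odot>\<^bsub>I (nat q)\<^esub> v"
        unfolding e using M.smult_pow_Suc(1)[OF x w] by simp
      moreover have "x [^] s \<odot>\<^bsub>I (nat q)\<^esub> ?g =
          x [^] s \<odot>\<^bsub>I (nat q)\<^esub> v \<ominus>\<^bsub>I (nat q)\<^esub> x [^] s \<odot>\<^bsub>I (nat q)\<^esub> (x \<odot>\<^bsub>I (nat q)\<^esub> w)"
        by (rule M.smult_diff) (use vc w x in auto)
      ultimately show ?thesis using vc w x by (simp add: a_minus_def M.M.r_neg)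
    qed
    ultimately have "?g \<in> power_torsion R (insert x S) (I (nat q))" unfolding power_torsion_def by blast
    then have "Leaf ?g \<in> base_set R I (insert x S) q"
      using False T'(1) S x by (auto simp: base_set_def base_carrier_def)
    moreover have "Leaf w \<in> base_set R I S q" using False w wS by (auto simp: base_set_def base_carrier_def)
    moreover have "u = x \<odot>\<^bsub>base_module I q\<^esub> Leaf w \<oplus>\<^bsub>base_module I q\<^esub> Leaf ?g"
      using u M.diff_add_cancel[OF vc, of "x \<odot>\<^bsub>I (nat q)\<^esub> w"] x w vc by (simp add: M.M.a_comm)
    ultimately show ?thesis by blast
  qed
  assume "x \<odot>\<^bsub>base_module I q\<^esub> u \<in> base_set R I (insert x S) q"
  then have "x \<odot>\<^bsub>I (nat q)\<^esub> v \<in> power_torsion R (insert x S) (I (nat q))" using u by (auto simp: base_set_def)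
  then obtain k :: nat where "x [^] k \<odot>\<^bsub>I (nat q)\<^esub> (x \<odot>\<^bsub>I (nat q)\<^esub> v) = \<zero>\<^bsub>I (nat q)\<^esub>"
    unfolding power_torsion_def by blast
  then have "x [^] Suc k \<odot>\<^bsub>I (nat q)\<^esub> v = \<zero>\<^bsub>I (nat q)\<^esub>" using M.smult_pow_Suc(1)[OF x vc] by simp
  then have "v \<in> power_torsion R (insert x S) (I (nat q))" using v(2) unfolding power_torsion_def by blast
  then show "u \<in> base_set R I (insert x S) q" using u v by (auto simp: base_set_def)
qed

text \<open>\<open>S\<close> grows one element at a time; each of them occurs in \<open>xs\<close>,
  so the Koszul complex contains the cone that makes this step acyclic.\<close>

lemma koszul_base_acyclic:
  assumes xs: "set xs \<subseteq> carrier R" and "finite S" "S \<subseteq> set xs"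
  shows "acyclic_quotient (koszul_module xs (base_module I)) (koszul_map xs (base_module I) (base_map I d))
    (koszul_set xs (base_set R I {})) (koszul_set xs (base_set R I S))"
  using assms(2,3)
proof (induction S rule: finite_induct)
  case empty
  interpret B: subcomplex R "base_module I" "base_map I d" "base_set R I {}" by (rule base_subcomplex) simp
  interpret K: subcomplex R "koszul_module xs (base_module I)" "koszul_map xs (base_module I) (base_map I d)"
    "koszul_set xs (base_set R I {})" by (rule B.koszul[OF xs])
  show ?case unfolding acyclic_quotient_def
  proof (intro allI ballI impI)
    fix q f assume f: "f \<in> koszul_set xs (base_set R I {}) q"
    have "f = koszul_map xs (base_module I) (base_map I d) (pd q) \<zero>\<^bsub>koszul_module xs (base_module I) (pd q)\<^esub>
        \<oplus>\<^bsub>koszul_module xs (base_module I) q\<^esub> f"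
      using K.D_zero[of "pd q"] K.Gc[OF f] by (simp add: K.module_simps)
    then show "\<exists>h\<in>koszul_set xs (base_set R I {}) (pd q). \<exists>g\<in>koszul_set xs (base_set R I {}) q.
        f = koszul_map xs (base_module I) (base_map I d) (pd q) h \<oplus>\<^bsub>koszul_module xs (base_module I) q\<^esub> g"
      using f submodule_zero[OF K.sub] by blast
  qed
next
  case (insert x S)
  have S: "S \<subseteq> carrier R" "x \<in> carrier R" "insert x S \<subseteq> carrier R" "x \<in> set xs" "S \<subseteq> set xs"
    using insert.prems xs by auto
  interpret P: subcomplex_pair R "base_module I" "base_map I d" "base_set R I {}" "base_set R I S"
    by (rule base_pair) (use S in auto)
  interpret Q: subcomplex_pair R "base_module I" "base_map I d" "base_set R I S" "base_set R I (insert x S)"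
    by (rule base_pair) (use S in auto)
  show ?case
    by (rule acyclic_quotient_trans[OF P.koszul_pair[OF xs] Q.koszul_pair[OF xs] insert.IH[OF S(5)]
        Q.koszul_acyclic[OF xs S(4) base_bijective[OF S(1,2)]]])
qed

lemma base_cocycles:
  "cocycles (base_module I) (base_map I d) (base_set R I S) (int i) =
    Leaf ` {v \<in> power_torsion R S (I i). d i v = \<zero>\<^bsub>I (Suc i)\<^esub>}"
proof -
  have "nat (sc (int i)) = Suc i" by (simp add: sc_def)
  then show ?thesis
    by (auto simp: cocycles_def base_set_def base_map_def base_carrier_def power_torsion_def)
qed

lemma base_coboundaries:
  assumes "S \<subseteq> carrier R"
  shows "coboundaries (base_map I d) (base_set R I S) (int 0) = {Leaf \<zero>\<^bsub>I 0\<^esub>}"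
    "coboundaries (base_map I d) (base_set R I S) (int (Suc i)) = Leaf ` d i ` power_torsion R S (I i)"
proof -
  \<comment> \<open>Degree -1 is represented by the zero submodule of \<open>I 0\<close>, since
    \<open>nat\<close> truncates; only zero is a coboundary in degree 0.\<close>
  have "pd (int 0) < 0" "nat (pd (int 0)) = 0" by (simp_all add: pd_def)
  then show "coboundaries (base_map I d) (base_set R I S) (int 0) = {Leaf \<zero>\<^bsub>I 0\<^esub>}"
    using submodule_zero[OF power_torsion_submodule[OF modI assms, of 0]]
    by (auto simp: coboundaries_def base_set_def base_map_def base_carrier_def image_iff)
  have "pd (int (Suc i)) = int i" by (simp add: pd_def)
  then show "coboundaries (base_map I d) (base_set R I S) (int (Suc i)) = Leaf ` d i ` power_torsion R S (I i)"
    by (force simp: coboundaries_def base_set_def base_map_def base_carrier_def power_torsion_def image_iff)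
qed

lemma base_vanishing_negative:
  assumes "q < 0" "S \<subseteq> carrier R"
  shows "cocycles (base_module I) (base_map I d) (base_set R I S) q \<subseteq> coboundaries (base_map I d) (base_set R I S) q"
proof -
  interpret B: subcomplex R "base_module I" "base_map I d" "base_set R I S" by (rule base_subcomplex[OF assms(2)])
  have "base_set R I S q \<subseteq> {\<zero>\<^bsub>base_module I q\<^esub>}" using assms(1) by (auto simp: base_set_def base_carrier_def)
  then show ?thesis using submodule_zero[OF B.coboundaries_submodule, of q] unfolding cocycles_def by blast
qed

lemma base_vanishing:
  assumes "q \<noteq> 0"
  shows "cocycles (base_module I) (base_map I d) (base_set R I {}) q \<subseteq> coboundaries (base_map I d) (base_set R I {}) q"
proof (cases "q < 0")
  case True
  then show ?thesis by (rule base_vanishing_negative) simp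
next
  case False
  then obtain i where q: "q = int (Suc i)" using assms by (metis linorder_cases not0_implies_Suc of_nat_0 zero_less_imp_eq_int)
  show ?thesis unfolding q base_cocycles base_coboundaries(2)[OF empty_subsetI] power_torsion_def using ex by auto
qed

text \<open>The augmentation maps M onto the cohomology of the resolution in degree 0; surjectivity
  is encoded by a zero third term.\<close>

lemma base_exact_0:
  "exact_subquotients R M (base_module I 0) (base_module I 0) (carrier M) {\<zero>\<^bsub>M\<^esub>} (\<lambda>m. Leaf (\<epsilon> m))
    (cocycles (base_module I) (base_map I d) (base_set R I {}) 0) (coboundaries (base_map I d) (base_set R I {}) 0)
    (\<lambda>x. x) (cocycles (base_module I) (base_map I d) (base_set R I {}) 0)
    (cocycles (base_module I) (base_map I d) (base_set R I {}) 0)"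
proof -
  interpret B: subcomplex R "base_module I" "base_map I d" "base_set R I {}" by (rule base_subcomplex) simp
  interpret M: module R M by (rule modM)
  show ?thesis
  proof (intro exact_subquotients.intro exact_subquotients_axioms.intro)
    show "linear_map R M (base_module I 0) (\<lambda>m. Leaf (\<epsilon> m))"
      using eps(1) by (auto simp: linear_map_def base_carrier_def)
    show "(\<lambda>m. Leaf (\<epsilon> m)) ` {\<zero>\<^bsub>M\<^esub>} \<subseteq> coboundaries (base_map I d) (base_set R I {}) 0"
      using linear_map_zero_neg_diff(1)[OF modM modI eps(1)] base_coboundaries(1)[of "{}"] by simp
    fix z assume z: "z \<in> cocycles (base_module I) (base_map I d) (base_set R I {}) 0"
    then obtain v where v: "z = Leaf v" "v \<in> carrier (I 0)" "d 0 v = \<zero>\<^bsub>I 1\<^esub>"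
      using base_cocycles[of "{}" 0] by (auto simp: power_torsion_def)
    then obtain m where m: "m \<in> carrier M" "v = \<epsilon> m" using eps(2) by blast
    have "z = Leaf (\<epsilon> m) \<oplus>\<^bsub>base_module I 0\<^esub> \<zero>\<^bsub>base_module I 0\<^esub>"
      using v m submodule_carrier[OF B.cocycles_submodule z] B.module_simps(7)[of z 0] by (simp only:)
    then show "\<exists>z1\<in>carrier M. \<exists>b\<in>coboundaries (base_map I d) (base_set R I {}) 0.
        z = Leaf (\<epsilon> z1) \<oplus>\<^bsub>base_module I 0\<^esub> b"
      using m submodule_zero[OF B.coboundaries_submodule] by blast
  qed (use modM module_base M.carrier_is_submodule B.cocycles_submodule B.coboundaries_submodule
      B.coboundaries_subset linear_map_id in auto)
qed

lemma base_noetherian: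
  assumes "noetherian_subquotient R M (carrier M) {\<zero>\<^bsub>M\<^esub>}"
  shows "noetherian_subquotient R (base_module I q)
    (cocycles (base_module I) (base_map I d) (base_set R I {}) q) (coboundaries (base_map I d) (base_set R I {}) q)"
proof (cases "q = 0")
  case True
  then show ?thesis
    using exact_subquotients.noetherian_middle[OF base_exact_0 assms noetherian_subquotient_self] by simp
next
  case False
  interpret B: subcomplex R "base_module I" "base_map I d" "base_set R I {}" by (rule base_subcomplex) simp
  have "cocycles (base_module I) (base_map I d) (base_set R I {}) q = coboundaries (base_map I d) (base_set R I {}) q"
    using base_vanishing[OF False] B.coboundaries_subset by blast
  then show ?thesis by (simp add: noetherian_subquotient_self)
qed

lemma locally_zero_if_subset:
  assumes "primeideal p R" "module R X" "submodule Z R X" "Z \<subseteq> B"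
  shows "locally_zero_subquotient R p X Z B"
proof -
  interpret p: primeideal p R by fact
  interpret X: module R X by fact
  have "\<one> \<in> carrier R - p" using p.I_notcarr p.one_imp_carrier by auto
  then show ?thesis
    unfolding locally_zero_subquotient_def using submodule_carrier[OF assms(3)] assms(4) by force
qed

lemma base_locally_zero:
  assumes p: "primeideal p R" and "locally_zero_subquotient R p M (carrier M) {\<zero>\<^bsub>M\<^esub>}"
  shows "locally_zero_subquotient R p (base_module I q)
    (cocycles (base_module I) (base_map I d) (base_set R I {}) q) (coboundaries (base_map I d) (base_set R I {}) q)"
proof -
  interpret B: subcomplex R "base_module I" "base_map I d" "base_set R I {}" by (rule base_subcomplex) simp
  note lz = locally_zero_if_subset[OF p module_base B.cocycles_submodule]
  show ?thesis
  proof (cases "q = 0")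
    case True
    then show ?thesis
      using exact_subquotients.locally_zero_middle[OF base_exact_0 p assms(2) lz[OF subset_refl]] by simp
  next
    case False
    then show ?thesis using lz base_vanishing by blast
  qed
qed

end

section \<open>Local cohomology\<close>

text \<open>The coset of a cocycle contains it and must be the zero coset, which is the set of
  coboundaries.\<close>

lemma zero_local_cohomology:
  assumes "module R (I i)" "\<zero>\<^bsub>I i\<^esub> \<in> torsion_coboundaries R \<aa> I d i"
    and "\<not> nonzero_module (local_cohomology R \<aa> I d i)"
  shows "torsion_cocycles R \<aa> I d i \<subseteq> torsion_coboundaries R \<aa> I d i"
proof
  interpret module R "I i" by fact
  fix z assume z: "z \<in> torsion_cocycles R \<aa> I d i"
  then have zc: "z \<in> carrier (I i)" by (simp add: torsion_cocycles_def torsion_part_def)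
  let ?X = "(I i)\<lparr>carrier := torsion_cocycles R \<aa> I d i\<rparr>" and ?B = "torsion_coboundaries R \<aa> I d i"
  have "?B +>\<^bsub>?X\<^esub> z \<in> carrier (local_cohomology R \<aa> I d i)"
    using z unfolding local_cohomology_def by (auto simp: a_rcosets_iff)
  then have "?B +>\<^bsub>?X\<^esub> z = ?B"
    using assms(3) unfolding nonzero_module_def by (simp add: local_cohomology_def)
  moreover have "z \<in> ?B +>\<^bsub>?X\<^esub> z" unfolding a_r_coset_def' using assms(2) zc by force
  ultimately show "z \<in> ?B" by simp
qed

lemma regular_on_Matlis_dual:
  fixes X (structure)
  assumes X: "module R X" and B: "submodule B R X" and x: "x \<in> carrier R"
    and surj: "carrier X \<subseteq> {x \<odot> z \<oplus> b |z b. z \<in> carrier X \<and> b \<in> B}"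
  shows "regular_element R (Matlis_dual R E (quotient_module X B)) x"
proof -
  let ?H = "quotient_module X B"
  interpret Q: quotient R X B by (intro quotient.intro quotient_axioms.intro X B)
  have "f = (\<lambda>K\<in>carrier ?H. \<zero>\<^bsub>E\<^esub>)" if f: "f \<in> extensional (carrier ?H)" "linear_map R ?H E f"
    and xf: "(\<lambda>K\<in>carrier ?H. x \<odot>\<^bsub>E\<^esub> f K) = (\<lambda>K\<in>carrier ?H. \<zero>\<^bsub>E\<^esub>)" for f
  proof
    fix K
    show "f K = (\<lambda>K\<in>carrier ?H. \<zero>\<^bsub>E\<^esub>) K"
    proof (cases "K \<in> carrier ?H")
      case False
      then show ?thesis using f(1) by (simp add: extensional_def)
    next
      case True
      then obtain z where z: "z \<in> carrier X" "K = B +> z" by (auto simp: a_rcosets_iff)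
      then obtain w b where w: "w \<in> carrier X" "b \<in> B" "z = x \<odot> w \<oplus> b" using surj by blast
      have L: "B +> w \<in> carrier ?H" using w by (auto simp: a_rcosets_iff)
      have "z = b \<oplus> x \<odot> w"
        using w x submodule_carrier[OF B] by (simp add: Q.X.M.a_comm)
      then have "K = B +> (x \<odot> w)" using z w x Q.coset_add_mem[OF w(2), of "x \<odot> w"] by simp
      then have "K = x \<odot>\<^bsub>?H\<^esub> (B +> w)" using Q.coset_smult[OF x w(1)] by simp
      then have "f K = x \<odot>\<^bsub>E\<^esub> f (B +> w)" using linear_mapD(3)[OF f(2) x L] by simp
      also have "\<dots> = \<zero>\<^bsub>E\<^esub>" using fun_cong[OF xf, of "B +> w"] L by simp
      finally show ?thesis using True by simp
    qed
  qed
  then show ?thesis unfolding regular_element_def Matlis_dual_def Hom_module_def using x by auto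
qed

lemma annihilator_mod_submodule_ideal:
  assumes X: "module R X" and B: "submodule B R X" and z: "z \<in> carrier X"
  shows "ideal {r \<in> carrier R. r \<odot>\<^bsub>X\<^esub> z \<in> B} R"
proof -
  interpret module R X by fact
  show ?thesis
    by (rule ideal_of_closed[OF is_cring])
      (use submoduleD[OF B] z in \<open>auto simp: smult_l_distr smult_assoc1\<close>)
qed

section \<open>From the Koszul comparison to the regular element\<close>

theorem corollary2p21:
  fixes R :: "('r, 'k) ring_scheme" and \<mm> \<aa> :: "'r set"
    and M :: "('r, 'a) module"
    and I :: "nat \<Rightarrow> ('r, 'b) module" and d :: "nat \<Rightarrow> 'b \<Rightarrow> 'b" and \<epsilon> :: "'a \<Rightarrow> 'b"
    and E :: "('r, 'e) module" and \<iota> :: "'r set \<Rightarrow> 'e"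
    and c :: nat
  assumes "noetherian_local_ring R \<mm>"
    and "adically_complete R \<mm>"
    and "ideal \<aa> R" and "\<aa> \<noteq> carrier R"
    and "injective_resolution R M \<epsilon> I d"
    and "injective_hull R (residue_field_module R \<mm>) \<iota> E"
    and "relative_Cohen_Macaulay R \<aa> M I d"
    and "cohomological_dimension R \<aa> I d = ereal (real c)" and "c > 0"
    and "Supp R (quotient_module M (ideal_smult R \<aa> M)) \<subseteq> prime_zero_locus R \<mm>"
  shows "\<exists>x\<in>\<aa>. regular_element R (Matlis_dual R E (local_cohomology R \<aa> I d c)) x"
proof -
  have R: "cring R" "noetherian_ring R" and m: "maximalideal \<mm> R"
    using assms(1) unfolding noetherian_local_ring_def by auto
  have fg: "finitely_generated_module R M" using assms(7) unfolding relative_Cohen_Macaulay_def by simp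
  then have M: "module R M" unfolding finitely_generated_module_def by simp
  interpret resolution R M \<epsilon> I d
    by (intro resolution.intro resolution_axioms.intro R assms(5) M)
  \<comment> \<open>Generators of \<aa> form the Koszul complex; generators of \<mm>, chosen below,
    serve in Melkersson's criterion for the part of H killed by \<aa>.\<close>
  obtain S where S: "S \<subseteq> carrier R" "finite S" "\<aa> = Idl\<^bsub>R\<^esub> S"
    using noetherian_ring.finetely_gen[OF R(2) assms(3)] by blast
  obtain xs where xs: "set xs = S" using finite_list[OF S(2)] by blast
  have xsc: "set xs \<subseteq> carrier R" using S xs by simp
  have mI: "ideal \<mm> R" using m by (simp add: maximalideal_def)
  obtain T where T: "T \<subseteq> carrier R" "finite T" "\<mm> = Idl\<^bsub>R\<^esub> T"
    using noetherian_ring.finetely_gen[OF R(2) mI] by blast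
  obtain ts where ts: "set ts = T" using finite_list[OF T(2)] by blast
  have tsc: "set ts \<subseteq> carrier R" using T ts by simp

  have tp: "torsion_part R \<aa> (I i) = power_torsion R (set xs) (I i)" for i
    by (rule torsion_part_eq_power_torsion[OF modI]) (use S xs in auto)
  let ?C = "base_module I" and ?D = "base_map I d" and ?G = "base_set R I (set xs)" and ?Full = "base_set R I {}"
  let ?Z = "cocycles ?C ?D ?G" and ?B = "coboundaries ?D ?G"
  have Zeq: "?Z (int i) = Leaf ` torsion_cocycles R \<aa> I d i" for i
    unfolding base_cocycles torsion_cocycles_def tp ..
  have Beq: "?B (int i) = Leaf ` torsion_coboundaries R \<aa> I d i" for i
    using base_coboundaries[OF xsc] by (cases i) (simp_all add: tp del: of_nat_Suc of_nat_0)
  interpret P: subcomplex_pair R ?C ?D ?Full ?G by (rule base_pair) (use xsc in auto)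

  have van: "?Z q \<subseteq> ?B q" if q: "q \<noteq> int c" for q
  proof (cases "q < 0")
    case True
    then show ?thesis using base_vanishing_negative xsc by blast
  next
    case False
    then obtain i where i: "q = int i" using nonneg_int_cases by (metis not_less)
    obtain j where j: "nonzero_module (local_cohomology R \<aa> I d j)"
      "\<And>k. nonzero_module (local_cohomology R \<aa> I d k) \<Longrightarrow> k = j"
      using assms(7) unfolding relative_Cohen_Macaulay_def by blast
    \<comment> \<open>The supremum runs over a singleton, which identifies the unique nonvanishing
      degree with c.\<close>
    have "{ereal (real i) |i. nonzero_module (local_cohomology R \<aa> I d i)} = {ereal (real j)}"
      using j by blast
    then have "j = c" using assms(8) unfolding cohomological_dimension_def by simp
    then have nz: "\<not> nonzero_module (local_cohomology R \<aa> I d i)" using j(2) q i by blast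
    have "\<zero>\<^bsub>?C (int i)\<^esub> \<in> ?B (int i)" by (rule submodule_zero[OF P.S'.coboundaries_submodule])
    then have "\<zero>\<^bsub>I i\<^esub> \<in> torsion_coboundaries R \<aa> I d i" unfolding Beq by auto
    then show ?thesis
      using zero_local_cohomology[OF modI _ nz] unfolding i Zeq Beq by blast
  qed

  let ?KC = "koszul_module xs ?C" and ?KD = "koszul_map xs ?C ?D"
  let ?KZ = "cocycles ?KC ?KD (koszul_set xs ?G)" and ?KB = "coboundaries ?KD (koszul_set xs ?G)"
  interpret K: subcomplex_pair R ?KC ?KD "koszul_set xs ?Full" "koszul_set xs ?G" by (rule P.koszul_pair[OF xsc])
  interpret E: exact_subquotients R "?KC q" "?KC q" "?KC q" "{\<zero>\<^bsub>?KC q\<^esub>}" "{\<zero>\<^bsub>?KC q\<^esub>}" "\<lambda>x. x" "?KZ q" "?KB q" "\<lambda>x. x"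
    "cocycles ?KC ?KD (koszul_set xs ?Full) q" "coboundaries ?KD (koszul_set xs ?Full) q" for q
    by (rule K.acyclic_quotient_exact, rule koszul_base_acyclic[OF xsc]) auto

  \<comment> \<open>The resolution has cohomology only in degree 0 and cones extend downwards, so
    its Koszul cohomology vanishes in degree c > 0. Injectivity passes this on to the torsion
    subcomplex.\<close>
  have "?KZ (int c) \<subseteq> ?KB (int c)"
  proof (rule E.zero_middle)
    show "cocycles ?KC ?KD (koszul_set xs ?Full) (int c) \<subseteq> coboundaries ?KD (koszul_set xs ?Full) (int c)"
      by (rule P.koszul_vanishing_above[OF xsc, of 0]) (use base_vanishing assms(9) in auto)
  qed simp
  then have aH: "?Z (int c) \<subseteq> linear_combinations (?C (int c)) xs (?Z (int c)) (?B (int c))"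
    by (intro P.S'.koszul_top_quotient[OF xsc]) (use van in auto)

  \<comment> \<open>\<open>V\<close> represents the part of H killed by \<aa>.\<close>
  define V where "V = {z \<in> ?Z (int c). \<forall>x\<in>set xs. x \<odot>\<^bsub>?C (int c)\<^esub> z \<in> ?B (int c)}"
  have van': "?Z q \<subseteq> ?B q" if "q < int c" for q using van that by simp
  note bottom = P.S'.koszul_bottom_exact[OF xsc, of "int c", OF van', folded V_def]
  have V: "submodule V R (?C (int c))" by (rule bottom(2))
  have BV: "?B (int c) \<subseteq> V" by (rule bottom(3))
  interpret F: exact_subquotients R "?KC (int c - int (length xs))" "?C (int c)" "?C (int c)"
    "?KZ (int c - int (length xs))" "?KB (int c - int (length xs))" "koszul_top xs" V "?B (int c)" "\<lambda>x. x" V V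
    by (rule bottom(1))
  \<comment> \<open>Finiteness of M passes to the Koszul cohomology of the resolution, then along
    the injection to that of the torsion subcomplex, and from its bottom degree onto V/B.\<close>
  have noethV: "noetherian_subquotient R (?C (int c)) V (?B (int c))"
  proof (rule F.noetherian_middle[OF E.noetherian_middle[OF noetherian_subquotient_self] noetherian_subquotient_self])
    show "noetherian_subquotient R (?KC (int c - int (length xs)))
        (cocycles ?KC ?KD (koszul_set xs ?Full) (int c - int (length xs)))
        (coboundaries ?KD (koszul_set xs ?Full) (int c - int (length xs)))"
      by (rule P.koszul_noetherian[OF xsc base_noetherian[OF noetherian_finitely_generated[OF R(2) fg]]])
  qed
  \<comment> \<open>The support condition enters here: such a p is outside Supp(M/\<aa>M), so M
    vanishes at p, and this spreads along the same route as finiteness.\<close>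
  have locV: "locally_zero_subquotient R p (?C (int c)) V (?B (int c))"
    if p: "primeideal p R" "\<aa> \<subseteq> p" "\<not> \<mm> \<subseteq> p" for p
  proof -
    have "p \<notin> Supp R (quotient_module M (ideal_smult R \<aa> M))"
      using assms(10) p unfolding prime_zero_locus_def by blast
    then have "locally_zero_subquotient R p M (carrier M) {\<zero>\<^bsub>M\<^esub>}"
      by (rule locally_zero_if_not_in_Supp[OF fg p(1) assms(3) p(2)])
    then have "locally_zero_subquotient R p (?KC q)
        (cocycles ?KC ?KD (koszul_set xs ?Full) q) (coboundaries ?KD (koszul_set xs ?Full) q)" for q
      using P.koszul_locally_zero[OF xsc p(1)] base_locally_zero[OF p(1)] by blast
    then have "locally_zero_subquotient R p (?KC q) (?KZ q) (?KB q)" for q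
      by (rule E.locally_zero_middle[OF p(1) locally_zero_if_subset[OF p(1) K.mod
            submodule_zero_singleton[OF K.mod] subset_refl]])
    then show ?thesis
      by (rule F.locally_zero_middle[OF p(1) _ locally_zero_if_subset[OF p(1) P.mod V subset_refl]])
  qed

  note modC = P.mod[of "int c"] and subB = P.S'.coboundaries_submodule[of "int c"]
    and subZ = P.S'.cocycles_submodule[of "int c"]
  \<comment> \<open>Otherwise a prime p contains the annihilator of z modulo coboundaries but not t.
    It contains \<aa>, as z lies in \<open>V\<close>, and not \<mm>, so local vanishing at p gives
    an element of the annihilator outside p.\<close>
  have nilV: "\<exists>k::nat. t [^]\<^bsub>R\<^esub> k \<odot>\<^bsub>?C (int c)\<^esub> z \<in> ?B (int c)" if t: "t \<in> \<mm>" and z: "z \<in> V" for t z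
  proof (rule ccontr)
    assume no: "\<not> ?thesis"
    let ?J = "{r \<in> carrier R. r \<odot>\<^bsub>?C (int c)\<^esub> z \<in> ?B (int c)}"
    have tc: "t \<in> carrier R" using ideal.Icarr[OF mI t] .
    have J: "ideal ?J R"
      by (rule annihilator_mod_submodule_ideal[OF modC subB submodule_carrier[OF V z]])
    obtain p where p: "primeideal p R" "?J \<subseteq> p" "t \<notin> p"
      using prime_avoiding_powers[OF R J tc] no by blast
    have "\<aa> \<subseteq> ?J" unfolding S(3) by (rule genideal_minimal[OF J]) (use z S xs in \<open>auto simp: V_def\<close>)
    then have "locally_zero_subquotient R p (?C (int c)) V (?B (int c))" using locV p t by blast
    then obtain u where "u \<in> carrier R - p" "u \<odot>\<^bsub>?C (int c)\<^esub> z \<in> ?B (int c)"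
      using z unfolding locally_zero_subquotient_def by blast
    then show False using p(2) by blast
  qed
  \<comment> \<open>The part of V/B killed by \<mm>: a finite-dimensional vector space, from which
    Melkersson's criterion recovers the \<mm>-torsion V/B.\<close>
  let ?W = "{z \<in> V. \<forall>t\<in>set ts. t \<odot>\<^bsub>?C (int c)\<^esub> z \<in> ?B (int c)}"
  have W_kill: "r \<odot>\<^bsub>?C (int c)\<^esub> z \<in> ?B (int c)" if r: "r \<in> \<mm>" and z: "z \<in> ?W" for r z
  proof -
    have "ideal {r \<in> carrier R. r \<odot>\<^bsub>?C (int c)\<^esub> z \<in> ?B (int c)} R"
      by (rule annihilator_mod_submodule_ideal[OF modC subB]) (use z submodule_carrier[OF V] in auto)
    then have "\<mm> \<subseteq> {r \<in> carrier R. r \<odot>\<^bsub>?C (int c)\<^esub> z \<in> ?B (int c)}"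
      unfolding T(3) by (rule genideal_minimal) (use z T ts in auto)
    then show ?thesis using r by blast
  qed
  have artV: "artinian_subquotient R (?C (int c)) V (?B (int c))"
  proof (rule artinian_if_torsion[OF modC V subB BV tsc])
    show "\<exists>k::nat. t [^]\<^bsub>R\<^esub> k \<odot>\<^bsub>?C (int c)\<^esub> z \<in> ?B (int c)" if "t \<in> set ts" "z \<in> V" for t z
      using nilV[of t z] that genideal_self[OF T(1)] T(3) ts by blast
    have subW: "submodule ?W R (?C (int c))" by (rule submodule_colon[OF modC V subB tsc])
    show "artinian_subquotient R (?C (int c)) ?W (?B (int c))"
    proof (rule artinian_if_noetherian_over_field[OF modC subW subB _ m W_kill])
      show "?B (int c) \<subseteq> ?W" using BV submodule_smult[OF subB] tsc by blast
      show "noetherian_subquotient R (?C (int c)) ?W (?B (int c))"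
        by (rule noetherian_subquotient_mono[OF noethV]) blast
    qed
  qed
  \<comment> \<open>The second use of the criterion, now for the generators of \<aa>: H is
    \<aa>-torsion since it is computed from torsion elements, and its part killed by \<aa> is
    V/B.\<close>
  have art: "artinian_subquotient R (?C (int c)) (?Z (int c)) (?B (int c))"
  proof (rule artinian_if_torsion[OF modC subZ subB P.S'.coboundaries_subset xsc])
    show "artinian_subquotient R (?C (int c)) {z \<in> ?Z (int c). \<forall>t\<in>set xs. t \<odot>\<^bsub>?C (int c)\<^esub> z \<in> ?B (int c)} (?B (int c))"
      using artV unfolding V_def .
    fix x z assume x: "x \<in> set xs" and "z \<in> ?Z (int c)"
    then obtain v where v: "z = Leaf v" "v \<in> power_torsion R (set xs) (I c)" unfolding base_cocycles by auto
    then obtain k :: nat where "x [^]\<^bsub>R\<^esub> k \<odot>\<^bsub>I c\<^esub> v = \<zero>\<^bsub>I c\<^esub>" using x unfolding power_torsion_def by blast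
    then have "x [^]\<^bsub>R\<^esub> k \<odot>\<^bsub>?C (int c)\<^esub> z = \<zero>\<^bsub>?C (int c)\<^esub>" using v by simp
    then show "\<exists>k::nat. x [^]\<^bsub>R\<^esub> k \<odot>\<^bsub>?C (int c)\<^esub> z \<in> ?B (int c)" using submodule_zero[OF subB] by metis
  qed

  obtain x where x: "x \<in> \<aa>"
    and surj: "?Z (int c) \<subseteq> {x \<odot>\<^bsub>?C (int c)\<^esub> z \<oplus>\<^bsub>?C (int c)\<^esub> b |z b. z \<in> ?Z (int c) \<and> b \<in> ?B (int c)}"
    using artinian_exists_surjective[OF modC subZ subB P.S'.coboundaries_subset art assms(3) _ aH]
      genideal_self[OF S(1)] S(3) xs by blast
  let ?z = "torsion_cocycles R \<aa> I d c" and ?b = "torsion_coboundaries R \<aa> I d c"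
  have surj': "?z \<subseteq> {x \<odot>\<^bsub>I c\<^esub> z \<oplus>\<^bsub>I c\<^esub> b |z b. z \<in> ?z \<and> b \<in> ?b}"
  proof
    fix z assume "z \<in> ?z"
    then have "Leaf z \<in> ?Z (int c)" unfolding Zeq by blast
    then obtain u v where "Leaf z = x \<odot>\<^bsub>?C (int c)\<^esub> u \<oplus>\<^bsub>?C (int c)\<^esub> v" "u \<in> ?Z (int c)" "v \<in> ?B (int c)"
      using surj by blast
    then obtain y b where "z = x \<odot>\<^bsub>I c\<^esub> y \<oplus>\<^bsub>I c\<^esub> b" "y \<in> ?z" "b \<in> ?b" unfolding Zeq Beq by auto
    then show "z \<in> {x \<odot>\<^bsub>I c\<^esub> z \<oplus>\<^bsub>I c\<^esub> b |z b. z \<in> ?z \<and> b \<in> ?b}" by blast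
  qed
  have leafD: "submodule N R (I c)" if N: "submodule (Leaf ` N) R (?C (int c))" for N
  proof -
    note n = submoduleD[OF N]
    show ?thesis
    proof (rule submodule_of_closed[OF modI])
      show "N \<subseteq> carrier (I c)" using n(1) by (auto simp: base_carrier_def)
      show "\<zero>\<^bsub>I c\<^esub> \<in> N" using n(2) by auto
      show "y \<oplus>\<^bsub>I c\<^esub> z \<in> N" if "y \<in> N" "z \<in> N" for y z using n(3)[of "Leaf y" "Leaf z"] that by auto
      show "r \<odot>\<^bsub>I c\<^esub> z \<in> N" if "r \<in> carrier R" "z \<in> N" for r z using n(6)[of r "Leaf z"] that by auto
    qed
  qed
  have subz: "submodule ?z R (I c)" and subb: "submodule ?b R (I c)"
    using subZ subB unfolding Zeq Beq by (auto intro: leafD)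
  have bz: "?b \<subseteq> ?z" using P.S'.coboundaries_subset[of "int c"] unfolding Zeq Beq by auto
  let ?X = "(I c)\<lparr>carrier := ?z\<rparr>"
  have X: "module R ?X" by (rule submodule.submodule_is_module[OF subz modI])
  have "submodule ?b R ?X"
    by (rule submodule_of_closed[OF X]) (use bz submoduleD[OF subb] in auto)
  then have "regular_element R (Matlis_dual R E (quotient_module ?X ?b)) x"
    by (rule regular_on_Matlis_dual[OF X]) (use surj' x ideal.Icarr[OF assms(3)] in auto)
  then show ?thesis using x unfolding local_cohomology_def by blast
qed

end
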